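(* Let $d\geq 2$, let $\psi$ satisfy Assumption (A) below, and let $f\in\operatorname{BV}(\mathbb{R}^d)$ have bounded support. For $\alpha>0$ let $u_{\alpha,0}$ be the unique minimizer of $u\mapsto\int_{\mathbb{R}^d}\psi(u-f)\,dx+\alpha\operatorname{TV}(u)$ over $\operatorname{BV}(\mathbb{R}^d)$. For $s>0$ put $E^s_\alpha=\{u_{\alpha,0}>s\}$, $G^s=\{f>s\}$, and for $s<0$ put $E^s_\alpha=\{u_{\alpha,0}<s\}$, $G^s=\{f<s\}$. Let $s\neq 0$ be such that $|E^s_\alpha\,\Delta\, G^s|\to 0$ as $\alpha\to0$, and such that $$\lim_{\nu\to0}d_H(G^s,G^{s+\nu})=0\quad\text{and}\quad\lim_{\nu\to 0}d_H(\mathbb{R}^d\setminus G^s,\mathbb{R}^d\setminus G^{s+\nu})=0.$$ Then $d_H(\partial E^s_\alpha,\partial G^s)\to 0$ as $\alpha\to 0$.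
   Context: $\operatorname{TV}(u)=\sup\{\int u\,\operatorname{div} z\,dx: z\in C_c^\infty(\mathbb{R}^d;\mathbb{R}^d),\ \|z\|_\infty\leq 1\}$; $\operatorname{BV}(\mathbb{R}^d)=\{u\in L^1_{loc}(\mathbb{R}^d):\operatorname{TV}(u)<\infty\}$. Assumption (A): $\psi:\mathbb{R}\to\mathbb{R}$ is strictly convex, even, $\psi(0)=0$, its Fenchel conjugate $\psi^\ast$ is uniformly convex, and $|\psi(s)|\leq C|s|^{d/(d-1)}$ for some $C>0$. Convention: every measurable set $E$ is identified with the representative whose topological boundary is $\partial E=\{x: 0<|E\cap B(x,r)|/|B(x,r)|<1 \text{ for all } r>0\}$. $d_H(E,F)=\max\{\sup_{x\in E}\operatorname{dist}(x,F),\sup_{y\in F}\operatorname{dist}(y,E)\}$ is the Hausdorff distance. *)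

theory Defs
  imports "HOL-Analysis.Analysis"
begin

definition strictly_convex :: "(real \<Rightarrow> real) \<Rightarrow> bool" where
  "strictly_convex g \<longleftrightarrow>
     (\<forall>x y l. x \<noteq> y \<and> 0 < l \<and> l < 1 \<longrightarrow>
        g (l * x + (1 - l) * y) < l * g x + (1 - l) * g y)"

definition fenchel_conj :: "(real \<Rightarrow> real) \<Rightarrow> real \<Rightarrow> ereal" where
  "fenchel_conj g t = (SUP s. ereal (s * t - g s))"

text \<open>Uniform convexity of an extended-real valued function (Zalinescu):
  there is a modulus delta with delta 0 = 0 and delta t > 0 for t > 0.\<close>
definition uniformly_convex :: "(real \<Rightarrow> ereal) \<Rightarrow> bool" where
  "uniformly_convex h \<longleftrightarrow>
     (\<exists>\<delta>::real \<Rightarrow> real. \<delta> 0 = 0 \<and> (\<forall>t>0. \<delta> t > 0) \<and>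
       (\<forall>x y l. 0 < l \<and> l < 1 \<longrightarrow>
          h (l * x + (1 - l) * y) + ereal (l * (1 - l) * \<delta> \<bar>x - y\<bar>)
            \<le> ereal l * h x + ereal (1 - l) * h y))"

definition assumptionA :: "nat \<Rightarrow> (real \<Rightarrow> real) \<Rightarrow> bool" where
  "assumptionA d \<psi> \<longleftrightarrow>
     strictly_convex \<psi> \<and> (\<forall>s. \<psi> (- s) = \<psi> s) \<and> \<psi> 0 = 0 \<and>
     uniformly_convex (fenchel_conj \<psi>) \<and>
     (\<exists>C>0. \<forall>s. \<bar>\<psi> s\<bar> \<le> C * \<bar>s\<bar> powr (real d / (real d - 1)))"

fun iter_partial :: "('a::euclidean_space \<Rightarrow> 'b::real_normed_vector) \<Rightarrow> 'a list \<Rightarrow> 'a \<Rightarrow> 'b" where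
  "iter_partial f [] = f"
| "iter_partial f (v # vs) = (\<lambda>x. frechet_derivative (iter_partial f vs) (at x) v)"

definition smooth :: "('a::euclidean_space \<Rightarrow> 'b::real_normed_vector) \<Rightarrow> bool" where
  "smooth f \<longleftrightarrow> (\<forall>vs. set vs \<subseteq> Basis \<longrightarrow> (\<forall>x. iter_partial f vs differentiable at x))"

definition divergence :: "('a::euclidean_space \<Rightarrow> 'a) \<Rightarrow> 'a \<Rightarrow> real" where
  "divergence z x = (\<Sum>i\<in>Basis. frechet_derivative z (at x) i \<bullet> i)"

definition test_fields :: "('a::euclidean_space \<Rightarrow> 'a) set" where
  "test_fields = {z. smooth z \<and> bounded {x. z x \<noteq> 0} \<and> (\<forall>x. norm (z x) \<le> 1)}"

definition TV :: "('a::euclidean_space \<Rightarrow> real) \<Rightarrow> ereal" where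
  "TV u = (SUP z\<in>test_fields. ereal (\<integral>x. u x * divergence z x \<partial>lebesgue))"

definition L1_loc :: "('a::euclidean_space \<Rightarrow> real) \<Rightarrow> bool" where
  "L1_loc u \<longleftrightarrow> u \<in> borel_measurable lebesgue \<and>
     (\<forall>K. compact K \<longrightarrow> set_integrable lebesgue K u)"

definition BV :: "('a::euclidean_space \<Rightarrow> real) set" where
  "BV = {u. L1_loc u \<and> TV u < \<infinity>}"

definition energy :: "(real \<Rightarrow> real) \<Rightarrow> ('a::euclidean_space \<Rightarrow> real) \<Rightarrow> real
    \<Rightarrow> ('a \<Rightarrow> real) \<Rightarrow> ereal" where
  "energy \<psi> f \<alpha> u =
     enn2ereal (\<integral>\<^sup>+ x. ennreal (\<psi> (u x - f x)) \<partial>lebesgue) + ereal \<alpha> * TV u"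

definition levelset :: "('a \<Rightarrow> real) \<Rightarrow> real \<Rightarrow> 'a set" where
  "levelset g t = (if t > 0 then {x. g x > t} else {x. g x < t})"

definition mboundary :: "'a::euclidean_space set \<Rightarrow> 'a set" where
  "mboundary E = {x. \<forall>r>0. 0 < measure lebesgue (E \<inter> ball x r) / measure lebesgue (ball x r)
                       \<and> measure lebesgue (E \<inter> ball x r) / measure lebesgue (ball x r) < 1}"

text \<open>A representative of (the a.e.-class of) E whose topological boundary is mboundary E.\<close>
definition canon :: "'a::euclidean_space set \<Rightarrow> 'a set" where
  "canon E = {x. \<exists>r>0. emeasure lebesgue (ball x r - E) = 0} \<union> (E \<inter> mboundary E)"

definition infdist_e :: "'a::metric_space \<Rightarrow> 'a set \<Rightarrow> ereal" where
  "infdist_e x B = (INF y\<in>B. ereal (dist x y))"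

definition hausdist :: "'a::metric_space set \<Rightarrow> 'a set \<Rightarrow> ereal" where
  "hausdist A B = (if A = {} \<and> B = {} then 0 else
      max (SUP x\<in>A. infdist_e x B) (SUP y\<in>B. infdist_e y A))"

end

theory Submission
  imports Defs
begin

text \<open>
  A minimizer obeys a local comparison principle: if \<open>f \<le> t - \<nu>\<close> almost everywhere on a ball of radius
  \<open>r\<close> and \<open>\<alpha>\<close> is small compared with \<open>r \<psi>(\<nu>) / \<nu>\<close>, then \<open>u\<^sub>\<alpha> \<le> t\<close> almost everywhere on that ball.
  The competitor is \<open>v = u - \<eta> (u - t)\<^sup>+\<close> with \<open>\<eta> = ((1 - \<bar>x - c\<bar>\<^sup>2 / r\<^sup>2)\<^sup>+)\<^sup>2\<close>. By convexity it lowers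
  the fidelity term by at least \<open>\<psi>(\<nu>) / \<nu>\<close> times \<open>\<integral> \<eta> (u - t)\<^sup>+\<close>, while
  \<open>TV(v) \<le> TV(u) + (d + 4) / r \<integral> \<eta> (u - t)\<^sup>+\<close>. The latter is a calibration argument with the field
  \<open>\<eta> (x - c) / r\<close>, carried out for mollifications of \<open>u\<close>; no coarea formula, isoperimetric inequality
  or density estimate is needed.

  If a point of \<open>\<partial>E\<close> is far from \<open>\<partial>G\<close>, a ball around it is, up to null sets, contained in \<open>G\<close> or disjoint from \<open>G\<close>;
  the Hausdorff continuity of the level sets of \<open>f\<close> then puts \<open>f\<close> strictly on one side of \<open>s\<close> on a
  smaller ball, and the comparison principle contradicts the choice of the point. Conversely, if a point
  of the compact set \<open>\<partial>G\<close> is far from \<open>\<partial>E\<close>, the symmetric difference has measure bounded below.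
\<close>

section \<open>Smooth bump functions\<close>

text \<open>A plain cutoff leaves the term \<open>\<integral> |grad \<eta>| (u - t)^+\<close>, and
  near the sphere \<open>|grad \<eta>|\<close> is not bounded by a multiple of
  \<open>\<eta>\<close>. But the gradient points towards \<open>c\<close>, so the divergence of
  \<open>W = \<eta> (x - c) / r\<close> contains \<open>- |grad \<eta>| |x - c| / r\<close>. This
  cancels the bad term up to the factor \<open>1 - |x - c| / r\<close>, which the square in
  \<open>\<eta>\<close> absorbs. In the constant, \<open>d\<close> is the divergence of
  \<open>x - c\<close>, and 4 comes from the gradient of the squared profile. The field
  \<open>W\<close> costs nothing in the constraint: where \<open>u > t\<close>, the truncation keeps
  only the share \<open>1 - \<eta>\<close> of the gradient of \<open>u\<close>, so a test field
  \<open>z\<close> for \<open>v\<close> becomes \<open>(1 - \<eta>) z - W\<close> for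
  \<open>u\<close>, of norm at most \<open>1 - \<eta> + \<eta> = 1\<close>. All this uses pointwise
  gradients, which \<open>u\<close> does not have. Mollification with an even kernel is
  self-adjoint: the gradient of the mollified function tested with a field equals, up to sign, the
  function tested with the divergence of the mollified field. The latter field is admissible, so
  \<open>TV u\<close> enters directly as a supremum.\<close>

definition flat :: "nat \<Rightarrow> real \<Rightarrow> real" where
  "flat k t = (if t > 0 then (1 / t) ^ k * exp (- (1 / t)) else 0)"

lemma flat_tendsto_0: "(flat k \<longlongrightarrow> 0) (at 0)"
proof -
  have "((\<lambda>t::real. (1 / t) ^ k * exp (- (1 / t))) \<longlongrightarrow> 0) (at_right 0)"
    using filterlim_compose[OF tendsto_power_div_exp_0[of k] filterlim_inverse_at_top_right]
    by (simp add: exp_minus divide_inverse)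
  then have "(flat k \<longlongrightarrow> 0) (at_right 0)"
    by (rule Lim_transform_eventually)
       (auto simp: flat_def eventually_at_filter intro!: always_eventually)
  moreover have "(flat k \<longlongrightarrow> 0) (at_left 0)"
    by (rule Lim_transform_eventually[OF tendsto_const])
       (auto simp: flat_def eventually_at_filter intro!: always_eventually)
  ultimately show ?thesis
    by (simp add: filterlim_split_at)
qed

text \<open>The powers of \<open>1 / t\<close> are carried along for this formula: differentiation
  stays in the span of the family, so all derivatives of the classical
  \<open>exp (- (1 / t))\<close>, extended by zero, are covered at once.\<close>

lemma flat_has_derivative:
  "(flat k has_real_derivative flat (k + 2) t - real k * flat (k + 1) t) (at t)"
proof -
  consider "t > 0" | "t < 0" | "t = 0" by linarith
  then show ?thesis
  proof cases
    case 1
    have "((\<lambda>t. (1 / t) ^ k * exp (- (1 / t))) has_real_derivative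
        flat (k + 2) t - real k * flat (k + 1) t) (at t)"
    proof -
      have k: "real k * (1 / t) ^ (k - Suc 0) = real k * (1 / t) ^ k * t"
        using 1 by (cases k) auto
      have "((\<lambda>t. (1 / t) ^ k * exp (- (1 / t))) has_real_derivative
          real k * (1 / t) ^ (k - Suc 0) * (- (1 / t\<^sup>2)) * exp (- (1 / t))
            + (1 / t) ^ k * (exp (- (1 / t)) * (1 / t\<^sup>2))) (at t)"
        using 1 by (auto intro!: derivative_eq_intros simp: power2_eq_square)
      then show ?thesis
        unfolding k using 1 by (simp add: flat_def power2_eq_square algebra_simps)
    qed
    then show ?thesis
      by (rule has_field_derivative_transform_within_open[of _ _ _ "{0<..}"])
         (use 1 in \<open>auto simp: flat_def\<close>)
  next
    case 2
    have "((\<lambda>t. 0) has_real_derivative flat (k + 2) t - real k * flat (k + 1) t) (at t)"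
      using 2 by (simp add: flat_def)
    then show ?thesis
      by (rule has_field_derivative_transform_within_open[of _ _ _ "{..<0}"])
         (use 2 in \<open>auto simp: flat_def\<close>)
  next
    case 3
    \<comment> \<open>At the origin the difference quotient of \<open>flat k\<close> is
      \<open>flat (Suc k)\<close>, so the limit for the next exponent gives derivative zero.\<close>
    have "((\<lambda>h. (flat k (0 + h) - flat k 0) / h) \<longlongrightarrow> 0) (at 0)"
      by (rule Lim_transform_eventually[OF flat_tendsto_0[of "Suc k"]])
         (auto simp: flat_def eventually_at_filter field_simps intro!: always_eventually)
    then show ?thesis
      unfolding 3 DERIV_def by (simp add: flat_def)
  qed
qed

text \<open>Differentiating a bump gives bumps with higher exponents times a linear form, so this
  algebra is stable under derivatives. Smoothness then takes one induction over the generators and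
  none over the order of differentiation.\<close>

inductive_set bump_algebra :: "real \<Rightarrow> ('a::euclidean_space \<Rightarrow> real) set" for c where
  flat: "(\<lambda>y. flat k (c - y \<bullet> y)) \<in> bump_algebra c"
| coord: "(\<lambda>y. y \<bullet> i) \<in> bump_algebra c"
| const: "(\<lambda>y. a) \<in> bump_algebra c"
| add: "f \<in> bump_algebra c \<Longrightarrow> g \<in> bump_algebra c \<Longrightarrow> (\<lambda>y. f y + g y) \<in> bump_algebra c"
| mult: "f \<in> bump_algebra c \<Longrightarrow> g \<in> bump_algebra c \<Longrightarrow> (\<lambda>y. f y * g y) \<in> bump_algebra c"

lemma bump_algebra_derivative:
  assumes "f \<in> bump_algebra c"
  shows "\<exists>f'. (\<forall>x. (f has_derivative (\<lambda>v. f' v x)) (at x)) \<and> (\<forall>v. f' v \<in> bump_algebra c)"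
  using assms
proof induction
  case (flat k)
  define f' where "f' = (\<lambda>v x::'a. (flat (k + 2) (c - x \<bullet> x) + (- real k) * flat (k + 1) (c - x \<bullet> x)) * ((-2) * (x \<bullet> v)))"
  have "((\<lambda>y. flat k (c - y \<bullet> y)) has_derivative (\<lambda>v. f' v x)) (at x)" for x :: 'a
  proof -
    have "((\<lambda>y. c - y \<bullet> y) has_derivative (\<lambda>v. (-2) * (x \<bullet> v))) (at x)"
      by (auto intro!: derivative_eq_intros simp: inner_commute)
    from has_derivative_compose[OF this flat_has_derivative[of k "c - x \<bullet> x", unfolded has_field_derivative_def]]
    show ?thesis
      by (simp add: f'_def)
  qed
  moreover have "f' v \<in> bump_algebra c" for v
    unfolding f'_def
    by (rule bump_algebra.mult[OF bump_algebra.add[OF bump_algebra.flat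
          bump_algebra.mult[OF bump_algebra.const bump_algebra.flat]]
          bump_algebra.mult[OF bump_algebra.const bump_algebra.coord]])
  ultimately show ?case by blast
next
  case (coord i)
  have "((\<lambda>y. y \<bullet> i) has_derivative (\<lambda>v. v \<bullet> i)) (at x)" for x
    by (auto intro!: derivative_eq_intros)
  then show ?case by (intro exI[of _ "\<lambda>v x. v \<bullet> i"]) (auto intro: bump_algebra.const)
next
  case (const a)
  show ?case by (intro exI[of _ "\<lambda>v x. 0"]) (auto intro: bump_algebra.const)
next
  case (add f g)
  from add.IH obtain f' g' where D: "\<And>x. (f has_derivative (\<lambda>v. f' v x)) (at x)" "\<And>v. f' v \<in> bump_algebra c"
    "\<And>x. (g has_derivative (\<lambda>v. g' v x)) (at x)" "\<And>v. g' v \<in> bump_algebra c" by metis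
  show ?case
  proof (rule exI[of _ "\<lambda>v x. f' v x + g' v x"], intro conjI allI)
    show "((\<lambda>y. f y + g y) has_derivative (\<lambda>v. f' v x + g' v x)) (at x)" for x
      by (rule has_derivative_add[OF D(1,3)])
    show "(\<lambda>x. f' v x + g' v x) \<in> bump_algebra c" for v
      by (rule bump_algebra.add[OF D(2,4)])
  qed
next
  case (mult f g)
  from mult.IH obtain f' g' where D: "\<And>x. (f has_derivative (\<lambda>v. f' v x)) (at x)" "\<And>v. f' v \<in> bump_algebra c"
    "\<And>x. (g has_derivative (\<lambda>v. g' v x)) (at x)" "\<And>v. g' v \<in> bump_algebra c" by metis
  show ?case
  proof (rule exI[of _ "\<lambda>v x. f x * g' v x + f' v x * g x"], intro conjI allI)
    show "((\<lambda>y. f y * g y) has_derivative (\<lambda>v. f x * g' v x + f' v x * g x)) (at x)" for x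
      by (rule has_derivative_mult[OF D(1,3)])
    show "(\<lambda>x. f x * g' v x + f' v x * g x) \<in> bump_algebra c" for v
      by (rule bump_algebra.add[OF bump_algebra.mult[OF mult.hyps(1) D(4)] bump_algebra.mult[OF D(2) mult.hyps(2)]])
  qed
qed

text \<open>The class \<open>S\<close> is the invariant of an induction over the list of directions.
  Bumps, convolutions, negatives and the zero field each supply their own class.\<close>

lemma smooth_if_family:
  assumes "f \<in> S"
    and S: "\<And>f x. f \<in> S \<Longrightarrow> f differentiable at x"
      "\<And>f i. f \<in> S \<Longrightarrow> i \<in> Basis \<Longrightarrow> (\<lambda>x. frechet_derivative f (at x) i) \<in> S"
  shows "smooth f"
proof -
  have "iter_partial f vs \<in> S" if "set vs \<subseteq> Basis" for vs
    using that by (induction vs) (use assms in auto)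
  then show ?thesis
    using S unfolding smooth_def by blast
qed

lemma bump_algebra_smooth:
  assumes "f \<in> bump_algebra c" shows "smooth f"
proof (rule smooth_if_family[where S = "bump_algebra c"])
  fix f :: "'a \<Rightarrow> real" assume "f \<in> bump_algebra c"
  then obtain f' where f': "\<And>x. (f has_derivative (\<lambda>v. f' v x)) (at x)" "\<And>v. f' v \<in> bump_algebra c"
    using bump_algebra_derivative by metis
  show "f differentiable at x" for x using f' unfolding differentiable_def by blast
  have "(\<lambda>x. frechet_derivative f (at x) i) = f' i" for i
    by (rule ext) (simp flip: frechet_derivative_at[OF f'(1)])
  then show "(\<lambda>x. frechet_derivative f (at x) i) \<in> bump_algebra c" for i
    using f'(2) by simp
qed (fact assms)

lemma smooth_differentiable: "smooth f \<Longrightarrow> f differentiable at x"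
  unfolding smooth_def by (metis iter_partial.simps(1) empty_subsetI list.set(1))

lemma smooth_has_derivative: "smooth f \<Longrightarrow> (f has_derivative frechet_derivative f (at x)) (at x)"
  using smooth_differentiable frechet_derivative_works by blast

lemma iter_partial_append: "iter_partial f (xs @ ys) = iter_partial (iter_partial f ys) xs"
  by (induction xs) auto

lemma smooth_partial:
  assumes "smooth f" "i \<in> Basis"
  shows "smooth (\<lambda>x. frechet_derivative f (at x) i)"
  unfolding smooth_def
proof (intro allI impI)
  fix vs :: "'a list" and x assume "set vs \<subseteq> Basis"
  \<comment> \<open>The head of the list is differentiated last, so an inner partial derivative
    corresponds to an element appended at the end.\<close>
  with assms have "iter_partial f (vs @ [i]) differentiable at x"
    unfolding smooth_def by simp
  then show "iter_partial (\<lambda>x. frechet_derivative f (at x) i) vs differentiable at x"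
    by (simp add: iter_partial_append)
qed

lemma smooth_continuous: "smooth f \<Longrightarrow> continuous_on S f"
  by (meson continuous_at_imp_continuous_on differentiable_imp_continuous_within smooth_differentiable)

lemma frechet_derivative_eq_0_outside:
  fixes f :: "'a::euclidean_space \<Rightarrow> 'b::real_normed_vector"
  assumes "x \<notin> closure {x. f x \<noteq> 0}"
  shows "frechet_derivative f (at x) = (\<lambda>v. 0)"
proof -
  have "(f has_derivative (\<lambda>v. 0)) (at x)"
    by (rule has_derivative_transform_within_open[of "\<lambda>x. 0" _ _ _ "- closure {x. f x \<noteq> 0}"])
       (use assms closure_subset[of "{x. f x \<noteq> 0}"] in auto)
  then show ?thesis by (metis frechet_derivative_at)
qed

lemma mollifier_exists:
  fixes e :: real
  assumes "e > 0"
  obtains \<rho> :: "'a::euclidean_space \<Rightarrow> real" where "smooth \<rho>" "\<And>x. \<rho> x \<ge> 0" "\<And>x. \<rho> (- x) = \<rho> x"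
    "\<And>x. norm x \<ge> e \<Longrightarrow> \<rho> x = 0" "integral\<^sup>L lborel \<rho> = 1" "integrable lborel \<rho>"
proof -
  define g :: "'a \<Rightarrow> real" where "g y = flat 0 (e\<^sup>2 - y \<bullet> y)" for y
  have g: "g y = (if norm y < e then exp (- (1 / (e\<^sup>2 - y \<bullet> y))) else 0)" for y
  proof -
    have "norm y < e \<longleftrightarrow> (norm y)\<^sup>2 < e\<^sup>2"
      using assms by (metis norm_ge_zero order_less_imp_le power2_less_imp_less power_strict_mono zero_less_numeral)
    then show ?thesis
      by (auto simp: g_def flat_def power2_norm_eq_inner)
  qed
  have smg: "smooth g"
    unfolding g_def by (rule bump_algebra_smooth) (rule bump_algebra.flat)
  have [measurable]: "g \<in> borel_measurable borel"
    by (intro borel_measurable_continuous_onI smooth_continuous smg)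
  have gint: "integrable lborel g"
  proof (rule Bochner_Integration.integrable_bound)
    show "integrable lborel (\<lambda>x. indicator (ball (0::'a) e) x :: real)"
      by (rule integrable_real_indicator) (use emeasure_lborel_ball_finite[of "0::'a" e] in \<open>simp_all add: less_top\<close>)
    show "AE x in lborel. norm (g x) \<le> norm (indicator (ball 0 e) x :: real)"
      proof (rule AE_I2)
      fix x :: 'a
      have "x \<bullet> x < e\<^sup>2" if "norm x < e"
        using that assms by (simp add: power2_norm_eq_inner[symmetric] power_strict_mono)
      then show "norm (g x) \<le> norm (indicator (ball 0 e) x :: real)"
        by (auto simp: g)
    qed
  qed simp
  define I where "I = integral\<^sup>L lborel g"
  \<comment> \<open>The bump is positive on a ball, which is not a null set; this permits the
    normalization to mass one.\<close>
  have "I > 0"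
  proof -
    have "I \<ge> 0" unfolding I_def by (rule Bochner_Integration.integral_nonneg) (simp add: g)
    moreover have "I \<noteq> 0"
    proof
      assume "I = 0"
      then have "AE x in lborel. g x = 0"
        using integral_nonneg_eq_0_iff_AE[OF gint] by (auto simp: I_def g)
      then have "AE x in lborel. x \<notin> ball (0::'a) e"
        by eventually_elim (auto simp: g)
      then have "ball (0::'a) e \<in> null_sets lborel"
        by (subst AE_iff_null_sets) auto
      then have "ball (0::'a) e \<in> null_sets lebesgue"
        by (rule null_sets_completionI)
      then have "negligible (ball (0::'a) e)"
        by (simp add: negligible_iff_null_sets)
      then show False
        using assms open_not_negligible[of "ball (0::'a) e"] by auto
    qed
    ultimately show ?thesis by simp
  qed
  show ?thesis
  proof
    show "smooth (\<lambda>x. (1 / I) * g x)"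
      unfolding g_def by (rule bump_algebra_smooth[OF bump_algebra.mult[OF bump_algebra.const bump_algebra.flat]])
    show "integral\<^sup>L lborel (\<lambda>x. (1 / I) * g x) = 1"
      using \<open>I > 0\<close> by (simp add: I_def)
    show "integrable lborel (\<lambda>x. (1 / I) * g x)"
      using gint by simp
  qed (use \<open>I > 0\<close> in \<open>auto simp: g\<close>)
qed

section \<open>Gradients and convolution\<close>

definition grad :: "('a::euclidean_space \<Rightarrow> real) \<Rightarrow> 'a \<Rightarrow> 'a" where
  "grad g x = (\<Sum>i\<in>Basis. frechet_derivative g (at x) i *\<^sub>R i)"

text \<open>The codomain is general because both functions and vector fields are mollified. The
  integral is over \<open>lborel\<close>, where product measures and Fubini are at hand; the passage
  from \<open>lebesgue\<close> is made once, in \<open>TV_truncation_le\<close>.\<close>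

definition conv :: "('a::euclidean_space \<Rightarrow> real) \<Rightarrow> ('a \<Rightarrow> 'b::{banach,second_countable_topology}) \<Rightarrow> 'a \<Rightarrow> 'b" where
  "conv \<rho> w x = (\<integral>y. \<rho> (x - y) *\<^sub>R w y \<partial>lborel)"

lemma grad_inner_Basis: "i \<in> Basis \<Longrightarrow> grad g x \<bullet> i = frechet_derivative g (at x) i"
  by (simp add: grad_def inner_sum_left inner_Basis if_distrib cong: if_cong)

lemma grad_inner:
  assumes "g differentiable at x"
  shows "grad g x \<bullet> h = frechet_derivative g (at x) h"
proof -
  interpret linear "frechet_derivative g (at x)"
    using assms linear_frechet_derivative by blast
  have "frechet_derivative g (at x) h = frechet_derivative g (at x) (\<Sum>i\<in>Basis. (h \<bullet> i) *\<^sub>R i)"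
    by (simp add: euclidean_representation)
  also have "\<dots> = grad g x \<bullet> h"
    by (simp add: sum scale grad_def inner_sum_left inner_commute[of h] mult.commute)
  finally show ?thesis by simp
qed

lemma grad_eqI:
  assumes "(g has_derivative (\<lambda>h. G \<bullet> h)) (at x)" shows "grad g x = G"
  by (rule euclidean_eqI) (simp add: grad_inner_Basis flip: frechet_derivative_at[OF assms])

lemma has_derivative_grad:
  "g differentiable at x \<Longrightarrow> (g has_derivative (\<lambda>h. grad g x \<bullet> h)) (at x)"
  by (subst grad_inner) (simp_all add: frechet_derivative_works)

lemma continuous_grad: "smooth g \<Longrightarrow> continuous_on S (grad g)"
  unfolding grad_def by (intro continuous_intros smooth_continuous smooth_partial)

lemma grad_eq_0_outside: "x \<notin> closure {x. g x \<noteq> 0} \<Longrightarrow> grad g x = 0"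
  by (simp add: grad_def frechet_derivative_eq_0_outside)

lemma bounded_supp_partial:
  fixes f :: "'a::euclidean_space \<Rightarrow> 'b::real_normed_vector"
  assumes "bounded {x. f x \<noteq> 0}"
  shows "bounded {x. frechet_derivative f (at x) i \<noteq> 0}"
proof (rule bounded_subset[OF bounded_closure[OF assms]])
  show "{x. frechet_derivative f (at x) i \<noteq> 0} \<subseteq> closure {x. f x \<noteq> 0}"
    using frechet_derivative_eq_0_outside[of _ f] by fastforce
qed

text \<open>Of two points at distance below 1, either both lie in the compact ball of radius
  \<open>R + 1\<close>, or the function vanishes at both.\<close>

lemma uniformly_continuous_bounded_supp:
  fixes g :: "'a::euclidean_space \<Rightarrow> 'b::real_normed_vector"
  assumes "continuous_on UNIV g" "bounded {x. g x \<noteq> 0}"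
  shows "uniformly_continuous_on UNIV g"
proof -
  obtain R where R: "\<And>x. g x \<noteq> 0 \<Longrightarrow> norm x \<le> R"
    using assms(2) by (auto simp: bounded_iff)
  have u: "uniformly_continuous_on (cball 0 (R + 1)) g"
    by (rule compact_uniformly_continuous) (auto intro: continuous_on_subset[OF assms(1)])
  show ?thesis
    unfolding uniformly_continuous_on_def
  proof (intro allI impI)
    fix e :: real assume "e > 0"
    then obtain d where d: "d > 0"
      "\<And>x y. x \<in> cball 0 (R + 1) \<Longrightarrow> y \<in> cball 0 (R + 1) \<Longrightarrow> dist y x < d \<Longrightarrow> dist (g y) (g x) < e"
      using u unfolding uniformly_continuous_on_def by metis
    have "dist (g y) (g x) < e" if xy: "dist y x < min d 1" for x y
    proof (cases "g x = 0 \<and> g y = 0")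
      case False
      then have "norm x \<le> R \<or> norm y \<le> R" using R by blast
      moreover have "norm y \<le> norm x + 1" "norm x \<le> norm y + 1"
        using xy by (auto simp: dist_norm) (smt (verit) norm_triangle_sub norm_minus_commute)+
      ultimately have "x \<in> cball 0 (R + 1)" "y \<in> cball 0 (R + 1)" by auto
      then show ?thesis using d(2) xy by auto
    qed (use \<open>e > 0\<close> in auto)
    then show "\<exists>d>0. \<forall>x\<in>UNIV. \<forall>x'\<in>UNIV. dist x' x < d \<longrightarrow> dist (g x') (g x) < e"
      using d(1) by (intro exI[of _ "min d 1"]) auto
  qed
qed

lemma bounded_range_bounded_supp:
  fixes g :: "'a::euclidean_space \<Rightarrow> 'b::real_normed_vector"
  assumes "continuous_on UNIV g" "bounded {x. g x \<noteq> 0}"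
  obtains M where "M > 0" "\<And>x. norm (g x) \<le> M"
proof -
  obtain R where R: "\<And>x. g x \<noteq> 0 \<Longrightarrow> norm x \<le> R"
    using assms(2) by (auto simp: bounded_iff)
  have "bounded (g ` cball 0 R)"
    by (intro compact_imp_bounded compact_continuous_image continuous_on_subset[OF assms(1)]) auto
  then obtain M where M: "M > 0" "\<And>x. norm x \<le> R \<Longrightarrow> norm (g x) \<le> M"
    by (auto simp: bounded_pos)
  show ?thesis
    by (rule that[OF M(1)]) (metis M R norm_zero order_less_imp_le)
qed

lemma integrable_bounded_supp:
  fixes f :: "'a::euclidean_space \<Rightarrow> 'b::{banach,second_countable_topology}"
  assumes [measurable]: "f \<in> borel_measurable borel" and "bounded {x. f x \<noteq> 0}" "\<And>x. norm (f x) \<le> M"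
  shows "integrable lborel f"
proof -
  obtain R where R: "\<And>x. f x \<noteq> 0 \<Longrightarrow> norm x \<le> R"
    using assms(2) by (auto simp: bounded_iff)
  have "integrable lborel (\<lambda>x. indicator (cball (0::'a) R) x *\<^sub>R M)"
    by (intro integrable_scaleR_left integrable_real_indicator)
       (use emeasure_lborel_cball_finite[of "0::'a" R] in \<open>simp_all add: less_top\<close>)
  then show ?thesis
    by (rule Bochner_Integration.integrable_bound)
      (use R assms(3) in \<open>auto simp: indicator_def intro!: AE_I2 order_trans[OF assms(3)]\<close>)
qed

lemma integrable_continuous_bounded_supp:
  fixes f :: "'a::euclidean_space \<Rightarrow> 'b::{banach,second_countable_topology}"
  assumes "continuous_on UNIV f" "bounded {x. f x \<noteq> 0}"
  shows "integrable lborel f"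
  by (metis assms bounded_range_bounded_supp integrable_bounded_supp borel_measurable_continuous_onI)

text \<open>Uniform continuity of the gradient makes \<open>d\<close> independent of the base point.
  Convolutions need this, since there the base point \<open>x - y\<close> runs through the whole
  space.\<close>

lemma smooth_uniform_linearization:
  fixes g :: "'a::euclidean_space \<Rightarrow> real"
  assumes g: "smooth g" "bounded {x. g x \<noteq> 0}" and "e > 0"
  obtains d where "d > 0" "\<And>a h. norm h < d \<Longrightarrow> \<bar>g (a + h) - g a - grad g a \<bullet> h\<bar> \<le> e * norm h"
proof -
  have "bounded {x. grad g x \<noteq> 0}"
    by (rule bounded_subset[OF bounded_closure[OF g(2)]]) (use grad_eq_0_outside in auto)
  then have "uniformly_continuous_on UNIV (grad g)"
    by (intro uniformly_continuous_bounded_supp continuous_grad g)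
  then obtain d where d: "d > 0" "\<And>x y. dist x y < d \<Longrightarrow> dist (grad g x) (grad g y) < e"
    using \<open>e > 0\<close> unfolding uniformly_continuous_on_def by (metis UNIV_I)
  show ?thesis
  proof (rule that[OF d(1)])
    fix a h :: 'a assume h: "norm h < d"
    have "a + t *\<^sub>R ((a + h) - a) \<in> ball a d" if "t \<in> {0..1}" for t :: real
    proof -
      from that have "t * norm h \<le> 1 * norm h" by (intro mult_right_mono) auto
      with h that show ?thesis by (simp add: dist_norm)
    qed
    moreover have "(g has_derivative (\<bullet>) (grad g x)) (at x within ball a d)" for x
      by (rule has_derivative_at_withinI[OF has_derivative_grad[OF smooth_differentiable[OF g(1)]]])
    moreover have "onorm ((\<bullet>) (grad g x) - (\<bullet>) (grad g a)) \<le> e" if "x \<in> ball a d" for x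
    proof (rule onorm_le)
      fix v :: 'a
      have "norm (grad g x - grad g a) \<le> e"
        using d(2)[of x a] that by (auto simp: dist_norm norm_minus_commute)
      then have "norm (grad g x - grad g a) * norm v \<le> e * norm v"
        by (rule mult_right_mono) simp
      then show "norm (((\<bullet>) (grad g x) - (\<bullet>) (grad g a)) v) \<le> e * norm v"
        using Cauchy_Schwarz_ineq2[of "grad g x - grad g a" v] by (simp add: inner_diff_left)
    qed
    ultimately have "norm (g (a + h) - g a - grad g a \<bullet> ((a + h) - a)) \<le> norm ((a + h) - a) * e"
      using differentiable_bound_linearization[of a "a + h" "ball a d" g "\<lambda>x. (\<bullet>) (grad g x)" a e] d(1)
      by simp
    then show "\<bar>g (a + h) - g a - grad g a \<bullet> h\<bar> \<le> e * norm h"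
      by (simp add: mult.commute)
  qed
qed

lemma integrable_conv:
  fixes w :: "'a::euclidean_space \<Rightarrow> 'b::{banach,second_countable_topology}"
  assumes "continuous_on UNIV g" "bounded {x. g x \<noteq> 0}" "integrable lborel w"
  shows "integrable lborel (\<lambda>y. g (x - y) *\<^sub>R w y)"
proof -
  obtain M where M: "M > 0" "\<And>x. norm (g x) \<le> M"
    using bounded_range_bounded_supp[OF assms(1,2)] by auto
  have [measurable]: "g \<in> borel_measurable borel"
    using assms(1) by (rule borel_measurable_continuous_onI)
  have [measurable]: "w \<in> borel_measurable borel" using assms(3) by auto
  have "integrable lborel (\<lambda>y. M *\<^sub>R w y)" using assms(3) by simp
  then show ?thesis
    by (rule Bochner_Integration.integrable_bound)
       (use M in \<open>auto intro!: AE_I2 mult_right_mono\<close>)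
qed

text \<open>Differentiation under the integral sign: the linearization error of \<open>g\<close> is
  uniform, so integrating it against the norm of \<open>w\<close> leaves it of smaller order than
  the increment.\<close>

lemma conv_has_derivative:
  fixes w :: "'a::euclidean_space \<Rightarrow> 'b::{banach,second_countable_topology}"
  assumes g: "smooth g" "bounded {x. g x \<noteq> 0}" and w: "integrable lborel w"
  shows "(conv g w has_derivative (\<lambda>h. \<integral>y. (grad g (x - y) \<bullet> h) *\<^sub>R w y \<partial>lborel)) (at x)"
proof -
  have gb: "bounded {x. grad g x \<noteq> 0}"
    by (rule bounded_subset[OF bounded_closure[OF g(2)]]) (use grad_eq_0_outside in auto)
  have int: "integrable lborel (\<lambda>y. (grad g (x - y) \<bullet> h) *\<^sub>R w y)" for h x
    by (rule integrable_conv[of "\<lambda>x. grad g x \<bullet> h"])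
       (auto intro!: continuous_intros continuous_grad g w bounded_subset[OF gb])
  have int': "integrable lborel (\<lambda>y. g (x - y) *\<^sub>R w y)" for x
    by (intro integrable_conv smooth_continuous g w)
  obtain M where M: "M > 0" "\<And>x. norm (grad g x) \<le> M"
    using bounded_range_bounded_supp[OF continuous_grad[OF g(1)] gb] by auto
  define D where "D = (\<lambda>h. \<integral>y. (grad g (x - y) \<bullet> h) *\<^sub>R w y \<partial>lborel)"
  define N where "N = (\<integral>y. norm (w y) \<partial>lborel)"
  have N: "N \<ge> 0" unfolding N_def by simp
  have "bounded_linear D"
  proof (rule bounded_linear_intro[where K = "M * N"])
    show "D (h + k) = D h + D k" for h k
      unfolding D_def by (subst Bochner_Integration.integral_add[symmetric])
        (auto simp: int inner_add_right scaleR_add_left)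
    show "D (r *\<^sub>R h) = r *\<^sub>R D h" for r h
      unfolding D_def by (subst integral_scaleR_right[symmetric])
        (auto simp: int)
    show "norm (D h) \<le> norm h * (M * N)" for h
    proof -
      have "norm (D h) \<le> (\<integral>y. M * norm h * norm (w y) \<partial>lborel)"
        unfolding D_def
      proof (rule Bochner_Integration.integral_norm_bound_integral)
        show "integrable lborel (\<lambda>y. M * norm h * norm (w y))" using w by simp
        show "norm ((grad g (x - y) \<bullet> h) *\<^sub>R w y) \<le> M * norm h * norm (w y)" for y
          using Cauchy_Schwarz_ineq2[of "grad g (x - y)" h] mult_right_mono[OF M(2)[of "x - y"], of "norm h"]
          by (auto intro!: mult_right_mono)
      qed (rule int)
      then show ?thesis by (simp add: N_def mult_ac)
    qed
  qed
  moreover have "\<exists>d>0. \<forall>y. norm (y - x) < d \<longrightarrow>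
      norm (conv g w y - conv g w x - D (y - x)) \<le> e * norm (y - x)" if "e > 0" for e
  proof -
    \<comment> \<open>The added 1 covers the case that \<open>w\<close> vanishes almost everywhere
      and \<open>N\<close> is zero.\<close>
    define e' where "e' = e / (N + 1)"
    have e': "e' > 0" "e' * N \<le> e" using that N by (auto simp: e'_def field_simps)
    obtain d where d: "d > 0" "\<And>a h. norm h < d \<Longrightarrow> \<bar>g (a + h) - g a - grad g a \<bullet> h\<bar> \<le> e' * norm h"
      using smooth_uniform_linearization[OF g e'(1)] by blast
    have "norm (conv g w y - conv g w x - D (y - x)) \<le> e * norm (y - x)" if y: "norm (y - x) < d" for y
    proof -
      have "conv g w y - conv g w x - D (y - x) =
          (\<integral>z. (g (y - z) - g (x - z) - grad g (x - z) \<bullet> (y - x)) *\<^sub>R w z \<partial>lborel)"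
        unfolding conv_def D_def scaleR_diff_left using int int' by simp
      also have "norm \<dots> \<le> (\<integral>z. e' * norm (y - x) * norm (w z) \<partial>lborel)"
      proof (rule Bochner_Integration.integral_norm_bound_integral)
        show "integrable lborel (\<lambda>z. (g (y - z) - g (x - z) - grad g (x - z) \<bullet> (y - x)) *\<^sub>R w z)"
          unfolding scaleR_diff_left using int int' by simp
        show "integrable lborel (\<lambda>z. e' * norm (y - x) * norm (w z))" using w by simp
        show "norm ((g (y - z) - g (x - z) - grad g (x - z) \<bullet> (y - x)) *\<^sub>R w z) \<le> e' * norm (y - x) * norm (w z)" for z
          using mult_right_mono[OF d(2)[OF y, of "x - z"], of "norm (w z)"] by simp
      qed
      also have "\<dots> = (e' * N) * norm (y - x)" by (simp add: N_def)
      also have "\<dots> \<le> e * norm (y - x)" using e' by (intro mult_right_mono) auto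
      finally show ?thesis .
    qed
    then show ?thesis using d(1) by blast
  qed
  ultimately show ?thesis
    unfolding has_derivative_at_alt D_def by blast
qed

lemma conv_partial:
  fixes w :: "'a::euclidean_space \<Rightarrow> 'b::{banach,second_countable_topology}"
  assumes "smooth g" "bounded {x. g x \<noteq> 0}" "integrable lborel w" "i \<in> Basis"
  shows "frechet_derivative (conv g w) (at x) i = conv (\<lambda>x. frechet_derivative g (at x) i) w x"
  using assms(4) frechet_derivative_at[OF conv_has_derivative[OF assms(1-3), of x], symmetric]
  by (simp add: conv_def grad_inner_Basis)

text \<open>Partial derivatives fall on the kernel only. The family of all convolutions with the
  fixed \<open>w\<close> and a varying smooth kernel of bounded support is therefore closed under
  them.\<close>

lemma conv_smooth:
  fixes w :: "'a::euclidean_space \<Rightarrow> 'b::{banach,second_countable_topology}"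
  assumes "smooth g" "bounded {x. g x \<noteq> 0}" "integrable lborel w"
  shows "smooth (conv g w)"
proof (rule smooth_if_family[where S = "(\<lambda>g. conv g w) ` {g. smooth g \<and> bounded {x. g x \<noteq> 0}}"])
  fix f :: "'a \<Rightarrow> 'b" and i :: 'a
  assume "f \<in> (\<lambda>g. conv g w) ` {g. smooth g \<and> bounded {x. g x \<noteq> 0}}"
  then obtain g where g: "f = conv g w" "smooth g" "bounded {x. g x \<noteq> 0}" by auto
  show "f differentiable at x" for x
    using conv_has_derivative[OF g(2,3) assms(3)] g(1) unfolding differentiable_def by blast
  assume "i \<in> Basis"
  then have "(\<lambda>x. frechet_derivative f (at x) i) = conv (\<lambda>x. frechet_derivative g (at x) i) w"
    by (simp add: g conv_partial[OF g(2,3) assms(3)])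
  then show "(\<lambda>x. frechet_derivative f (at x) i) \<in> (\<lambda>g. conv g w) ` {g. smooth g \<and> bounded {x. g x \<noteq> 0}}"
    using smooth_partial[OF g(2) \<open>i \<in> Basis\<close>] bounded_supp_partial[OF g(3)] by blast
qed (use assms in auto)

lemma grad_conv:
  fixes w :: "'a::euclidean_space \<Rightarrow> real"
  assumes "smooth g" "bounded {x. g x \<noteq> 0}" "integrable lborel w"
  shows "grad (conv g w) x \<bullet> h = (\<integral>y. (grad g (x - y) \<bullet> h) * w y \<partial>lborel)"
  using conv_has_derivative[OF assms, of x] frechet_derivative_at[OF conv_has_derivative[OF assms, of x], symmetric]
  by (subst grad_inner) (auto simp: differentiable_def)

section \<open>Integration by parts and approximation in the mean\<close>

lemma integral_lborel_affine_unit: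
  fixes f :: "'a::euclidean_space \<Rightarrow> 'b::{banach,second_countable_topology}" and c :: real
  assumes [measurable]: "f \<in> borel_measurable borel" and "\<bar>c\<bar> = 1"
  shows "(\<integral>x. f (t + c *\<^sub>R x) \<partial>lborel) = (\<integral>x. f x \<partial>lborel)"
    and "(\<integral>\<^sup>+x. ennreal (norm (f (t + c *\<^sub>R x))) \<partial>lborel) = (\<integral>\<^sup>+x. ennreal (norm (f x)) \<partial>lborel)"
proof -
  have "c \<noteq> 0" using assms(2) by auto
  then have l: "(lborel :: 'a measure) = distr lborel borel (\<lambda>x. t + c *\<^sub>R x)"
    using lborel_affine[of c t] assms(2) by (simp add: density_1)
  show "(\<integral>x. f (t + c *\<^sub>R x) \<partial>lborel) = (\<integral>x. f x \<partial>lborel)"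
    by (subst (2) l, subst integral_distr) auto
  show "(\<integral>\<^sup>+x. ennreal (norm (f (t + c *\<^sub>R x))) \<partial>lborel) = (\<integral>\<^sup>+x. ennreal (norm (f x)) \<partial>lborel)"
    by (subst (2) l, subst nn_integral_distr) auto
qed

text \<open>By translation invariance every difference quotient of \<open>g\<close> has integral
  zero, and dominated convergence carries this to the derivative. No iterated integration along
  coordinate lines is involved.\<close>

lemma integral_partial_eq_0:
  fixes g :: "'a::euclidean_space \<Rightarrow> real"
  assumes g: "\<And>x. (g has_derivative g' x) (at x)" "continuous_on UNIV (\<lambda>x. g' x i)"
    and supp: "bounded {x. g x \<noteq> 0}" and i: "i \<in> Basis"
  shows "(\<integral>x. g' x i \<partial>lborel) = 0"
proof -
  have g'_eq: "g' x = frechet_derivative g (at x)" for x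
    using frechet_derivative_at[OF g(1)] by simp
  have supp': "bounded {x. g' x i \<noteq> 0}"
    unfolding g'_eq by (rule bounded_supp_partial[OF supp])
  obtain M where M: "M > 0" "\<And>x. norm (g' x i) \<le> M"
    using bounded_range_bounded_supp[OF g(2) supp'] by auto
  obtain R where R: "\<And>x. g x \<noteq> 0 \<Longrightarrow> norm x \<le> R"
    using supp by (auto simp: bounded_iff)
  have cont: "continuous_on UNIV g"
    using g(1) by (meson continuous_at_imp_continuous_on has_derivative_continuous)
  have [measurable]: "g \<in> borel_measurable borel" "(\<lambda>x. g' x i) \<in> borel_measurable borel"
    using cont g(2) by (auto intro: borel_measurable_continuous_onI)
  have gint: "integrable lborel g"
    by (rule integrable_continuous_bounded_supp[OF cont supp])
  define h :: "nat \<Rightarrow> real" where "h n = inverse (real (Suc n))" for n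
  have h: "0 < h n" "h n \<le> 1" for n by (auto simp: h_def field_simps)
  define q where "q n x = (g (x + h n *\<^sub>R i) - g x) / h n" for n x
  have line: "((\<lambda>t. g (x + t *\<^sub>R i)) has_real_derivative g' (x + t *\<^sub>R i) i) (at t)" for x t
  proof -
    have "((\<lambda>t. g (x + t *\<^sub>R i)) has_derivative (\<lambda>s. g' (x + t *\<^sub>R i) (s *\<^sub>R i))) (at t)"
      by (rule has_derivative_compose[OF _ g(1)]) (auto intro!: derivative_eq_intros)
    moreover have "g' (x + t *\<^sub>R i) (s *\<^sub>R i) = g' (x + t *\<^sub>R i) i * s" for s
      using linear_scale[OF has_derivative_linear[OF g(1)]] by simp
    ultimately show ?thesis by (simp add: has_field_derivative_def)
  qed
  have shift: "integrable lborel (\<lambda>x. g (x + h n *\<^sub>R i))" "(\<integral>x. g (x + h n *\<^sub>R i) \<partial>lborel) = (\<integral>x. g x \<partial>lborel)" for n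
  proof -
    have "(\<lambda>x. x + h n *\<^sub>R i) = (\<lambda>x. h n *\<^sub>R i + 1 *\<^sub>R x)" by auto
    then show "(\<integral>x. g (x + h n *\<^sub>R i) \<partial>lborel) = (\<integral>x. g x \<partial>lborel)"
      using integral_lborel_affine_unit(1)[of g 1 "h n *\<^sub>R i"] by (simp add: add.commute)
    show "integrable lborel (\<lambda>x. g (x + h n *\<^sub>R i))"
      using gint integral_lborel_affine_unit(2)[of g 1 "h n *\<^sub>R i"]
      by (simp add: add.commute integrable_iff_bounded)
  qed
  have q0: "(\<integral>x. q n x \<partial>lborel) = 0" for n
    unfolding q_def using shift[of n] gint by simp
  have lim: "(\<lambda>n. q n x) \<longlonglongrightarrow> g' x i" for x
  proof -
    have "((\<lambda>t. (g (x + t *\<^sub>R i) - g x) / t) \<longlongrightarrow> g' x i) (at 0)"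
      using line[of x 0] by (simp add: DERIV_def)
    moreover have "filterlim h (at 0) sequentially"
      unfolding h_def filterlim_at using LIMSEQ_inverse_real_of_nat by (auto simp del: of_nat_Suc)
    ultimately show ?thesis
      unfolding q_def by (rule filterlim_compose)
  qed
  \<comment> \<open>The mean value theorem bounds the quotient by \<open>M\<close>; as the steps are
    at most 1, it vanishes outside the ball of radius \<open>R + 1\<close>.\<close>
  have bound: "norm (q n x) \<le> M * indicator (cball 0 (R + 1)) x" for n x
  proof (cases "norm x \<le> R + 1")
    case True
    have "\<exists>z>0. z < h n \<and> g (x + h n *\<^sub>R i) - g (x + 0 *\<^sub>R i) = (h n - 0) * g' (x + z *\<^sub>R i) i"
      by (rule MVT2[OF h(1)]) (rule line)
    then obtain z where "q n x = g' (x + z *\<^sub>R i) i"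
      using h(1)[of n] by (auto simp: q_def)
    then show ?thesis using M(2) True by simp
  next
    case False
    have "norm (h n *\<^sub>R i) \<le> 1" using h[of n] i by simp
    then have "norm (x + h n *\<^sub>R i) > R"
      using False norm_triangle_ineq2[of x "- (h n *\<^sub>R i)"] by simp
    then have "q n x = 0" using R[of x] R[of "x + h n *\<^sub>R i"] False by (force simp: q_def)
    then show ?thesis using M(1) by simp
  qed
  have "(\<lambda>n. \<integral>x. q n x \<partial>lborel) \<longlonglongrightarrow> (\<integral>x. g' x i \<partial>lborel)"
  proof (rule integral_dominated_convergence[where w = "\<lambda>x. M * indicator (cball 0 (R + 1)) x"])
    show "q n \<in> borel_measurable lborel" for n unfolding q_def by measurable
    show "integrable lborel (\<lambda>x. M * indicator (cball (0::'a) (R + 1)) x)"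
      by (intro integrable_mult_right integrable_real_indicator)
         (use emeasure_lborel_cball_finite[of "0::'a" "R + 1"] in \<open>simp_all add: less_top\<close>)
  qed (use lim bound in auto)
  then show ?thesis
    by (simp add: q0 LIMSEQ_const_iff)
qed

text \<open>Each summand is the vanishing integral of a partial derivative of \<open>f\<close> times
  a component of \<open>z\<close>. Continuous first derivatives are all that is asked, because the
  lemma is applied to the cutoff field, which is not smooth.\<close>

lemma integral_by_parts_div:
  fixes f :: "'a::euclidean_space \<Rightarrow> real" and z :: "'a \<Rightarrow> 'a"
  assumes f: "\<And>x. f differentiable at x" "continuous_on UNIV (grad f)"
    and z: "\<And>x. z differentiable at x"
      "\<And>i. i \<in> Basis \<Longrightarrow> continuous_on UNIV (\<lambda>x. frechet_derivative z (at x) i)"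
    and supp: "bounded {x. z x \<noteq> 0}"
  shows "(\<integral>x. f x * divergence z x \<partial>lborel) = - (\<integral>x. grad f x \<bullet> z x \<partial>lborel)"
proof -
  have cf: "continuous_on UNIV f" and cz: "continuous_on UNIV z"
    using f(1) z(1) by (auto simp: continuous_at_imp_continuous_on differentiable_imp_continuous_within)
  have p1: "continuous_on UNIV (\<lambda>x. f x * (frechet_derivative z (at x) i \<bullet> i))" if "i \<in> Basis" for i
    using that by (intro continuous_intros cf z)
  have p2: "continuous_on UNIV (\<lambda>x. (grad f x \<bullet> i) * (z x \<bullet> i))" for i
    by (intro continuous_intros f cz)
  have i1: "integrable lborel (\<lambda>x. f x * (frechet_derivative z (at x) i \<bullet> i))" if "i \<in> Basis" for i
    by (rule integrable_continuous_bounded_supp[OF p1[OF that]])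
       (auto intro: bounded_subset[OF bounded_supp_partial[OF supp, of i]])
  have i2: "integrable lborel (\<lambda>x. (grad f x \<bullet> i) * (z x \<bullet> i))" for i
    by (rule integrable_continuous_bounded_supp[OF p2]) (auto intro: bounded_subset[OF supp])
  have *: "(\<integral>x. f x * (frechet_derivative z (at x) i \<bullet> i) \<partial>lborel) + (\<integral>x. (grad f x \<bullet> i) * (z x \<bullet> i) \<partial>lborel) = 0"
    if i: "i \<in> Basis" for i
  proof -
    have "(\<integral>x. f x * (frechet_derivative z (at x) i \<bullet> i) + (grad f x \<bullet> i) * (z x \<bullet> i) \<partial>lborel) = 0"
    proof (rule integral_partial_eq_0[where g = "\<lambda>x. f x * (z x \<bullet> i)"
          and g' = "\<lambda>x h. f x * (frechet_derivative z (at x) h \<bullet> i) + (grad f x \<bullet> h) * (z x \<bullet> i)"])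
      show "((\<lambda>x. f x * (z x \<bullet> i)) has_derivative
          (\<lambda>h. f x * (frechet_derivative z (at x) h \<bullet> i) + (grad f x \<bullet> h) * (z x \<bullet> i))) (at x)" for x
      proof -
        have "((\<lambda>x. z x \<bullet> i) has_derivative (\<lambda>h. frechet_derivative z (at x) h \<bullet> i)) (at x)"
          using z(1)[of x, unfolded frechet_derivative_works] by (rule has_derivative_inner_left)
        from has_derivative_mult[OF has_derivative_grad[OF f(1)] this] show ?thesis .
      qed
      show "continuous_on UNIV (\<lambda>x. f x * (frechet_derivative z (at x) i \<bullet> i) + (grad f x \<bullet> i) * (z x \<bullet> i))"
        by (intro continuous_on_add p1 p2 i)
      show "bounded {x. f x * (z x \<bullet> i) \<noteq> 0}" by (rule bounded_subset[OF supp]) auto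
    qed (rule i)
    then show ?thesis using i1[OF i] i2[of i] by simp
  qed
  have "(\<integral>x. f x * divergence z x \<partial>lborel) + (\<integral>x. grad f x \<bullet> z x \<partial>lborel)
      = (\<Sum>i\<in>Basis. (\<integral>x. f x * (frechet_derivative z (at x) i \<bullet> i) \<partial>lborel)) +
        (\<Sum>i\<in>Basis. (\<integral>x. (grad f x \<bullet> i) * (z x \<bullet> i) \<partial>lborel))"
  proof -
    have "(\<integral>x. grad f x \<bullet> z x \<partial>lborel) = (\<integral>x. (\<Sum>i\<in>Basis. (grad f x \<bullet> i) * (z x \<bullet> i)) \<partial>lborel)"
      by (subst euclidean_inner) simp
    also have "\<dots> = (\<Sum>i\<in>Basis. (\<integral>x. (grad f x \<bullet> i) * (z x \<bullet> i) \<partial>lborel))"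
      by (rule Bochner_Integration.integral_sum) (rule i2)
    finally have "(\<integral>x. grad f x \<bullet> z x \<partial>lborel) = \<dots>" .
    moreover have "(\<integral>x. f x * divergence z x \<partial>lborel) = (\<Sum>i\<in>Basis. (\<integral>x. f x * (frechet_derivative z (at x) i \<bullet> i) \<partial>lborel))"
      unfolding divergence_def sum_distrib_left by (rule Bochner_Integration.integral_sum) (rule i1)
    ultimately show ?thesis by simp
  qed
  also have "\<dots> = 0"
    by (subst sum.distrib[symmetric]) (simp add: *)
  finally show ?thesis by linarith
qed

text \<open>Cutting \<open>w\<close> in height and in space comes before replacing it by continuous
  functions: these converge only almost everywhere, and the cuts provide the integrable majorant as
  well as the bounded support.\<close>

lemma L1_approx_continuous:
  fixes w :: "'a::euclidean_space \<Rightarrow> real"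
  assumes w: "integrable lborel w" and "e > 0"
  obtains g where "continuous_on UNIV g" "bounded {x. g x \<noteq> 0}" "(\<integral>x. \<bar>w x - g x\<bar> \<partial>lborel) < e"
proof -
  have [measurable]: "w \<in> borel_measurable borel" using w by auto
  define cut :: "nat \<Rightarrow> 'a \<Rightarrow> real" where "cut M x = max 0 (min 1 (real M + 1 - norm x))" for M x
  define clip :: "nat \<Rightarrow> real \<Rightarrow> real" where "clip M t = max (- real M) (min (real M) t)" for M t
  have cut: "0 \<le> cut M x" "cut M x \<le> 1" "continuous_on UNIV (cut M)" for M x
    unfolding cut_def by (auto intro!: continuous_intros)
  have clip: "\<bar>clip M t\<bar> \<le> real M" "\<bar>clip M t\<bar> \<le> \<bar>t\<bar>" "continuous_on UNIV (clip M)" for M t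
    unfolding clip_def by (auto intro!: continuous_intros)
  have [measurable]: "cut M \<in> borel_measurable borel" "clip M \<in> borel_measurable borel" for M
    using cut clip by (auto intro: borel_measurable_continuous_onI)
  have "(\<lambda>M. \<integral>x. \<bar>w x - clip M (w x) * cut M x\<bar> \<partial>lborel) \<longlonglongrightarrow> (\<integral>x. 0 \<partial>(lborel :: 'a measure))"
  proof (rule integral_dominated_convergence[where w = "\<lambda>x. 2 * \<bar>w x\<bar>"])
    show "integrable lborel (\<lambda>x. 2 * \<bar>w x\<bar>)" using w by simp
    show "AE x in lborel. (\<lambda>M. \<bar>w x - clip M (w x) * cut M x\<bar>) \<longlonglongrightarrow> 0"
    proof (rule AE_I2)
      fix x
      obtain N where N: "real N \<ge> max \<bar>w x\<bar> (norm x)" using real_arch_simple by blast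
      have "\<bar>w x - clip M (w x) * cut M x\<bar> = 0" if "M \<ge> N" for M
      proof -
        have "real M \<ge> real N" using that by simp
        then have "clip M (w x) = w x" "cut M x = 1" using N by (auto simp: clip_def cut_def)
        then show ?thesis by simp
      qed
      then show "(\<lambda>M. \<bar>w x - clip M (w x) * cut M x\<bar>) \<longlonglongrightarrow> 0"
        by (intro tendsto_eventually) (auto simp: eventually_sequentially)
    qed
    show "AE x in lborel. norm \<bar>w x - clip M (w x) * cut M x\<bar> \<le> 2 * \<bar>w x\<bar>" for M
    proof (rule AE_I2)
      fix x
      have "\<bar>clip M (w x) * cut M x\<bar> \<le> \<bar>w x\<bar> * 1"
        unfolding abs_mult using clip cut by (intro mult_mono) auto
      then show "norm \<bar>w x - clip M (w x) * cut M x\<bar> \<le> 2 * \<bar>w x\<bar>" by simp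
    qed
  qed auto
  then obtain M where M: "(\<integral>x. \<bar>w x - clip M (w x) * cut M x\<bar> \<partial>lborel) < e / 2"
    using \<open>e > 0\<close> by (auto simp: lim_sequentially dist_real_def dest!: spec[of _ "e / 2"])
  \<comment> \<open>Measurability in this sense supplies continuous functions that converge to
    \<open>w\<close> off a null set.\<close>
  have "w measurable_on UNIV"
    by (rule lebesgue_measurable_imp_measurable_on) (auto intro: measurable_completion)
  then obtain N g where N: "negligible N" and g: "\<And>n. continuous_on UNIV (g n)"
    "\<And>x. x \<notin> N \<Longrightarrow> (\<lambda>n. g n x) \<longlonglongrightarrow> w x"
    unfolding measurable_on_def by auto
  have [measurable]: "g n \<in> borel_measurable borel" for n
    using g by (auto intro: borel_measurable_continuous_onI)
  have AEN: "AE x in lborel. x \<notin> N"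
  proof -
    have "N \<in> null_sets lebesgue" using N by (simp add: negligible_iff_null_sets)
    then have "AE x in lebesgue. x \<notin> N" by (rule AE_not_in)
    then show ?thesis by (simp add: AE_completion_iff)
  qed
  have int_cut: "integrable lborel (cut M)"
    by (rule integrable_continuous_bounded_supp[OF cut(3)])
       (rule bounded_subset[OF bounded_cball[of 0 "real M + 1"]], auto simp: cut_def)
  have "(\<lambda>n. \<integral>x. \<bar>clip M (w x) * cut M x - clip M (g n x) * cut M x\<bar> \<partial>lborel) \<longlonglongrightarrow> (\<integral>x. 0 \<partial>(lborel :: 'a measure))"
  proof (rule integral_dominated_convergence[where w = "\<lambda>x. 2 * real M * cut M x"])
    show "integrable lborel (\<lambda>x. 2 * real M * cut M x)" using int_cut by simp
    show "AE x in lborel. (\<lambda>n. \<bar>clip M (w x) * cut M x - clip M (g n x) * cut M x\<bar>) \<longlonglongrightarrow> 0"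
      using AEN
    proof eventually_elim
      case (elim x)
      have "(\<lambda>n. clip M (g n x)) \<longlonglongrightarrow> clip M (w x)"
        unfolding clip_def by (intro tendsto_intros g(2) elim)
      then have "(\<lambda>n. \<bar>clip M (w x) * cut M x - clip M (g n x) * cut M x\<bar>) \<longlonglongrightarrow> \<bar>clip M (w x) * cut M x - clip M (w x) * cut M x\<bar>"
        by (intro tendsto_intros)
      then show ?case by simp
    qed
    show "AE x in lborel. norm \<bar>clip M (w x) * cut M x - clip M (g n x) * cut M x\<bar> \<le> 2 * real M * cut M x" for n
    proof (rule AE_I2)
      fix x
      have "\<bar>clip M (w x) - clip M (g n x)\<bar> \<le> 2 * real M"
        using clip(1)[of M "w x"] clip(1)[of M "g n x"] by linarith
      then have "\<bar>clip M (w x) - clip M (g n x)\<bar> * cut M x \<le> 2 * real M * cut M x"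
        using cut(1) by (rule mult_right_mono)
      then show "norm \<bar>clip M (w x) * cut M x - clip M (g n x) * cut M x\<bar> \<le> 2 * real M * cut M x"
        using cut(1)[of M x] by (simp add: abs_mult flip: left_diff_distrib)
    qed
  qed auto
  then obtain n where n: "(\<integral>x. \<bar>clip M (w x) * cut M x - clip M (g n x) * cut M x\<bar> \<partial>lborel) < e / 2"
    using \<open>e > 0\<close> by (auto simp: lim_sequentially dist_real_def dest!: spec[of _ "e / 2"])
  define G where "G x = clip M (g n x) * cut M x" for x
  have G: "continuous_on UNIV G" "bounded {x. G x \<noteq> 0}"
  proof -
    show "continuous_on UNIV G"
      unfolding G_def by (intro continuous_on_mult cut continuous_on_compose2[OF clip(3) g(1)]) auto
    show "bounded {x. G x \<noteq> 0}"
      by (rule bounded_subset[OF bounded_cball[of 0 "real M + 1"]]) (auto simp: G_def cut_def)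
  qed
  have iG: "integrable lborel G" by (rule integrable_continuous_bounded_supp[OF G])
  have i1: "integrable lborel (\<lambda>x. clip M (w x) * cut M x)"
    by (rule Bochner_Integration.integrable_bound[OF w])
       (use clip cut in \<open>auto simp: abs_mult intro!: AE_I2 mult_left_le order_trans[OF mult_mono[OF clip(2) cut(2)]]\<close>)
  have "(\<integral>x. \<bar>w x - G x\<bar> \<partial>lborel) \<le> (\<integral>x. \<bar>w x - clip M (w x) * cut M x\<bar> + \<bar>clip M (w x) * cut M x - G x\<bar> \<partial>lborel)"
    by (rule integral_mono) (use w iG i1 in auto)
  also have "\<dots> = (\<integral>x. \<bar>w x - clip M (w x) * cut M x\<bar> \<partial>lborel) + (\<integral>x. \<bar>clip M (w x) * cut M x - G x\<bar> \<partial>lborel)"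
    using w iG i1 by simp
  also have "\<dots> < e" using M n by (simp add: G_def)
  finally show ?thesis using that G by blast
qed

section \<open>Mollification\<close>

text \<open>Evenness is included because it makes convolution self-adjoint, so that mollification
  can be moved from a vector field to the function it is tested against.\<close>

definition mollifier :: "real \<Rightarrow> ('a::euclidean_space \<Rightarrow> real) \<Rightarrow> bool" where
  "mollifier e \<rho> \<longleftrightarrow> smooth \<rho> \<and> (\<forall>x. \<rho> x \<ge> 0) \<and> (\<forall>x. \<rho> (- x) = \<rho> x) \<and>
     (\<forall>x. norm x \<ge> e \<longrightarrow> \<rho> x = 0) \<and> integral\<^sup>L lborel \<rho> = 1"

lemma mollifierD:
  assumes "mollifier e \<rho>"
  shows "smooth \<rho>" "\<rho> x \<ge> 0" "\<rho> (- x) = \<rho> x" "norm x \<ge> e \<Longrightarrow> \<rho> x = 0" "integral\<^sup>L lborel \<rho> = 1"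
    "bounded {x. \<rho> x \<noteq> 0}" "integrable lborel \<rho>" "\<rho> \<in> borel_measurable borel"
proof -
  show s: "smooth \<rho>" "\<rho> x \<ge> 0" "\<rho> (- x) = \<rho> x" "norm x \<ge> e \<Longrightarrow> \<rho> x = 0" "integral\<^sup>L lborel \<rho> = 1"
    using assms by (auto simp: mollifier_def)
  have "\<forall>x. norm x \<ge> e \<longrightarrow> \<rho> x = 0" using assms by (auto simp: mollifier_def)
  then show b: "bounded {x. \<rho> x \<noteq> 0}"
    by (intro bounded_subset[OF bounded_cball[of 0 e]]) (auto, meson linear)
  show "integrable lborel \<rho>"
    by (rule integrable_continuous_bounded_supp[OF smooth_continuous[OF s(1)] b])
  show "\<rho> \<in> borel_measurable borel"
    by (rule borel_measurable_continuous_onI[OF smooth_continuous[OF s(1)]])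
qed

lemma integral_reflected_shift:
  fixes g :: "'a::euclidean_space \<Rightarrow> real"
  assumes "g \<in> borel_measurable borel"
  shows "(\<integral>y. g (x - y) \<partial>lborel) = integral\<^sup>L lborel g"
proof -
  have "(\<integral>y. g (x - y) \<partial>lborel) = (\<integral>y. g (x + (-1) *\<^sub>R y) \<partial>lborel)"
    by simp
  also have "\<dots> = integral\<^sup>L lborel g"
    by (rule integral_lborel_affine_unit(1)[OF assms]) simp
  finally show ?thesis .
qed

text \<open>For fixed \<open>y\<close> the kernel has mass one in \<open>x\<close>, so after Tonelli
  averaging cannot increase the norm. Nonnegative integrals make integrability of the convolution
  part of the conclusion.\<close>

lemma conv_L1_bound:
  fixes v :: "'a::euclidean_space \<Rightarrow> real"
  assumes \<rho>: "mollifier e \<rho>" and v: "integrable lborel v"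
  shows "integrable lborel (conv \<rho> v)" "(\<integral>x. \<bar>conv \<rho> v x\<bar> \<partial>lborel) \<le> (\<integral>x. \<bar>v x\<bar> \<partial>lborel)"
proof -
  note r = mollifierD[OF \<rho>]
  have [measurable]: "\<rho> \<in> borel_measurable borel" "v \<in> borel_measurable borel" using r v by auto
  have [measurable]: "conv \<rho> v \<in> borel_measurable borel"
    by (rule borel_measurable_continuous_onI[OF smooth_continuous[OF conv_smooth[OF r(1,6) v]]])
  have nn\<rho>: "(\<integral>\<^sup>+x. ennreal (\<rho> (x - y)) \<partial>lborel) = 1" for y
  proof -
    have "(\<integral>\<^sup>+x. ennreal (norm (\<rho> (- y + 1 *\<^sub>R x))) \<partial>lborel) = (\<integral>\<^sup>+x. ennreal (norm (\<rho> x)) \<partial>lborel)"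
      by (rule integral_lborel_affine_unit(2)) auto
    also have "\<dots> = ennreal (integral\<^sup>L lborel \<rho>)"
      using r(2) by (simp add: nn_integral_eq_integral[OF r(7)])
    finally show ?thesis using r(2,5) by simp
  qed
  have "(\<integral>\<^sup>+x. ennreal \<bar>conv \<rho> v x\<bar> \<partial>lborel) \<le> (\<integral>\<^sup>+x. \<integral>\<^sup>+y. ennreal (\<rho> (x - y)) * ennreal \<bar>v y\<bar> \<partial>lborel \<partial>lborel)"
  proof (rule nn_integral_mono)
    fix x
    have "integrable lborel (\<lambda>y. \<rho> (x - y) *\<^sub>R v y)"
      by (rule integrable_conv[OF smooth_continuous[OF r(1)] r(6) v])
    from integral_norm_bound_ennreal[OF this]
    show "ennreal \<bar>conv \<rho> v x\<bar> \<le> (\<integral>\<^sup>+y. ennreal (\<rho> (x - y)) * ennreal \<bar>v y\<bar> \<partial>lborel)"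
      using r(2) by (simp add: conv_def abs_mult ennreal_mult)
  qed
  also have "\<dots> = (\<integral>\<^sup>+y. \<integral>\<^sup>+x. ennreal (\<rho> (x - y)) * ennreal \<bar>v y\<bar> \<partial>lborel \<partial>lborel)"
    by (rule lborel_pair.Fubini') measurable
  also have "\<dots> = (\<integral>\<^sup>+y. ennreal \<bar>v y\<bar> \<partial>lborel)"
    by (subst nn_integral_multc) (auto simp: nn\<rho>)
  finally have le: "(\<integral>\<^sup>+x. ennreal \<bar>conv \<rho> v x\<bar> \<partial>lborel) \<le> (\<integral>\<^sup>+y. ennreal \<bar>v y\<bar> \<partial>lborel)" .
  also have fin: "\<dots> = ennreal (\<integral>x. \<bar>v x\<bar> \<partial>lborel)"
    using v by (subst nn_integral_eq_integral) auto
  finally have le': "(\<integral>\<^sup>+x. ennreal \<bar>conv \<rho> v x\<bar> \<partial>lborel) \<le> ennreal (\<integral>x. \<bar>v x\<bar> \<partial>lborel)" .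
  then show int: "integrable lborel (conv \<rho> v)"
    by (intro integrableI_bounded) (auto intro: order_le_less_trans)
  have "(\<integral>\<^sup>+x. ennreal \<bar>conv \<rho> v x\<bar> \<partial>lborel) = ennreal (\<integral>x. \<bar>conv \<rho> v x\<bar> \<partial>lborel)"
    using int by (subst nn_integral_eq_integral) auto
  with le' show "(\<integral>x. \<bar>conv \<rho> v x\<bar> \<partial>lborel) \<le> (\<integral>x. \<bar>v x\<bar> \<partial>lborel)"
    by simp
qed

text \<open>The error is an average of \<open>g y - g x\<close> over the ball of radius
  \<open>e\<close>. The hypothesis concerns the single point \<open>x\<close>, so the lemma also
  serves with \<open>d = 0\<close>, away from the support of \<open>g\<close>.\<close>

lemma conv_uniform_approx:
  fixes g :: "'a::euclidean_space \<Rightarrow> real"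
  assumes \<rho>: "mollifier e \<rho>" and g: "integrable lborel g" "\<And>y. dist x y < e \<Longrightarrow> \<bar>g y - g x\<bar> \<le> d"
  shows "\<bar>conv \<rho> g x - g x\<bar> \<le> d"
proof -
  note r = mollifierD[OF \<rho>]
  have i1: "integrable lborel (\<lambda>y. \<rho> (x - y) * g y)"
    using integrable_conv[OF smooth_continuous[OF r(1)] r(6) g(1)] by simp
  have one: "(\<integral>y. \<rho> (x - y) \<partial>lborel) = 1"
    using integral_reflected_shift[OF r(8)] r(5) by simp
  then have i2: "integrable lborel (\<lambda>y. \<rho> (x - y))"
    using not_integrable_integral_eq by fastforce
  have "conv \<rho> g x - g x = (\<integral>y. \<rho> (x - y) * g y \<partial>lborel) - (\<integral>y. \<rho> (x - y) * g x \<partial>lborel)"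
    using one by (simp add: conv_def)
  also have "\<dots> = (\<integral>y. \<rho> (x - y) * (g y - g x) \<partial>lborel)"
    unfolding right_diff_distrib using i1 i2 by simp
  finally have "\<bar>conv \<rho> g x - g x\<bar> = \<bar>\<integral>y. \<rho> (x - y) * (g y - g x) \<partial>lborel\<bar>" by simp
  also have "\<dots> \<le> (\<integral>y. \<rho> (x - y) * d \<partial>lborel)"
  proof (rule integral_abs_bound_integral)
    show "integrable lborel (\<lambda>y. \<rho> (x - y) * (g y - g x))"
      unfolding right_diff_distrib using i1 i2 by simp
    show "integrable lborel (\<lambda>y. \<rho> (x - y) * d)" using i2 by simp
    show "\<bar>\<rho> (x - y) * (g y - g x)\<bar> \<le> \<rho> (x - y) * d" for y
    proof (cases "dist x y < e")
      case True
      then show ?thesis using g(2)[OF True] r(2)[of "x - y"] by (simp add: abs_mult mult_left_mono)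
    next
      case False
      then show ?thesis using r(4)[of "x - y"] by (simp add: dist_norm)
    qed
  qed
  also have "\<dots> = d" using one by simp
  finally show ?thesis .
qed

text \<open>A continuous function of bounded support is close to \<open>w\<close> and is
  approximated uniformly by its mollifications; the contraction property in the mean handles the
  remainder. The radius \<open>e0\<close> works for every kernel of that size.\<close>

lemma conv_L1_approx:
  fixes w :: "'a::euclidean_space \<Rightarrow> real"
  assumes w: "integrable lborel w" and "\<epsilon> > 0"
  obtains e0 where "e0 > 0"
    "\<And>e \<rho>. mollifier e \<rho> \<Longrightarrow> e \<le> e0 \<Longrightarrow> (\<integral>x. \<bar>conv \<rho> w x - w x\<bar> \<partial>lborel) \<le> \<epsilon>"
proof -
  obtain g where g: "continuous_on UNIV g" "bounded {x. g x \<noteq> 0}" "(\<integral>x. \<bar>w x - g x\<bar> \<partial>lborel) < \<epsilon> / 3"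
    using L1_approx_continuous[OF w, of "\<epsilon> / 3"] \<open>\<epsilon> > 0\<close> by auto
  have gi: "integrable lborel g" by (rule integrable_continuous_bounded_supp[OF g(1,2)])
  obtain R where R: "\<And>x. g x \<noteq> 0 \<Longrightarrow> norm x \<le> R"
    using g(2) by (auto simp: bounded_iff)
  define V where "V = measure lborel (cball (0::'a) (R + 1))"
  have V: "V \<ge> 0" by (simp add: V_def)
  \<comment> \<open>A uniform error \<open>d\<close> on a ball of volume \<open>V\<close> costs at
    most a third of \<open>\<epsilon>\<close>; 1 is added because \<open>V\<close> is only known to
    be nonnegative.\<close>
  define d where "d = \<epsilon> / (3 * (V + 1))"
  have d: "d > 0" "d * V \<le> \<epsilon> / 3"
    using \<open>\<epsilon> > 0\<close> V by (auto simp: d_def field_simps)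
  obtain e1 where e1: "e1 > 0" "\<And>x y. dist x y < e1 \<Longrightarrow> dist (g x) (g y) < d"
    using uniformly_continuous_bounded_supp[OF g(1,2)] d(1)
    unfolding uniformly_continuous_on_def by (metis UNIV_I)
  show ?thesis
  proof
    show "min e1 1 > 0" using e1 by simp
    fix e and \<rho> :: "'a \<Rightarrow> real" assume \<rho>: "mollifier e \<rho>" and e: "e \<le> min e1 1"
    note r = mollifierD[OF \<rho>]
    have gb: "\<bar>conv \<rho> g x - g x\<bar> \<le> d * indicator (cball 0 (R + 1)) x" for x
    proof (cases "norm x \<le> R + 1")
      case True
      have "\<bar>conv \<rho> g x - g x\<bar> \<le> d"
        by (rule conv_uniform_approx[OF \<rho> gi])
           (use e1(2) e in \<open>force simp: dist_commute dist_real_def intro: less_imp_le\<close>)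
      then show ?thesis using True by simp
    next
      case False
      then have "g x = 0" using R[of x] by force
      have "\<bar>conv \<rho> g x - g x\<bar> \<le> 0"
      proof (rule conv_uniform_approx[OF \<rho> gi])
        fix y assume "dist x y < e"
        then have "norm y > R" using False e norm_triangle_ineq2[of x "x - y"] by (simp add: dist_norm)
        then have "g y = 0" using R[of y] by force
        then show "\<bar>g y - g x\<bar> \<le> 0" using \<open>g x = 0\<close> by simp
      qed
      then show ?thesis using d by simp
    qed
    have i0: "integrable lborel (\<lambda>x. d * indicator (cball (0::'a) (R + 1)) x)"
      by (intro integrable_mult_right integrable_real_indicator)
         (use emeasure_lborel_cball_finite[of "0::'a" "R + 1"] in \<open>simp_all add: less_top\<close>)
    have wg: "integrable lborel (\<lambda>x. w x - g x)" using w gi by simp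
    have ci: "integrable lborel (conv \<rho> w)" "integrable lborel (conv \<rho> g)" "integrable lborel (conv \<rho> (\<lambda>x. w x - g x))"
      using conv_L1_bound(1)[OF \<rho>] w gi wg by auto
    have c_diff: "conv \<rho> (\<lambda>x. w x - g x) x = conv \<rho> w x - conv \<rho> g x" for x
      using integrable_conv[OF smooth_continuous[OF r(1)] r(6) w, of x]
        integrable_conv[OF smooth_continuous[OF r(1)] r(6) gi, of x]
      by (simp add: conv_def right_diff_distrib)
    have "(\<integral>x. \<bar>conv \<rho> w x - w x\<bar> \<partial>lborel) \<le>
        (\<integral>x. \<bar>conv \<rho> (\<lambda>x. w x - g x) x\<bar> + \<bar>conv \<rho> g x - g x\<bar> + \<bar>w x - g x\<bar> \<partial>lborel)"
      by (rule integral_mono) (use ci w gi in \<open>auto simp: c_diff\<close>)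
    also have "\<dots> = (\<integral>x. \<bar>conv \<rho> (\<lambda>x. w x - g x) x\<bar> \<partial>lborel) + (\<integral>x. \<bar>conv \<rho> g x - g x\<bar> \<partial>lborel) + (\<integral>x. \<bar>w x - g x\<bar> \<partial>lborel)"
      using ci w gi by simp
    also have "\<dots> \<le> (\<integral>x. \<bar>w x - g x\<bar> \<partial>lborel) + (\<integral>x. d * indicator (cball (0::'a) (R + 1)) x \<partial>lborel) + (\<integral>x. \<bar>w x - g x\<bar> \<partial>lborel)"
      by (intro add_mono order_refl conv_L1_bound(2)[OF \<rho> wg] integral_mono i0 gb) (use ci gi in auto)
    also have "\<dots> = (\<integral>x. \<bar>w x - g x\<bar> \<partial>lborel) + d * V + (\<integral>x. \<bar>w x - g x\<bar> \<partial>lborel)"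
      by (simp add: V_def)
    also have "\<dots> \<le> \<epsilon>" using g(3) d(2) by simp
    finally show "(\<integral>x. \<bar>conv \<rho> w x - w x\<bar> \<partial>lborel) \<le> \<epsilon>" .
  qed
qed

lemma conv_supp:
  fixes Z :: "'a::euclidean_space \<Rightarrow> 'b::{banach,second_countable_topology}"
  assumes "mollifier e \<rho>" "\<And>y. Z y \<noteq> 0 \<Longrightarrow> norm y \<le> R" "conv \<rho> Z x \<noteq> 0"
  shows "norm x \<le> R + e"
proof (rule ccontr)
  assume x: "\<not> norm x \<le> R + e"
  have "\<rho> (x - y) *\<^sub>R Z y = 0" for y
  proof (cases "Z y = 0")
    case False
    then have "norm y \<le> R" by (rule assms(2))
    then have "norm (x - y) \<ge> e" using x norm_triangle_ineq2[of x y] by simp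
    then show ?thesis using mollifierD(4)[OF assms(1)] by simp
  qed simp
  then have "(\<lambda>y. \<rho> (x - y) *\<^sub>R Z y) = (\<lambda>y. 0)" by blast
  then show False using assms(3) unfolding conv_def by simp
qed

text \<open>Averages of vectors of norm at most 1 have norm at most 1. The field constructed for the
  competitor is only continuous, and this turns it into an admissible one.\<close>

lemma conv_test_field:
  fixes Z :: "'a::euclidean_space \<Rightarrow> 'a"
  assumes \<rho>: "mollifier e \<rho>" and Z: "Z \<in> borel_measurable borel" "\<And>x. norm (Z x) \<le> 1"
    and R: "\<And>x. Z x \<noteq> 0 \<Longrightarrow> norm x \<le> R"
  shows "conv \<rho> Z \<in> test_fields"
proof -
  note r = mollifierD[OF \<rho>]
  have "bounded {x. Z x \<noteq> 0}"
    using R by (auto simp: bounded_iff)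
  then have Zi: "integrable lborel Z" by (rule integrable_bounded_supp[OF Z(1) _ Z(2)])
  have "norm (conv \<rho> Z x) \<le> 1" for x
  proof -
    have one: "(\<integral>y. \<rho> (x - y) \<partial>lborel) = 1"
      using integral_reflected_shift[OF r(8)] r(5) by simp
    have "norm (conv \<rho> Z x) \<le> (\<integral>y. \<rho> (x - y) \<partial>lborel)"
      unfolding conv_def
    proof (rule Bochner_Integration.integral_norm_bound_integral)
      show "integrable lborel (\<lambda>y. \<rho> (x - y) *\<^sub>R Z y)"
        by (rule integrable_conv[OF smooth_continuous[OF r(1)] r(6) Zi])
      show "integrable lborel (\<lambda>y. \<rho> (x - y))"
        using one not_integrable_integral_eq by fastforce
      show "norm (\<rho> (x - y) *\<^sub>R Z y) \<le> \<rho> (x - y)" for y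
        using mult_left_mono[OF Z(2)[of y] r(2)[of "x - y"]] r(2)[of "x - y"] by simp
    qed
    then show ?thesis using one by simp
  qed
  moreover have "bounded {x. conv \<rho> Z x \<noteq> 0}"
    using conv_supp[OF \<rho> R] by (auto simp: bounded_iff)
  ultimately show ?thesis
    unfolding test_fields_def using conv_smooth[OF r(1,6) Zi] by blast
qed

text \<open>All derivatives sit on the kernel, so \<open>w\<close> need only be integrable and
  \<open>Z\<close> bounded, measurable and of bounded support. Fubini exchanges the two integrals.
  Read from right to left, the identity replaces a gradient of the mollified function by a quantity
  that the total variation controls.\<close>

lemma integral_div_conv:
  fixes Z :: "'a::euclidean_space \<Rightarrow> 'a" and w :: "'a \<Rightarrow> real"
  assumes \<rho>: "mollifier e \<rho>" and Z: "Z \<in> borel_measurable borel" "\<And>x. norm (Z x) \<le> 1"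
    and R: "\<And>x. Z x \<noteq> 0 \<Longrightarrow> norm x \<le> R" and w: "integrable lborel w"
  shows "(\<integral>x. w x * divergence (conv \<rho> Z) x \<partial>lborel) = - (\<integral>x. grad (conv \<rho> w) x \<bullet> Z x \<partial>lborel)"
proof -
  note r = mollifierD[OF \<rho>]
  have "bounded {x. Z x \<noteq> 0}" using R by (auto simp: bounded_iff)
  then have Zi: "integrable lborel Z" by (rule integrable_bounded_supp[OF Z(1) _ Z(2)])
  have gb: "bounded {x. grad \<rho> x \<noteq> 0}"
    by (rule bounded_subset[OF bounded_closure[OF r(6)]]) (use grad_eq_0_outside in auto)
  have gc: "continuous_on UNIV (grad \<rho>)" by (rule continuous_grad[OF r(1)])
  obtain M where M: "M > 0" "\<And>x. norm (grad \<rho> x) \<le> M"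
    using bounded_range_bounded_supp[OF gc gb] by auto
  have [measurable]: "grad \<rho> \<in> borel_measurable borel" "Z \<in> borel_measurable borel" "w \<in> borel_measurable borel"
    using borel_measurable_continuous_onI[OF gc] Z w by auto
  \<comment> \<open>The gradient of an even function is odd; this is the minus sign in the
    conclusion.\<close>
  have odd: "grad \<rho> (x - y) = - grad \<rho> (y - x)" for x y
  proof -
    have "((\<lambda>u. \<rho> (- u)) has_derivative (\<lambda>h. grad \<rho> (y - x) \<bullet> (- h))) (at (x - y))"
      by (rule has_derivative_compose[of uminus uminus])
         (auto intro!: derivative_eq_intros has_derivative_grad smooth_differentiable r(1))
    then have "(\<rho> has_derivative (\<lambda>h. (- grad \<rho> (y - x)) \<bullet> h)) (at (x - y))"
      by (simp add: r(3))
    then show ?thesis by (rule grad_eqI)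
  qed
  have ip: "integrable lborel (\<lambda>y. frechet_derivative \<rho> (at (x - y)) i *\<^sub>R Z y)" if "i \<in> Basis" for i x
    by (rule integrable_conv[OF smooth_continuous[OF smooth_partial[OF r(1) that]] bounded_supp_partial[OF r(6)] Zi])
  have div: "divergence (conv \<rho> Z) x = (\<integral>y. grad \<rho> (x - y) \<bullet> Z y \<partial>lborel)" for x
  proof -
    have "divergence (conv \<rho> Z) x = (\<Sum>i\<in>Basis. (\<integral>y. frechet_derivative \<rho> (at (x - y)) i *\<^sub>R Z y \<partial>lborel) \<bullet> i)"
      by (simp add: divergence_def conv_partial[OF r(1,6) Zi] conv_def)
    also have "\<dots> = (\<Sum>i\<in>Basis. (\<integral>y. (grad \<rho> (x - y) \<bullet> i) * (Z y \<bullet> i) \<partial>lborel))"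
      using ip by (intro sum.cong refl) (simp add: grad_inner_Basis flip: integral_inner_left)
    also have "\<dots> = (\<integral>y. (\<Sum>i\<in>Basis. (grad \<rho> (x - y) \<bullet> i) * (Z y \<bullet> i)) \<partial>lborel)"
    proof (rule Bochner_Integration.integral_sum[symmetric])
      fix i :: 'a assume i: "i \<in> Basis"
      have "integrable lborel (\<lambda>y. (frechet_derivative \<rho> (at (x - y)) i *\<^sub>R Z y) \<bullet> i)"
        using ip[OF i] by (rule integrable_inner_left)
      then show "integrable lborel (\<lambda>y. (grad \<rho> (x - y) \<bullet> i) * (Z y \<bullet> i))"
        using i by (simp add: grad_inner_Basis)
    qed
    also have "\<dots> = (\<integral>y. grad \<rho> (x - y) \<bullet> Z y \<partial>lborel)"
      by (subst (2) euclidean_inner) simp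
    finally show ?thesis .
  qed
  have prod: "integrable (lborel \<Otimes>\<^sub>M lborel) (\<lambda>(x, y). w x * (grad \<rho> (x - y) \<bullet> Z y))"
  proof (rule Bochner_Integration.integrable_bound)
    show "integrable (lborel \<Otimes>\<^sub>M lborel) (\<lambda>(x, y). M * (w x * norm (Z y)))"
    proof -
      have "integrable (lborel \<Otimes>\<^sub>M lborel) (\<lambda>(x, y). w x * norm (Z y))"
        by (rule lborel_pair.Fubini_integrable) (use w Zi in \<open>auto simp: abs_mult\<close>)
      from integrable_mult_right[OF this, of M] show ?thesis by (simp add: case_prod_unfold)
    qed
    show "AE p in lborel \<Otimes>\<^sub>M lborel. norm ((\<lambda>(x, y). w x * (grad \<rho> (x - y) \<bullet> Z y)) p)
        \<le> norm ((\<lambda>(x, y). M * (w x * norm (Z y))) p)"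
    proof (rule AE_I2, clarify)
      fix x y :: 'a
      have "\<bar>grad \<rho> (x - y) \<bullet> Z y\<bar> \<le> M * norm (Z y)"
        using Cauchy_Schwarz_ineq2[of "grad \<rho> (x - y)" "Z y"] mult_right_mono[OF M(2)[of "x - y"], of "norm (Z y)"]
        by auto
      then show "norm (w x * (grad \<rho> (x - y) \<bullet> Z y)) \<le> norm (M * (w x * norm (Z y)))"
        using M(1) mult_left_mono[of "\<bar>grad \<rho> (x - y) \<bullet> Z y\<bar>" "M * norm (Z y)" "\<bar>w x\<bar>"]
        by (simp add: abs_mult mult_ac)
    qed
  qed measurable
  have "(\<integral>x. w x * divergence (conv \<rho> Z) x \<partial>lborel) = (\<integral>x. \<integral>y. w x * (grad \<rho> (x - y) \<bullet> Z y) \<partial>lborel \<partial>lborel)"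
    by (simp add: div)
  also have "\<dots> = (\<integral>y. \<integral>x. w x * (grad \<rho> (x - y) \<bullet> Z y) \<partial>lborel \<partial>lborel)"
    by (rule lborel_pair.Fubini_integral[OF prod, symmetric])
  also have "\<dots> = (\<integral>y. - (grad (conv \<rho> w) y \<bullet> Z y) \<partial>lborel)"
  proof (rule Bochner_Integration.integral_cong[OF refl])
    fix y
    have "w x * (grad \<rho> (x - y) \<bullet> Z y) = - ((grad \<rho> (y - x) \<bullet> Z y) * w x)" for x
      by (subst odd) simp
    then show "(\<integral>x. w x * (grad \<rho> (x - y) \<bullet> Z y) \<partial>lborel) = - (grad (conv \<rho> w) y \<bullet> Z y)"
      by (simp add: grad_conv[OF r(1,6) w])
  qed
  finally show ?thesis by simp
qed

section \<open>The cutoff function and its calibrating field\<close>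

text \<open>The square has two purposes: the profile is continuously differentiable across the
  sphere, and its gradient is a multiple of the unsquared profile \<open>p\<close>. A further factor
  \<open>1 - |x - c| / r\<close>, at most \<open>p\<close> inside the ball, then brings it back to
  the size of \<open>p * p\<close>, the cutoff itself.\<close>

definition cutoff :: "'a::euclidean_space \<Rightarrow> real \<Rightarrow> 'a \<Rightarrow> real" where
  "cutoff c r x = (max 0 (1 - (x - c) \<bullet> (x - c) / r\<^sup>2))\<^sup>2"

lemma max_0_square_has_derivative:
  "((\<lambda>s::real. (max 0 s)\<^sup>2) has_real_derivative 2 * max 0 s) (at s)"
proof -
  consider "s > 0" | "s < 0" | "s = 0" by linarith
  then show ?thesis
  proof cases
    case 1
    have "((\<lambda>s. s\<^sup>2) has_real_derivative 2 * max 0 s) (at s)"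
      using 1 by (auto intro!: derivative_eq_intros)
    then show ?thesis
      by (rule has_field_derivative_transform_within_open[of _ _ _ "{0<..}"]) (use 1 in auto)
  next
    case 2
    have "((\<lambda>s. 0) has_real_derivative 2 * max 0 s) (at s)" using 2 by simp
    then show ?thesis
      by (rule has_field_derivative_transform_within_open[of _ _ _ "{..<0}"]) (use 2 in auto)
  next
    case 3
    have "((\<lambda>h::real. max 0 h) \<longlongrightarrow> max 0 0) (at 0)" by (intro tendsto_intros)
    then have "((\<lambda>h::real. max 0 h) \<longlongrightarrow> 0) (at 0)" by simp
    then have "((\<lambda>h::real. (max 0 h)\<^sup>2 / h) \<longlongrightarrow> 0) (at 0)"
      by (rule Lim_transform_eventually)
         (auto simp: eventually_at_filter max_def power2_eq_square intro!: always_eventually)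
    then show ?thesis unfolding 3 DERIV_def by simp
  qed
qed

lemma cutoff_has_derivative:
  "(cutoff c r has_derivative
     (\<lambda>h. (- (4 * max 0 (1 - (x - c) \<bullet> (x - c) / r\<^sup>2) / r\<^sup>2) *\<^sub>R (x - c)) \<bullet> h)) (at x)"
proof -
  have "((\<lambda>x. 1 - (x - c) \<bullet> (x - c) / r\<^sup>2) has_derivative (\<lambda>h. - (2 * ((x - c) \<bullet> h)) / r\<^sup>2)) (at x)"
    by (auto intro!: derivative_eq_intros simp: inner_commute divide_inverse)
  from has_derivative_compose[OF this max_0_square_has_derivative[unfolded has_field_derivative_def]]
  have "((\<lambda>x. (max 0 (1 - (x - c) \<bullet> (x - c) / r\<^sup>2))\<^sup>2) has_derivative
      (\<lambda>h. 2 * max 0 (1 - (x - c) \<bullet> (x - c) / r\<^sup>2) * (- (2 * ((x - c) \<bullet> h)) / r\<^sup>2))) (at x)" .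
  then show ?thesis
    unfolding cutoff_def[abs_def] by (rule has_derivative_eq_rhs) (simp add: fun_eq_iff)
qed

lemmas cutoff_grad = grad_eqI[OF cutoff_has_derivative]

lemma cutoff_differentiable: "cutoff c r differentiable at x"
  using cutoff_has_derivative unfolding differentiable_def by blast

lemma continuous_cutoff: "continuous_on S (cutoff c r)"
  by (meson continuous_at_imp_continuous_on differentiable_imp_continuous_within cutoff_differentiable)

lemma continuous_grad_cutoff: "continuous_on S (grad (cutoff c r))"
  unfolding cutoff_grad[abs_def] by (cases "r = 0") (auto intro!: continuous_intros)

lemma cutoff_bounds: "0 \<le> cutoff c r x" "cutoff c r x \<le> 1"
  unfolding cutoff_def by (auto simp: abs_square_le_1 intro!: power_le_one)

lemma cutoff_eq_0_iff:
  assumes "r > 0"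
  shows "cutoff c r x = 0 \<longleftrightarrow> x \<notin> ball c r"
proof -
  have "x \<in> ball c r \<longleftrightarrow> (norm (x - c))\<^sup>2 < r\<^sup>2"
    using assms by (metis dist_commute dist_norm mem_ball norm_ge_zero order_less_imp_le power2_less_imp_less power_strict_mono zero_less_numeral)
  also have "\<dots> \<longleftrightarrow> (x - c) \<bullet> (x - c) / r\<^sup>2 < 1"
    using assms by (simp add: power2_norm_eq_inner field_simps)
  finally show ?thesis by (auto simp: cutoff_def max_def)
qed

definition cutoff_field :: "'a::euclidean_space \<Rightarrow> real \<Rightarrow> 'a \<Rightarrow> 'a" where
  "cutoff_field c r x = (cutoff c r x / r) *\<^sub>R (x - c)"

lemma cutoff_field_has_derivative:
  "(cutoff_field c r has_derivative
     (\<lambda>h. (cutoff c r x / r) *\<^sub>R h + ((grad (cutoff c r) x \<bullet> h) / r) *\<^sub>R (x - c))) (at x)"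
proof -
  have "((\<lambda>x. cutoff c r x / r) has_derivative (\<lambda>h. (grad (cutoff c r) x \<bullet> h) / r)) (at x)"
    using has_derivative_mult_left[OF has_derivative_grad[OF cutoff_differentiable[of c r x]], of "inverse r"]
    by (simp add: divide_inverse)
  moreover have "((\<lambda>x. x - c) has_derivative (\<lambda>h. h)) (at x)"
    by (auto intro!: derivative_eq_intros)
  ultimately show ?thesis
    unfolding cutoff_field_def[abs_def] by (rule has_derivative_scaleR)
qed

lemmas cutoff_field_frechet = frechet_derivative_at[OF cutoff_field_has_derivative, symmetric]

text \<open>Since the gradient points towards \<open>c\<close>, the second term is minus the norm of
  the gradient times \<open>|x - c| / r\<close>. It is the reason for choosing a radial
  field.\<close>

lemma divergence_cutoff_field:
  "divergence (cutoff_field c r :: 'a::euclidean_space \<Rightarrow> 'a) x =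
     real DIM('a) * cutoff c r x / r + (grad (cutoff c r) x \<bullet> (x - c)) / r"
proof -
  have "divergence (cutoff_field c r :: 'a \<Rightarrow> 'a) x =
      (\<Sum>i\<in>Basis. cutoff c r x / r + (grad (cutoff c r) x \<bullet> i) * ((x - c) \<bullet> i) / r)"
    unfolding divergence_def cutoff_field_frechet by (simp add: inner_add_left inner_Basis)
  also have "\<dots> = real DIM('a) * cutoff c r x / r + (\<Sum>i\<in>Basis. (grad (cutoff c r) x \<bullet> i) * ((x - c) \<bullet> i)) / r"
    by (simp add: sum.distrib sum_divide_distrib)
  finally show ?thesis by (subst euclidean_inner)
qed

text \<open>On the ball \<open>|x - c| / r\<close> is at most 1. The bound by the cutoff itself, and
  not merely by 1, is what leaves room for this field beside the damped test field.\<close>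

lemma norm_cutoff_field_le:
  assumes "r > 0" shows "norm (cutoff_field c r x) \<le> cutoff c r x"
proof (cases "x \<in> ball c r")
  case True
  then have "norm (x - c) / r \<le> 1" using assms by (simp add: dist_norm norm_minus_commute)
  from mult_left_mono[OF this cutoff_bounds(1)] show ?thesis
    using assms cutoff_bounds(1)[of c r x] by (simp add: cutoff_field_def)
next
  case False
  then have "cutoff c r x = 0" using cutoff_eq_0_iff[OF assms] by blast
  then show ?thesis by (simp add: cutoff_field_def)
qed

text \<open>With \<open>\<sigma> = \<bar>x - c\<bar> / r\<close>, the excess of the gradient norm over its part absorbed by the
  divergence is a multiple of \<open>\<sigma> (1 - \<sigma>) \<le> 1 - \<sigma>\<^sup>2\<close>, hence again of the cutoff.\<close>

lemma divergence_cutoff_field_le: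
  fixes c x :: "'a::euclidean_space"
  assumes "r > 0"
  shows "divergence (cutoff_field c r) x + norm (grad (cutoff c r) x) \<le> (real DIM('a) + 4) / r * cutoff c r x"
proof -
  define p where "p = max 0 (1 - (x - c) \<bullet> (x - c) / r\<^sup>2)"
  define \<sigma> where "\<sigma> = norm (x - c) / r"
  have \<sigma>: "\<sigma> \<ge> 0" "norm (x - c) = \<sigma> * r" "(x - c) \<bullet> (x - c) = \<sigma>\<^sup>2 * r\<^sup>2"
    using assms by (auto simp: \<sigma>_def power2_norm_eq_inner[symmetric] power_divide)
  have p: "p \<ge> 0" "cutoff c r x = p\<^sup>2" "p = max 0 (1 - \<sigma>\<^sup>2)"
    using assms by (auto simp: p_def cutoff_def \<sigma>)
  have g: "grad (cutoff c r) x = (- (4 * p / r\<^sup>2)) *\<^sub>R (x - c)"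
    by (simp add: cutoff_grad p_def)
  have n: "norm (grad (cutoff c r) x) = 4 * p * \<sigma> / r"
    unfolding g using assms p(1) \<sigma> by (simp add: power2_eq_square)
  have "grad (cutoff c r) x \<bullet> (x - c) = - (4 * p * \<sigma>\<^sup>2)"
    unfolding g using assms \<sigma>(3) by simp
  then have "divergence (cutoff_field c r) x + norm (grad (cutoff c r) x) =
      (real DIM('a) * p\<^sup>2 + 4 * (p * (\<sigma> * (1 - \<sigma>)))) / r"
    unfolding divergence_cutoff_field n p(2) using assms by (simp add: field_simps power2_eq_square)
  also have "p * (\<sigma> * (1 - \<sigma>)) \<le> p * p"
  proof (rule mult_left_mono[OF _ p(1)])
    show "\<sigma> * (1 - \<sigma>) \<le> p"
    proof (cases "\<sigma> \<le> 1")
      case True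
      then have "\<sigma> * (1 - \<sigma>) \<le> (1 + \<sigma>) * (1 - \<sigma>)" by (intro mult_right_mono) auto
      then show ?thesis by (simp add: p(3) power2_eq_square algebra_simps)
    next
      case False
      then have "\<sigma> * (1 - \<sigma>) \<le> 0" using \<sigma>(1) by (simp add: mult_nonneg_nonpos)
      then show ?thesis using p(1) by simp
    qed
  qed
  finally show ?thesis
    using assms by (simp add: p(2) power2_eq_square divide_right_mono algebra_simps)
qed

text \<open>This is \<open>(s + |s|) / 2\<close> with the absolute value smoothed, so that the chain
  rule applies. Its derivative lies in the unit interval, which keeps the calibrated field
  admissible, and it exceeds the positive part by at most \<open>\<delta> / 2\<close>.\<close>

definition soft_pos :: "real \<Rightarrow> real \<Rightarrow> real" where
  "soft_pos \<delta> s = (s + sqrt (s\<^sup>2 + \<delta>\<^sup>2)) / 2"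

definition soft_pos' :: "real \<Rightarrow> real \<Rightarrow> real" where
  "soft_pos' \<delta> s = (1 + s / sqrt (s\<^sup>2 + \<delta>\<^sup>2)) / 2"

lemma soft_pos_has_derivative:
  assumes "\<delta> > 0"
  shows "(soft_pos \<delta> has_real_derivative soft_pos' \<delta> s) (at s)"
proof -
  have "s\<^sup>2 + \<delta>\<^sup>2 > 0" using assms by (simp add: add_nonneg_pos)
  then show ?thesis
    unfolding soft_pos_def[abs_def] soft_pos'_def
    by (auto intro!: derivative_eq_intros simp: field_simps)
qed

lemma continuous_soft_pos': "\<delta> > 0 \<Longrightarrow> continuous_on S (soft_pos' \<delta>)"
  unfolding soft_pos'_def[abs_def]
  by (intro continuous_intros) (auto simp: add_nonneg_eq_0_iff)

lemma soft_pos'_bounds: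
  assumes "\<delta> > 0" shows "0 \<le> soft_pos' \<delta> s" "soft_pos' \<delta> s \<le> 1"
proof -
  have "\<bar>s\<bar> \<le> sqrt (s\<^sup>2 + \<delta>\<^sup>2)" by (rule real_le_rsqrt) simp
  moreover have "sqrt (s\<^sup>2 + \<delta>\<^sup>2) > 0" using assms by (simp add: add_nonneg_pos)
  ultimately have "\<bar>s / sqrt (s\<^sup>2 + \<delta>\<^sup>2)\<bar> \<le> 1" by simp
  then have "- 1 \<le> s / sqrt (s\<^sup>2 + \<delta>\<^sup>2)" "s / sqrt (s\<^sup>2 + \<delta>\<^sup>2) \<le> 1"
    by linarith+
  then show "0 \<le> soft_pos' \<delta> s" "soft_pos' \<delta> s \<le> 1" unfolding soft_pos'_def by simp_all
qed

lemma soft_pos_bounds: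
  assumes "\<delta> > 0" shows "max 0 s \<le> soft_pos \<delta> s" "soft_pos \<delta> s \<le> max 0 s + \<delta> / 2"
proof -
  have "\<bar>s\<bar> \<le> sqrt (s\<^sup>2 + \<delta>\<^sup>2)" by (rule real_le_rsqrt) simp
  then show "max 0 s \<le> soft_pos \<delta> s" unfolding soft_pos_def by (auto simp: max_def abs_if split: if_splits)
  have "sqrt (s\<^sup>2 + \<delta>\<^sup>2) \<le> \<bar>s\<bar> + \<delta>"
    using assms by (intro real_le_lsqrt) (auto simp: power2_sum)
  then show "soft_pos \<delta> s \<le> max 0 s + \<delta> / 2" unfolding soft_pos_def by (auto simp: max_def abs_if split: if_splits)
qed

section \<open>Total variation of the truncated competitor\<close>

lemma divergence_eq_0_outside:
  assumes "x \<notin> closure {x. z x \<noteq> 0}" shows "divergence z x = 0"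
  by (simp add: divergence_def frechet_derivative_eq_0_outside[OF assms])

text \<open>With \<phi> the smoothed positive part, the gradient of the competitor is
  \<open>(1 - \<eta> \<phi>') grad g - \<phi> grad \<eta>\<close>. Subtracting
  \<open>\<phi>' W\<close> from the field tested against \<open>grad g\<close> creates a correction
  \<open>grad \<phi> \<bullet> W\<close>, and integration by parts turns it into
  \<open>- \<phi> divergence W\<close>. What remains besides \<open>Z\<close> is \<phi> times the
  divergence of \<open>W\<close> plus \<open>grad \<eta> \<bullet> z\<close>, which the pointwise
  estimate bounds by a multiple of \<open>\<eta> \<phi>\<close>.\<close>

lemma competitor_bound:
  fixes g :: "'a::euclidean_space \<Rightarrow> real" and z :: "'a \<Rightarrow> 'a"
  assumes g: "\<And>x. g differentiable at x" "continuous_on UNIV (grad g)"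
    and z: "z \<in> test_fields" "\<forall>x. z x \<noteq> 0 \<longrightarrow> norm x \<le> R"
    and r: "r > 0" "cball c r \<subseteq> cball 0 R" and \<delta>: "\<delta> > 0"
  shows "\<exists>Z. continuous_on UNIV Z \<and> (\<forall>x. norm (Z x) \<le> 1) \<and> (\<forall>x. Z x \<noteq> 0 \<longrightarrow> norm x \<le> R) \<and>
    (\<integral>x. (g x - cutoff c r x * soft_pos \<delta> (g x - t)) * divergence z x \<partial>lborel) \<le>
       - (\<integral>x. grad g x \<bullet> Z x \<partial>lborel)
       + (real DIM('a) + 4) / r * (\<integral>x. cutoff c r x * soft_pos \<delta> (g x - t) \<partial>lborel)"
proof -
  define \<eta> where "\<eta> = cutoff c r"
  define W where "W = cutoff_field c r"
  define \<phi> where "\<phi> x = soft_pos \<delta> (g x - t)" for x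
  define \<phi>' where "\<phi>' x = soft_pos' \<delta> (g x - t)" for x
  define v where "v x = g x - \<eta> x * \<phi> x" for x
  \<comment> \<open>The factor \<open>1 - \<eta> x * \<phi>' x\<close> is what the truncation leaves
    of \<open>grad g\<close>; the share taken from \<open>z\<close> is given to
    \<open>W\<close>.\<close>
  define Z where "Z x = (1 - \<eta> x * \<phi>' x) *\<^sub>R z x - \<phi>' x *\<^sub>R W x" for x
  have sz: "smooth z" "bounded {x. z x \<noteq> 0}" and z1: "norm (z x) \<le> 1" for x
    using z(1) by (auto simp: test_fields_def)
  have cg: "continuous_on UNIV g"
    using g(1) by (auto simp: continuous_at_imp_continuous_on differentiable_imp_continuous_within)
  have c\<eta>: "continuous_on UNIV \<eta>" "continuous_on UNIV (grad \<eta>)"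
    unfolding \<eta>_def by (rule continuous_cutoff continuous_grad_cutoff)+
  have cW: "continuous_on UNIV W"
    unfolding W_def cutoff_field_def[abs_def] by (intro continuous_intros continuous_cutoff) (use r in auto)
  have cz: "continuous_on UNIV z" by (rule smooth_continuous[OF sz(1)])
  have c\<phi>': "continuous_on UNIV \<phi>'"
    unfolding \<phi>'_def[abs_def]
    by (rule continuous_on_compose2[OF continuous_soft_pos'[OF \<delta>, of UNIV]]) (auto intro!: continuous_intros cg)
  have d\<phi>: "(\<phi> has_derivative (\<lambda>h. (\<phi>' x *\<^sub>R grad g x) \<bullet> h)) (at x)" for x
  proof -
    have "((\<lambda>x. g x - t) has_derivative (\<lambda>h. grad g x \<bullet> h)) (at x)"
      using has_derivative_diff[OF has_derivative_grad[OF g(1)] has_derivative_const[of t]] by simp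
    from has_derivative_compose[OF this soft_pos_has_derivative[OF \<delta>, unfolded has_field_derivative_def]]
    show ?thesis by (simp add: \<phi>_def[abs_def] \<phi>'_def)
  qed
  then have \<phi>_diff: "\<phi> differentiable at x" for x unfolding differentiable_def by blast
  have grad_\<phi>: "grad \<phi> = (\<lambda>x. \<phi>' x *\<^sub>R grad g x)" using grad_eqI[OF d\<phi>] by blast
  have c\<phi>: "continuous_on UNIV \<phi>"
    using \<phi>_diff by (auto simp: continuous_at_imp_continuous_on differentiable_imp_continuous_within)
  have d\<eta>: "(\<eta> has_derivative (\<lambda>h. grad \<eta> x \<bullet> h)) (at x)" for x
    unfolding \<eta>_def by (rule has_derivative_grad[OF cutoff_differentiable])
  have dv: "(v has_derivative (\<lambda>h. ((1 - \<eta> x * \<phi>' x) *\<^sub>R grad g x - \<phi> x *\<^sub>R grad \<eta> x) \<bullet> h)) (at x)" for x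
    unfolding v_def[abs_def]
    by (rule has_derivative_eq_rhs[OF has_derivative_diff[OF has_derivative_grad[OF g(1)] has_derivative_mult[OF d\<eta> d\<phi>]]])
       (auto simp: algebra_simps)
  then have v_diff: "v differentiable at x" for x unfolding differentiable_def by blast
  have grad_v: "grad v = (\<lambda>x. (1 - \<eta> x * \<phi>' x) *\<^sub>R grad g x - \<phi> x *\<^sub>R grad \<eta> x)"
    using grad_eqI[OF dv] by blast
  have cgv: "continuous_on UNIV (grad v)"
    unfolding grad_v by (intro continuous_intros c\<eta> c\<phi> c\<phi>' g)
  have cg\<phi>: "continuous_on UNIV (grad \<phi>)"
    unfolding grad_\<phi> by (intro continuous_intros c\<phi>' g)
  have cZ: "continuous_on UNIV Z"
    unfolding Z_def[abs_def] by (intro continuous_intros c\<eta> c\<phi>' cz cW)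
  have \<eta>_out: "\<eta> x = 0" if "\<not> norm x \<le> R" for x
    unfolding \<eta>_def cutoff_eq_0_iff[OF r(1)] using that r(2) by (force simp: subset_eq less_imp_le)
  then have W_out: "W x = 0" if "\<not> norm x \<le> R" for x
    using that by (simp add: W_def cutoff_field_def \<eta>_def)
  have z_out: "z x = 0" if "\<not> norm x \<le> R" for x using that z(2) by blast
  have b\<eta>: "bounded {x. \<eta> x \<noteq> 0}" and bW: "bounded {x. W x \<noteq> 0}"
    using \<eta>_out W_out by (auto simp: bounded_iff)
  have \<eta>01: "0 \<le> \<eta> x" "\<eta> x \<le> 1" for x unfolding \<eta>_def by (rule cutoff_bounds)+
  have \<phi>'01: "0 \<le> \<phi>' x" "\<phi>' x \<le> 1" for x unfolding \<phi>'_def by (rule soft_pos'_bounds[OF \<delta>])+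
  have \<phi>0: "0 \<le> \<phi> x" for x unfolding \<phi>_def using soft_pos_bounds(1)[OF \<delta>, of "g x - t"] by simp
  \<comment> \<open>The two weights add up to \<open>1 - \<eta> \<phi>' + \<phi>' \<eta>\<close>,
    which is exactly 1.\<close>
  have NZ: "norm (Z x) \<le> 1" for x
  proof -
    have p: "0 \<le> 1 - \<eta> x * \<phi>' x"
      using mult_mono[OF \<eta>01(2) \<phi>'01(2), of x x] \<eta>01 \<phi>'01 by simp
    have "norm (Z x) \<le> (1 - \<eta> x * \<phi>' x) * norm (z x) + \<phi>' x * norm (W x)"
      unfolding Z_def using norm_triangle_ineq4[of "(1 - \<eta> x * \<phi>' x) *\<^sub>R z x" "\<phi>' x *\<^sub>R W x"] p \<phi>'01 by simp
    also have "\<dots> \<le> (1 - \<eta> x * \<phi>' x) * 1 + \<phi>' x * \<eta> x"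
      using norm_cutoff_field_le[OF r(1), of c x]
      by (intro add_mono mult_left_mono z1 p \<phi>'01) (simp add: W_def \<eta>_def)
    finally show ?thesis by (simp add: mult.commute)
  qed
  have Z_out: "norm x \<le> R" if "Z x \<noteq> 0" for x
    using that z_out[of x] W_out[of x] by (cases "norm x \<le> R") (auto simp: Z_def)
  have ibp_v: "(\<integral>x. v x * divergence z x \<partial>lborel) = - (\<integral>x. grad v x \<bullet> z x \<partial>lborel)"
    by (rule integral_by_parts_div[OF v_diff cgv smooth_differentiable[OF sz(1)]
          smooth_continuous[OF smooth_partial[OF sz(1)]] sz(2)])
  have W_diff: "W differentiable at x" for x
    unfolding W_def using cutoff_field_has_derivative differentiable_def by blast
  have cW': "continuous_on UNIV (\<lambda>x. frechet_derivative W (at x) i)" for i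
    unfolding W_def cutoff_field_frechet
    by (intro continuous_intros continuous_cutoff continuous_grad_cutoff) (use r in auto)
  have ibp_\<phi>: "(\<integral>x. \<phi> x * divergence W x \<partial>lborel) = - (\<integral>x. grad \<phi> x \<bullet> W x \<partial>lborel)"
    by (rule integral_by_parts_div[OF \<phi>_diff cg\<phi> W_diff cW' bW])
  have bz: "bounded {x. z x \<noteq> 0}" by (rule sz)
  have bZ: "bounded {x. Z x \<noteq> 0}" using Z_out by (auto simp: bounded_iff)
  have cdW: "continuous_on UNIV (divergence W)"
    unfolding divergence_def[abs_def] by (intro continuous_intros cW')
  have bdW: "bounded {x. divergence W x \<noteq> 0}"
    by (rule bounded_subset[OF bounded_closure[OF bW]]) (use divergence_eq_0_outside in blast)
  have i1: "integrable lborel (\<lambda>x. grad g x \<bullet> Z x)"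
    by (rule integrable_continuous_bounded_supp)
       (auto intro!: continuous_intros g cZ intro: bounded_subset[OF bZ])
  have i2: "integrable lborel (\<lambda>x. \<phi>' x * (grad g x \<bullet> W x))"
    by (rule integrable_continuous_bounded_supp)
       (auto intro!: continuous_intros g cW c\<phi>' intro: bounded_subset[OF bW])
  have i3: "integrable lborel (\<lambda>x. \<phi> x * (grad \<eta> x \<bullet> z x))"
    by (rule integrable_continuous_bounded_supp)
       (auto intro!: continuous_intros c\<eta> cz c\<phi> intro: bounded_subset[OF bz])
  have i4: "integrable lborel (\<lambda>x. \<phi> x * divergence W x)"
    by (rule integrable_continuous_bounded_supp)
       (auto intro!: continuous_intros c\<phi> cdW intro: bounded_subset[OF bdW])
  have i5: "integrable lborel (\<lambda>x. \<eta> x * \<phi> x)"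
    by (rule integrable_continuous_bounded_supp)
       (auto intro!: continuous_intros c\<phi> c\<eta> intro: bounded_subset[OF b\<eta>])
  \<comment> \<open>The middle term is \<open>grad \<phi> x \<bullet> W x\<close>, in the form ready
    for integration by parts.\<close>
  have "grad v x \<bullet> z x = grad g x \<bullet> Z x + \<phi>' x * (grad g x \<bullet> W x) - \<phi> x * (grad \<eta> x \<bullet> z x)" for x
    by (simp add: grad_v Z_def inner_diff_left inner_diff_right algebra_simps)
  then have "(\<integral>x. grad v x \<bullet> z x \<partial>lborel) =
      (\<integral>x. grad g x \<bullet> Z x \<partial>lborel) + (\<integral>x. \<phi>' x * (grad g x \<bullet> W x) \<partial>lborel) - (\<integral>x. \<phi> x * (grad \<eta> x \<bullet> z x) \<partial>lborel)"
    using i1 i2 i3 by simp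
  moreover have "(\<integral>x. \<phi>' x * (grad g x \<bullet> W x) \<partial>lborel) = - (\<integral>x. \<phi> x * divergence W x \<partial>lborel)"
    using ibp_\<phi> by (simp add: grad_\<phi>)
  ultimately have eq: "(\<integral>x. v x * divergence z x \<partial>lborel) = - (\<integral>x. grad g x \<bullet> Z x \<partial>lborel) +
      ((\<integral>x. \<phi> x * divergence W x \<partial>lborel) + (\<integral>x. \<phi> x * (grad \<eta> x \<bullet> z x) \<partial>lborel))"
    using ibp_v by simp
  have "(\<integral>x. \<phi> x * divergence W x \<partial>lborel) + (\<integral>x. \<phi> x * (grad \<eta> x \<bullet> z x) \<partial>lborel) =
      (\<integral>x. \<phi> x * divergence W x + \<phi> x * (grad \<eta> x \<bullet> z x) \<partial>lborel)"
    using i3 i4 by simp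
  also have "\<dots> \<le> (\<integral>x. (real DIM('a) + 4) / r * (\<eta> x * \<phi> x) \<partial>lborel)"
  proof (rule integral_mono)
    fix x
    have "grad \<eta> x \<bullet> z x \<le> norm (grad \<eta> x) * norm (z x)" by (rule norm_cauchy_schwarz)
    also have "\<dots> \<le> norm (grad \<eta> x) * 1" by (intro mult_left_mono z1) auto
    finally have "divergence W x + grad \<eta> x \<bullet> z x \<le> (real DIM('a) + 4) / r * \<eta> x"
      using divergence_cutoff_field_le[OF r(1), of c x] by (simp add: W_def \<eta>_def)
    from mult_left_mono[OF this \<phi>0]
    show "\<phi> x * divergence W x + \<phi> x * (grad \<eta> x \<bullet> z x) \<le> (real DIM('a) + 4) / r * (\<eta> x * \<phi> x)"
      by (simp add: algebra_simps)
  qed (use i3 i4 i5 in auto)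
  also have "\<dots> = (real DIM('a) + 4) / r * (\<integral>x. \<eta> x * \<phi> x \<partial>lborel)" by simp
  finally have "(\<integral>x. v x * divergence z x \<partial>lborel) \<le> - (\<integral>x. grad g x \<bullet> Z x \<partial>lborel) +
      (real DIM('a) + 4) / r * (\<integral>x. \<eta> x * \<phi> x \<partial>lborel)"
    using eq by simp
  then show ?thesis
    using cZ NZ Z_out unfolding v_def \<eta>_def \<phi>_def by (intro exI[of _ Z] conjI allI impI)
qed

lemma continuous_divergence: "smooth z \<Longrightarrow> continuous_on S (divergence z)"
  unfolding divergence_def[abs_def] by (intro continuous_intros smooth_continuous smooth_partial)

lemma bounded_supp_divergence:
  assumes "bounded {x. z x \<noteq> 0}" shows "bounded {x. divergence z x \<noteq> 0}"
proof (rule bounded_subset[OF bounded_closure[OF assms]], rule subsetI, rule ccontr)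
  fix x assume "x \<in> {x. divergence z x \<noteq> 0}" "x \<notin> closure {x. z x \<noteq> 0}"
  then show False using divergence_eq_0_outside[of x z] by simp
qed

lemma divergence_supp:
  fixes z :: "'a::euclidean_space \<Rightarrow> 'a"
  assumes "\<And>x. z x \<noteq> 0 \<Longrightarrow> norm x \<le> R" "divergence z x \<noteq> 0"
  shows "norm x \<le> R"
proof -
  have "closure {x. z x \<noteq> 0} \<subseteq> cball 0 R"
    by (rule closure_minimal) (use assms(1) in auto)
  then show ?thesis using assms(2) divergence_eq_0_outside[of x z] by (metis mem_cball_0 subsetD)
qed

text \<open>The smooth estimate is applied to a mollification \<open>g\<close> of \<open>w\<close>.
  Its field \<open>Z\<close> is moved back to \<open>w\<close> by self-adjointness, where
  \<open>T\<close> bounds it, and the error vanishes because truncation is Lipschitz in the mean.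
  Mollifying enlarges supports, hence \<open>R + 1\<close> in the hypothesis on
  \<open>T\<close>.\<close>

lemma truncation_integral_bound:
  fixes w :: "'a::euclidean_space \<Rightarrow> real" and z :: "'a \<Rightarrow> 'a"
  assumes w: "integrable lborel w"
    and T: "\<And>z. z \<in> test_fields \<Longrightarrow> (\<And>x. z x \<noteq> 0 \<Longrightarrow> norm x \<le> R + 1) \<Longrightarrow> (\<integral>x. w x * divergence z x \<partial>lborel) \<le> T"
    and z: "z \<in> test_fields" "\<And>x. z x \<noteq> 0 \<Longrightarrow> norm x \<le> R"
    and r: "r > 0" "cball c r \<subseteq> cball 0 R"
  shows "(\<integral>x. (w x - cutoff c r x * max 0 (w x - t)) * divergence z x \<partial>lborel) \<le>
     T + (real DIM('a) + 4) / r * (\<integral>x. cutoff c r x * max 0 (w x - t) \<partial>lborel)"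
proof -
  define C where "C = (real DIM('a) + 4) / r"
  have C: "C \<ge> 0" using r by (simp add: C_def)
  define \<eta> where "\<eta> = cutoff c r"
  have \<eta>: "0 \<le> \<eta> x" "\<eta> x \<le> 1" "continuous_on UNIV \<eta>" for x
    unfolding \<eta>_def by (rule cutoff_bounds continuous_cutoff)+
  have b\<eta>: "bounded {x. \<eta> x \<noteq> 0}"
    by (rule bounded_subset[OF bounded_ball[of c r]]) (use cutoff_eq_0_iff[OF r(1), of c] in \<open>unfold \<eta>_def, blast\<close>)
  have i\<eta>: "integrable lborel \<eta>" by (rule integrable_continuous_bounded_supp[OF \<eta>(3) b\<eta>])
  define H where "H = integral\<^sup>L lborel \<eta>"
  have H: "H \<ge> 0" unfolding H_def using \<eta> by simp
  have sz: "smooth z" "bounded {x. z x \<noteq> 0}" using z(1) by (auto simp: test_fields_def)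
  have cd: "continuous_on UNIV (divergence z)" by (rule continuous_divergence[OF sz(1)])
  obtain D where D: "D > 0" "\<And>x. norm (divergence z x) \<le> D"
    using bounded_range_bounded_supp[OF cd bounded_supp_divergence[OF sz(2)]] by auto
  have [measurable]: "w \<in> borel_measurable borel" "\<eta> \<in> borel_measurable borel"
    "divergence z \<in> borel_measurable borel"
    using w borel_measurable_continuous_onI[OF \<eta>(3)] borel_measurable_continuous_onI[OF cd] by auto
  have int_pos: "integrable lborel (\<lambda>x. \<eta> x * max 0 (w x - t))"
  proof (rule Bochner_Integration.integrable_bound)
    show "integrable lborel (\<lambda>x. \<bar>w x\<bar> + \<bar>t\<bar> * \<eta> x)" using w i\<eta> by simp
    show "AE x in lborel. norm (\<eta> x * max 0 (w x - t)) \<le> norm (\<bar>w x\<bar> + \<bar>t\<bar> * \<eta> x)"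
    proof (rule AE_I2)
      fix x
      have "\<eta> x * max 0 (w x - t) \<le> \<eta> x * (\<bar>w x\<bar> + \<bar>t\<bar>)"
        by (intro mult_left_mono \<eta>) auto
      also have "\<dots> \<le> \<bar>w x\<bar> + \<bar>t\<bar> * \<eta> x"
        using mult_right_mono[OF \<eta>(2)[of x], of "\<bar>w x\<bar>"] by (simp add: algebra_simps)
      finally show "norm (\<eta> x * max 0 (w x - t)) \<le> norm (\<bar>w x\<bar> + \<bar>t\<bar> * \<eta> x)"
        using \<eta>(1)[of x] by simp
    qed
  qed measurable
  have int_div: "integrable lborel (\<lambda>x. f x * divergence z x)" if "integrable lborel f" for f :: "'a \<Rightarrow> real"
  proof (rule Bochner_Integration.integrable_bound)
    show "integrable lborel (\<lambda>x. D * f x)" using that by simp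
    have [measurable]: "f \<in> borel_measurable borel" using that by auto
    show "(\<lambda>x. f x * divergence z x) \<in> borel_measurable lborel" by simp
    show "AE x in lborel. norm (f x * divergence z x) \<le> norm (D * f x)"
      using D mult_left_mono[OF D(2), of "\<bar>f _\<bar>"] by (auto intro!: AE_I2 simp: abs_mult mult.commute)
  qed
  define A where "A = (\<integral>x. (w x - \<eta> x * max 0 (w x - t)) * divergence z x \<partial>lborel)"
  define B where "B = (\<integral>x. \<eta> x * max 0 (w x - t) \<partial>lborel)"
  \<comment> \<open>The part with \<open>D\<close> pays for replacing the truncated \<open>g\<close>
    by the truncated \<open>w\<close> under the divergence; the part with \<open>C\<close> pays for
    the same replacement in the penalty integral.\<close>
  define K where "K = D * (2 + H / 2) + C * (1 + H / 2)"
  have K: "K \<ge> 0" using D C H by (simp add: K_def)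
  \<comment> \<open>A single \<open>\<epsilon>\<close> serves as accuracy of the mollification and
    as smoothing parameter of the positive part.\<close>
  have main: "A \<le> T + C * B + K * \<epsilon>" if "\<epsilon> > 0" for \<epsilon>
  proof -
    obtain e0 where e0: "e0 > 0"
      "\<And>e \<rho>. mollifier e \<rho> \<Longrightarrow> e \<le> e0 \<Longrightarrow> (\<integral>x. \<bar>conv \<rho> w x - w x\<bar> \<partial>lborel) \<le> \<epsilon>"
      using conv_L1_approx[OF w \<open>\<epsilon> > 0\<close>] by metis
    \<comment> \<open>The bound 1 keeps the mollified field within radius \<open>R + 1\<close>,
      where \<open>T\<close> applies.\<close>
    define e where "e = min e0 1"
    have e: "e > 0" "e \<le> e0" "e \<le> 1" using e0 by (auto simp: e_def)
    obtain \<rho> :: "'a \<Rightarrow> real" where \<rho>: "mollifier e \<rho>"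
      using mollifier_exists[OF e(1)] unfolding mollifier_def by metis
    note rho = mollifierD[OF \<rho>]
    define g where "g = conv \<rho> w"
    have sg: "smooth g" unfolding g_def by (rule conv_smooth[OF rho(1,6) w])
    have gi: "integrable lborel g" unfolding g_def by (rule conv_L1_bound(1)[OF \<rho> w])
    have gw: "(\<integral>x. \<bar>g x - w x\<bar> \<partial>lborel) \<le> \<epsilon>" unfolding g_def by (rule e0(2)[OF \<rho> e(2)])
    define p where "p x = \<eta> x * soft_pos \<epsilon> (g x - t)" for x
    have z2: "\<forall>x. z x \<noteq> 0 \<longrightarrow> norm x \<le> R" using z(2) by blast
    obtain Z where Z: "continuous_on UNIV Z" "\<forall>x. norm (Z x) \<le> 1" "\<forall>x. Z x \<noteq> 0 \<longrightarrow> norm x \<le> R"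
      "(\<integral>x. (g x - cutoff c r x * soft_pos \<epsilon> (g x - t)) * divergence z x \<partial>lborel) \<le>
        - (\<integral>x. grad g x \<bullet> Z x \<partial>lborel) +
        (real DIM('a) + 4) / r * (\<integral>x. cutoff c r x * soft_pos \<epsilon> (g x - t) \<partial>lborel)"
      using competitor_bound[OF smooth_differentiable[OF sg] continuous_grad[OF sg] z(1) z2 r \<open>\<epsilon> > 0\<close>, where t = t]
      by (elim exE conjE) (rule that)
    note Z' = spec[OF Z(2)] mp[OF spec[OF Z(3)]]
    have mZ: "Z \<in> borel_measurable borel" by (rule borel_measurable_continuous_onI[OF Z(1)])
    have "- (\<integral>x. grad g x \<bullet> Z x \<partial>lborel) = (\<integral>x. w x * divergence (conv \<rho> Z) x \<partial>lborel)"
      unfolding g_def by (rule integral_div_conv[OF \<rho> mZ Z' w, symmetric])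
    also have "\<dots> \<le> T"
    proof (rule T)
      show "conv \<rho> Z \<in> test_fields" by (rule conv_test_field[OF \<rho> mZ Z'])
      show "norm x \<le> R + 1" if "conv \<rho> Z x \<noteq> 0" for x
        using conv_supp[OF \<rho> Z'(2) that] e(3) by simp
    qed
    finally have 1: "(\<integral>x. (g x - p x) * divergence z x \<partial>lborel) \<le> T + C * (\<integral>x. p x \<partial>lborel)"
      using Z(4) by (simp add: C_def p_def \<eta>_def)
    \<comment> \<open>The positive part is Lipschitz with constant 1, its smoothing is off by at
      most half of \<open>\<epsilon>\<close>, and the cutoff is at most 1.\<close>
    have pd: "\<bar>p x - \<eta> x * max 0 (w x - t)\<bar> \<le> \<bar>g x - w x\<bar> + \<epsilon> / 2 * \<eta> x" for x
    proof -
      have "\<bar>soft_pos \<epsilon> (g x - t) - max 0 (w x - t)\<bar> \<le> \<bar>g x - w x\<bar> + \<epsilon> / 2"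
        using soft_pos_bounds[OF \<open>\<epsilon> > 0\<close>, of "g x - t"] by (auto simp: max_def abs_if split: if_splits)
      from mult_left_mono[OF this \<eta>(1)[of x]]
      have "\<bar>p x - \<eta> x * max 0 (w x - t)\<bar> \<le> \<eta> x * (\<bar>g x - w x\<bar> + \<epsilon> / 2)"
        using \<eta>(1)[of x] by (simp add: p_def abs_mult flip: right_diff_distrib)
      also have "\<dots> \<le> \<bar>g x - w x\<bar> + \<epsilon> / 2 * \<eta> x"
        using mult_right_mono[OF \<eta>(2)[of x], of "\<bar>g x - w x\<bar>"] by (simp add: algebra_simps)
      finally show ?thesis .
    qed
    have [measurable]: "g \<in> borel_measurable borel" using gi by auto
    have [measurable]: "p \<in> borel_measurable borel" unfolding p_def[abs_def] soft_pos_def[abs_def] by measurable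
    have pdi: "integrable lborel (\<lambda>x. p x - \<eta> x * max 0 (w x - t))"
    proof (rule Bochner_Integration.integrable_bound)
      show "integrable lborel (\<lambda>x. \<bar>g x - w x\<bar> + \<epsilon> / 2 * \<eta> x)" using gi w i\<eta> by simp
      show "AE x in lborel. norm (p x - \<eta> x * max 0 (w x - t)) \<le> norm (\<bar>g x - w x\<bar> + \<epsilon> / 2 * \<eta> x)"
        using pd by (auto intro!: AE_I2 order_trans[OF pd])
    qed measurable
    have pi: "integrable lborel p"
      using Bochner_Integration.integrable_add[OF pdi int_pos] by simp
    have pint: "(\<integral>x. p x \<partial>lborel) \<le> B + \<epsilon> * (1 + H / 2)"
    proof -
      have "(\<integral>x. p x \<partial>lborel) \<le> (\<integral>x. \<eta> x * max 0 (w x - t) + (\<bar>g x - w x\<bar> + \<epsilon> / 2 * \<eta> x) \<partial>lborel)"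
      proof (rule integral_mono)
        show "p x \<le> \<eta> x * max 0 (w x - t) + (\<bar>g x - w x\<bar> + \<epsilon> / 2 * \<eta> x)" for x using pd[of x] by linarith
      qed (use pi int_pos gi w i\<eta> in auto)
      also have "\<dots> = B + ((\<integral>x. \<bar>g x - w x\<bar> \<partial>lborel) + \<epsilon> / 2 * H)"
        using int_pos gi w i\<eta> by (simp add: B_def H_def)
      finally show ?thesis using gw by (simp add: algebra_simps)
    qed
    define q where "q x = (w x - \<eta> x * max 0 (w x - t)) - (g x - p x)" for x
    have qi: "integrable lborel q" unfolding q_def[abs_def] using w int_pos gi pi by simp
    have "A - (\<integral>x. (g x - p x) * divergence z x \<partial>lborel) = (\<integral>x. q x * divergence z x \<partial>lborel)"
      unfolding A_def q_def
      using int_div[OF Bochner_Integration.integrable_diff[OF w int_pos]] int_div[OF Bochner_Integration.integrable_diff[OF gi pi]]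
      by (simp add: left_diff_distrib[of "w _ - _"])
    also have "\<dots> \<le> (\<integral>x. D * (2 * \<bar>g x - w x\<bar> + \<epsilon> / 2 * \<eta> x) \<partial>lborel)"
    proof (rule integral_mono)
      show "q x * divergence z x \<le> D * (2 * \<bar>g x - w x\<bar> + \<epsilon> / 2 * \<eta> x)" for x
      proof -
        have "q x * divergence z x \<le> \<bar>q x\<bar> * \<bar>divergence z x\<bar>" by (metis abs_ge_self abs_mult)
        also have "\<dots> \<le> (2 * \<bar>g x - w x\<bar> + \<epsilon> / 2 * \<eta> x) * D"
        proof (rule mult_mono)
          have "\<bar>(a - b) - (c - d)\<bar> \<le> 2 * \<bar>c - a\<bar> + k" if "\<bar>d - b\<bar> \<le> \<bar>c - a\<bar> + k" for a b c d k :: real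
            using that abs_triangle_ineq[of "a - c" "d - b"] by (simp add: abs_minus_commute algebra_simps)
          from this[OF pd] show "\<bar>q x\<bar> \<le> 2 * \<bar>g x - w x\<bar> + \<epsilon> / 2 * \<eta> x" unfolding q_def .
          then show "0 \<le> 2 * \<bar>g x - w x\<bar> + \<epsilon> / 2 * \<eta> x" by linarith
        qed (use D(2)[of x] in auto)
        finally show ?thesis by (simp add: mult.commute)
      qed
    qed (use int_div[OF qi] gi w i\<eta> in auto)
    also have "\<dots> = D * (2 * (\<integral>x. \<bar>g x - w x\<bar> \<partial>lborel) + \<epsilon> / 2 * H)"
      using gi w i\<eta> by (simp add: H_def)
    also have "\<dots> \<le> D * (2 * \<epsilon> + \<epsilon> / 2 * H)" using D(1) gw by (intro mult_left_mono) auto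
    finally have "A \<le> T + C * (\<integral>x. p x \<partial>lborel) + D * (2 * \<epsilon> + \<epsilon> / 2 * H)" using 1 by linarith
    also have "C * (\<integral>x. p x \<partial>lborel) \<le> C * (B + \<epsilon> * (1 + H / 2))" by (intro mult_left_mono pint C)
    finally show ?thesis by (simp add: K_def algebra_simps)
  qed
  have "A \<le> T + C * B"
  proof (rule field_le_epsilon)
    fix x :: real assume x: "x > 0"
    have pos: "x / (K + 1) > 0" using K x by simp
    have "A \<le> T + C * B + K * (x / (K + 1))" by (rule main[OF pos])
    also have "K * (x / (K + 1)) \<le> (K + 1) * (x / (K + 1))"
      using pos by (intro mult_right_mono) auto
    also have "\<dots> = x" using K by simp
    finally show "A \<le> T + C * B + x" by simp
  qed
  then show ?thesis by (simp add: A_def B_def C_def \<eta>_def)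
qed

section \<open>Elementary properties of the total variation and the truncation of BV
  functions\<close>

lemma zero_in_test_fields: "(\<lambda>x. 0) \<in> test_fields"
  unfolding test_fields_def
  by (auto intro!: smooth_if_family[where S = "{\<lambda>x. 0}"])

lemma TV_nonneg:
  fixes u :: "'a::euclidean_space \<Rightarrow> real"
  shows "TV u \<ge> 0"
proof -
  have "divergence (\<lambda>x::'a. 0) = (\<lambda>x. 0)"
    by (simp add: divergence_def fun_eq_iff)
  then have "ereal (\<integral>x. u x * divergence (\<lambda>x::'a. 0) x \<partial>lebesgue) = 0" by simp
  then show ?thesis
    unfolding TV_def using SUP_upper[OF zero_in_test_fields, of "\<lambda>z. ereal (\<integral>x. u x * divergence z x \<partial>lebesgue)"]
    by (simp add: zero_ereal_def)
qed

lemma BV_TV_real: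
  assumes "u \<in> BV" obtains T where "TV u = ereal T" "T \<ge> 0"
  using assms TV_nonneg[of u] unfolding BV_def by (cases "TV u") auto

lemma divergence_uminus:
  assumes "z differentiable at x"
  shows "divergence (\<lambda>x. - z x) x = - divergence z x"
proof -
  have "((\<lambda>x. - z x) has_derivative (\<lambda>v. - frechet_derivative z (at x) v)) (at x)"
    using assms by (intro has_derivative_minus) (simp add: frechet_derivative_works)
  then show ?thesis
    by (simp add: divergence_def sum_negf flip: frechet_derivative_at)
qed

lemma smooth_uminus:
  assumes "smooth f" shows "smooth (\<lambda>x. - f x)"
proof (rule smooth_if_family[where S = "{\<lambda>x. - f x | f. smooth f}"])
  fix h :: "'a \<Rightarrow> 'b" and i :: 'a assume "h \<in> {\<lambda>x. - f x | f. smooth f}"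
  then obtain f where f: "h = (\<lambda>x. - f x)" "smooth f" by blast
  have d: "(h has_derivative (\<lambda>v. - frechet_derivative f (at x) v)) (at x)" for x
    unfolding f(1) by (rule has_derivative_minus[OF smooth_has_derivative[OF f(2)]])
  show "h differentiable at x" for x using d unfolding differentiable_def by blast
  assume "i \<in> Basis"
  have "(\<lambda>x. frechet_derivative h (at x) i) = (\<lambda>x. - frechet_derivative f (at x) i)"
    by (rule ext) (simp flip: frechet_derivative_at[OF d])
  then show "(\<lambda>x. frechet_derivative h (at x) i) \<in> {\<lambda>x. - f x | f. smooth f}"
    using smooth_partial[OF f(2) \<open>i \<in> Basis\<close>] by (intro CollectI exI conjI)
qed (use assms in blast)

lemma test_fields_uminus: "z \<in> test_fields \<Longrightarrow> (\<lambda>x. - z x) \<in> test_fields"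
  by (simp add: test_fields_def smooth_uminus)

text \<open>Test fields are closed under change of sign. This symmetry later yields lower bounds for
  minimizers from upper ones, and negative levels from positive ones.\<close>

lemma TV_uminus_le: "TV (\<lambda>x. - u x) \<le> TV u"
  unfolding TV_def
proof (rule SUP_least)
  fix z :: "'a \<Rightarrow> 'a" assume z: "z \<in> test_fields"
  then have "divergence (\<lambda>x. - z x) x = - divergence z x" for x
    by (intro divergence_uminus smooth_differentiable) (simp add: test_fields_def)
  then have "(\<integral>x. - u x * divergence z x \<partial>lebesgue) = (\<integral>x. u x * divergence (\<lambda>x. - z x) x \<partial>lebesgue)"
    by simp
  then show "ereal (\<integral>x. - u x * divergence z x \<partial>lebesgue) \<le> (SUP z\<in>test_fields. ereal (\<integral>x. u x * divergence z x \<partial>lebesgue))"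
    using SUP_upper[OF test_fields_uminus[OF z], of "\<lambda>z. ereal (\<integral>x. u x * divergence z x \<partial>lebesgue)"] by simp
qed

lemma TV_uminus: "TV (\<lambda>x. - u x) = TV u"
  using TV_uminus_le[of u] TV_uminus_le[of "\<lambda>x. - u x"] by simp

lemma BV_uminus: "u \<in> BV \<Longrightarrow> (\<lambda>x. - u x) \<in> BV"
  by (simp add: BV_def TV_uminus L1_loc_def set_integrable_def)

lemma borel_measurable_lebesgue_continuous:
  fixes g :: "'a::euclidean_space \<Rightarrow> 'b::topological_space"
  assumes "continuous_on UNIV g" shows "g \<in> borel_measurable lebesgue"
  using borel_measurable_continuous_onI[OF assms] by (auto intro: measurable_completion)

lemma integrable_truncation:
  assumes u: "L1_loc u" and r: "r > 0"
  shows "integrable lebesgue (\<lambda>x. cutoff c r x * max 0 (u x - t))"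
proof (rule Bochner_Integration.integrable_bound)
  have [measurable]: "u \<in> borel_measurable lebesgue" using u by (simp add: L1_loc_def)
  have [measurable]: "cutoff c r \<in> borel_measurable lebesgue"
    by (rule borel_measurable_lebesgue_continuous[OF continuous_cutoff])
  have "set_integrable lebesgue (cball c r) u" "set_integrable lebesgue (cball c r) (\<lambda>x. \<bar>t\<bar>)"
    using u lmeasurable_cball[of c r] by (auto simp: L1_loc_def set_integrable_def fmeasurable_def less_top)
  then show "integrable lebesgue (\<lambda>x. \<bar>indicator (cball c r) x *\<^sub>R u x\<bar> + indicator (cball c r) x *\<^sub>R \<bar>t\<bar>)"
    by (intro Bochner_Integration.integrable_add integrable_abs) (auto simp: set_integrable_def)
  show "AE x in lebesgue. norm (cutoff c r x * max 0 (u x - t))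
      \<le> norm (\<bar>indicator (cball c r) x *\<^sub>R u x\<bar> + indicator (cball c r) x *\<^sub>R \<bar>t\<bar>)"
  proof (rule AE_I2)
    fix x
    show "norm (cutoff c r x * max 0 (u x - t))
      \<le> norm (\<bar>indicator (cball c r) x *\<^sub>R u x\<bar> + indicator (cball c r) x *\<^sub>R \<bar>t\<bar>)"
    proof (cases "x \<in> ball c r")
      case True
      have "cutoff c r x * max 0 (u x - t) \<le> 1 * max 0 (u x - t)"
        by (intro mult_right_mono cutoff_bounds) auto
      also have "\<dots> \<le> \<bar>u x\<bar> + \<bar>t\<bar>" by auto
      finally show ?thesis using True cutoff_bounds(1)[of c r x] by simp
    next
      case False
      then have "cutoff c r x = 0" using cutoff_eq_0_iff[OF r] by blast
      then show ?thesis by simp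
    qed
  qed
  show "(\<lambda>x. cutoff c r x * max 0 (u x - t)) \<in> borel_measurable lebesgue" by measurable
qed

text \<open>The smooth theory wants a Borel function integrable on the whole space, while
  \<open>u\<close> is Lebesgue measurable and only locally integrable. For each test field,
  \<open>u\<close> is therefore restricted to a large ball and replaced by a Borel representative
  \<open>w\<close>; none of the integrals involved notices the change.\<close>

lemma TV_truncation_le:
  fixes u :: "'a::euclidean_space \<Rightarrow> real"
  assumes u: "u \<in> BV" and r: "r > 0"
  shows "TV (\<lambda>x. u x - cutoff c r x * max 0 (u x - t)) \<le>
    TV u + ereal ((real DIM('a) + 4) / r * (\<integral>x. cutoff c r x * max 0 (u x - t) \<partial>lebesgue))"
proof -
  have loc: "L1_loc u" using u by (simp add: BV_def)
  have [measurable]: "u \<in> borel_measurable lebesgue" using loc by (simp add: L1_loc_def)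
  have [measurable]: "cutoff c r \<in> borel_measurable borel" "cutoff c r \<in> borel_measurable lebesgue"
    by (rule borel_measurable_lebesgue_continuous borel_measurable_continuous_onI, rule continuous_cutoff)+
  obtain T where T: "TV u = ereal T" using BV_TV_real[OF u] by metis
  have "ereal (\<integral>x. (u x - cutoff c r x * max 0 (u x - t)) * divergence z x \<partial>lebesgue) \<le>
    ereal (T + (real DIM('a) + 4) / r * (\<integral>x. cutoff c r x * max 0 (u x - t) \<partial>lebesgue))"
    if z: "z \<in> test_fields" for z
  proof -
    obtain R0 where R0: "\<And>x. z x \<noteq> 0 \<Longrightarrow> norm x \<le> R0"
      using z by (auto simp: test_fields_def bounded_iff)
    define R where "R = max R0 (norm c + r)"
    have zR: "norm x \<le> R" if "z x \<noteq> 0" for x using R0[OF that] by (simp add: R_def)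
    have cR: "cball c r \<subseteq> cball 0 R"
    proof
      fix x assume "x \<in> cball c r"
      then show "x \<in> cball 0 R"
        using norm_triangle_ineq2[of x c] by (simp add: R_def dist_norm norm_minus_commute)
    qed
    \<comment> \<open>The ball contains the support of \<open>z\<close>, the cutoff ball, and a
      margin of 1 for the mollified fields.\<close>
    define K where "K = cball (0::'a) (R + 1)"
    have uK: "integrable lebesgue (\<lambda>x. indicator K x * u x)"
      using loc by (simp add: L1_loc_def set_integrable_def K_def)
    obtain w where w[measurable]: "w \<in> borel_measurable lborel" and wAE: "AE x in lborel. indicator K x * u x = w x"
      using completion_ex_borel_measurable_real[OF borel_measurable_integrable[OF uK]] by blast
    have wAE': "AE x in lebesgue. indicator K x * u x = w x" by (rule AE_completion[OF wAE])
    have wl[measurable]: "w \<in> borel_measurable lebesgue" by (rule measurable_completion[OF w])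
    have "integrable lebesgue w"
      using uK integrable_cong_AE[OF _ _ wAE'] by simp
    then have wi: "integrable lborel w" using integrable_completion[OF w] by simp
    have dm: "divergence z' \<in> borel_measurable borel" "divergence z' \<in> borel_measurable lebesgue" if "z' \<in> test_fields" for z' :: "'a \<Rightarrow> 'a"
      using that continuous_divergence[of z' UNIV]
      by (auto simp: test_fields_def intro: borel_measurable_lebesgue_continuous borel_measurable_continuous_onI)
    have "(\<integral>x. (w x - cutoff c r x * max 0 (w x - t)) * divergence z x \<partial>lborel) \<le>
      T + (real DIM('a) + 4) / r * (\<integral>x. cutoff c r x * max 0 (w x - t) \<partial>lborel)"
    proof (rule truncation_integral_bound[OF wi _ z zR r cR])
      fix z' :: "'a \<Rightarrow> 'a" assume z': "z' \<in> test_fields" and s: "\<And>x. z' x \<noteq> 0 \<Longrightarrow> norm x \<le> R + 1"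
      note [measurable] = dm[OF z']
      have "(\<integral>x. w x * divergence z' x \<partial>lborel) = (\<integral>x. w x * divergence z' x \<partial>lebesgue)"
        by (rule integral_completion[symmetric]) measurable
      also have "\<dots> = (\<integral>x. u x * divergence z' x \<partial>lebesgue)"
      proof (rule integral_cong_AE)
        show "AE x in lebesgue. w x * divergence z' x = u x * divergence z' x"
          using wAE'
        proof eventually_elim
          case (elim x)
          show ?case
          proof (cases "divergence z' x = 0")
            case False
            then have "x \<in> K" using divergence_supp[OF s False] by (simp add: K_def)
            then show ?thesis using elim by simp
          qed simp
        qed
      qed measurable
      also have "ereal \<dots> \<le> TV u" unfolding TV_def by (rule SUP_upper[OF z'])
      finally show "(\<integral>x. w x * divergence z' x \<partial>lborel) \<le> T" by (simp add: T)
    qed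
    moreover have "(\<integral>x. cutoff c r x * max 0 (w x - t) \<partial>lborel) = (\<integral>x. cutoff c r x * max 0 (u x - t) \<partial>lebesgue)"
    proof -
      have "(\<integral>x. cutoff c r x * max 0 (w x - t) \<partial>lborel) = (\<integral>x. cutoff c r x * max 0 (w x - t) \<partial>lebesgue)"
        by (rule integral_completion[symmetric]) measurable
      also have "\<dots> = (\<integral>x. cutoff c r x * max 0 (u x - t) \<partial>lebesgue)"
      proof (rule integral_cong_AE)
        show "AE x in lebesgue. cutoff c r x * max 0 (w x - t) = cutoff c r x * max 0 (u x - t)"
          using wAE'
        proof eventually_elim
          case (elim x)
          show ?case
          proof (cases "cutoff c r x = 0")
            case False
            then have "x \<in> cball c r" using cutoff_eq_0_iff[OF r, of c x] ball_subset_cball by blast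
            then have "x \<in> cball 0 R" using cR by blast
            then have "x \<in> K" by (simp add: K_def)
            then show ?thesis using elim by simp
          qed simp
        qed
      qed measurable
      finally show ?thesis .
    qed
    moreover have "(\<integral>x. (w x - cutoff c r x * max 0 (w x - t)) * divergence z x \<partial>lborel)
       = (\<integral>x. (u x - cutoff c r x * max 0 (u x - t)) * divergence z x \<partial>lebesgue)"
    proof -
      note [measurable] = dm[OF z]
      have "(\<integral>x. (w x - cutoff c r x * max 0 (w x - t)) * divergence z x \<partial>lborel) =
          (\<integral>x. (w x - cutoff c r x * max 0 (w x - t)) * divergence z x \<partial>lebesgue)"
        by (rule integral_completion[symmetric]) measurable
      also have "\<dots> = (\<integral>x. (u x - cutoff c r x * max 0 (u x - t)) * divergence z x \<partial>lebesgue)"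
      proof (rule integral_cong_AE)
        show "AE x in lebesgue. (w x - cutoff c r x * max 0 (w x - t)) * divergence z x
            = (u x - cutoff c r x * max 0 (u x - t)) * divergence z x"
          using wAE'
        proof eventually_elim
          case (elim x)
          show ?case
          proof (cases "divergence z x = 0")
            case False
            then have "x \<in> K" using divergence_supp[OF zR False] by (simp add: K_def)
            then show ?thesis using elim by simp
          qed simp
        qed
      qed measurable
      finally show ?thesis .
    qed
    ultimately show ?thesis by simp
  qed
  then show ?thesis
    unfolding T TV_def[of "\<lambda>x. u x - _ x"] by (intro SUP_least) simp
qed

lemma truncation_BV:
  fixes u :: "'a::euclidean_space \<Rightarrow> real"
  assumes u: "u \<in> BV" and r: "r > 0"
  shows "(\<lambda>x. u x - cutoff c r x * max 0 (u x - t)) \<in> BV"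
proof -
  have loc: "L1_loc u" using u by (simp add: BV_def)
  obtain T where T: "TV u = ereal T" using BV_TV_real[OF u] by metis
  have i: "integrable lebesgue (\<lambda>x. cutoff c r x * max 0 (u x - t))" by (rule integrable_truncation[OF loc r])
  have "L1_loc (\<lambda>x. u x - cutoff c r x * max 0 (u x - t))"
    unfolding L1_loc_def
  proof (intro conjI allI impI)
    show "(\<lambda>x. u x - cutoff c r x * max 0 (u x - t)) \<in> borel_measurable lebesgue"
      using loc borel_measurable_integrable[OF i] by (auto simp: L1_loc_def)
    fix K :: "'a set" assume K: "compact K"
    then have "set_integrable lebesgue K u" using loc by (simp add: L1_loc_def)
    moreover have "set_integrable lebesgue K (\<lambda>x. cutoff c r x * max 0 (u x - t))"
      unfolding set_integrable_def
      by (rule integrable_mult_indicator[OF _ i]) (use K in \<open>simp add: borel_compact\<close>)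
    ultimately show "set_integrable lebesgue K (\<lambda>x. u x - cutoff c r x * max 0 (u x - t))"
      by (rule set_integral_diff)
  qed
  then show ?thesis
    using TV_truncation_le[OF u r, of c t] unfolding BV_def T by (auto intro: order_le_less_trans)
qed

section \<open>The comparison principle for minimizers\<close>

lemma strictly_convex_convex: "strictly_convex \<psi> \<Longrightarrow> convex_on UNIV \<psi>"
proof (rule convex_onI)
  fix t x y :: real assume s: "strictly_convex \<psi>" and t: "0 < t" "t < 1"
  show "\<psi> ((1 - t) *\<^sub>R x + t *\<^sub>R y) \<le> (1 - t) * \<psi> x + t * \<psi> y"
  proof (cases "x = y")
    case True then show ?thesis by (simp add: algebra_simps)
  next
    case False
    with s t have "\<psi> (t * y + (1 - t) * x) < t * \<psi> y + (1 - t) * \<psi> x"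
      unfolding strictly_convex_def by metis
    then show ?thesis by (simp add: algebra_simps)
  qed
qed simp

lemma convex_scale_le:
  fixes \<psi> :: "real \<Rightarrow> real"
  assumes "convex_on UNIV \<psi>" "\<psi> 0 = 0" "0 < a" "a \<le> b"
  shows "b * \<psi> a \<le> a * \<psi> b"
proof -
  have "\<psi> ((1 - a / b) *\<^sub>R 0 + (a / b) *\<^sub>R b) \<le> (1 - a / b) * \<psi> 0 + (a / b) * \<psi> b"
    using assms by (intro convex_onD[OF assms(1)]) auto
  then show ?thesis using assms by (simp add: field_simps)
qed

text \<open>Chord slopes through the origin increase, so the average slope between \<open>a\<close>
  and \<open>b\<close> is at least \<open>\<psi> a / a\<close>, hence at least
  \<open>\<psi> \<nu> / \<nu>\<close>. Increments take the place of a derivative of \<psi>.\<close>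

lemma convex_increment_ge:
  fixes \<psi> :: "real \<Rightarrow> real"
  assumes \<psi>: "convex_on UNIV \<psi>" "\<psi> 0 = 0" and "0 < \<nu>" "\<nu> \<le> a" "a \<le> b"
  shows "\<psi> a + \<psi> \<nu> / \<nu> * (b - a) \<le> \<psi> b"
proof -
  have a: "a > 0" using assms by linarith
  have 1: "\<psi> \<nu> / \<nu> \<le> \<psi> a / a"
    using convex_scale_le[OF \<psi> \<open>0 < \<nu>\<close> \<open>\<nu> \<le> a\<close>] \<open>0 < \<nu>\<close> a by (simp add: field_simps)
  have "\<psi> a + \<psi> \<nu> / \<nu> * (b - a) \<le> \<psi> a + \<psi> a / a * (b - a)"
    using mult_right_mono[OF 1, of "b - a"] assms by simp
  also have "\<dots> = b * \<psi> a / a" using a by (simp add: field_simps)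
  also have "\<dots> \<le> \<psi> b"
    using convex_scale_le[OF \<psi> a \<open>a \<le> b\<close>] a by (simp add: field_simps)
  finally show ?thesis .
qed

text \<open>The origin is the midpoint of \<open>x\<close> and \<open>- x\<close>, where \<psi>
  takes equal values.\<close>

lemma even_strictly_convex_pos:
  assumes "strictly_convex \<psi>" "\<And>s. \<psi> (- s) = \<psi> s" "\<psi> 0 = 0" "x \<noteq> 0"
  shows "\<psi> x > 0"
proof -
  have "\<psi> (1/2 * x + (1 - 1/2) * (- x)) < 1/2 * \<psi> x + (1 - 1/2) * \<psi> (- x)"
    using assms(4) by (intro assms(1)[unfolded strictly_convex_def, rule_format]) auto
  then show ?thesis using assms(2,3) by simp
qed

lemma energy_uminus:
  assumes "\<And>s. \<psi> (- s) = \<psi> s"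
  shows "energy \<psi> (\<lambda>x. - f x) \<alpha> (\<lambda>x. - u x) = energy \<psi> f \<alpha> u"
proof -
  have "\<psi> (- u x - - f x) = \<psi> (u x - f x)" for x
    using assms[of "u x - f x"] by simp
  then show ?thesis by (simp add: energy_def TV_uminus)
qed

lemma minimizer_le_on_ball:
  fixes u f :: "'a::euclidean_space \<Rightarrow> real"
  assumes \<psi>: "strictly_convex \<psi>" "\<And>s. \<psi> (- s) = \<psi> s" "\<psi> 0 = 0"
    and f: "f \<in> BV" and u: "u \<in> BV" "\<And>v. v \<in> BV \<Longrightarrow> energy \<psi> f \<alpha> u \<le> energy \<psi> f \<alpha> v"
    and r: "r > 0" and "\<nu> > 0" and \<alpha>: "\<alpha> > 0" "\<alpha> * ((real DIM('a) + 4) / r) < \<psi> \<nu> / \<nu>"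
    and fle: "AE x in lebesgue. x \<in> ball c r \<longrightarrow> f x \<le> t - \<nu>"
  shows "AE x in lebesgue. x \<in> ball c r \<longrightarrow> u x \<le> t"
proof -
  define C where "C = (real DIM('a) + 4) / r"
  define k where "k = \<psi> \<nu> / \<nu>"
  have k: "k > 0" using even_strictly_convex_pos[OF \<psi>, of \<nu>] \<open>\<nu> > 0\<close> by (simp add: k_def)
  have conv: "convex_on UNIV \<psi>" by (rule strictly_convex_convex[OF \<psi>(1)])
  have nonneg: "\<psi> x \<ge> 0" for x
    using even_strictly_convex_pos[OF \<psi>, of x] \<psi>(3) by (cases "x = 0") auto
  have [measurable]: "\<psi> \<in> borel_measurable borel"
    using convex_on_continuous[OF open_UNIV conv] by (rule borel_measurable_continuous_onI)
  define p where "p x = cutoff c r x * max 0 (u x - t)" for x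
  define v where "v x = u x - p x" for x
  have loc: "L1_loc u" "L1_loc f" using u f by (auto simp: BV_def)
  have [measurable]: "u \<in> borel_measurable lebesgue" "f \<in> borel_measurable lebesgue"
    using loc by (auto simp: L1_loc_def)
  have pint: "integrable lebesgue p" unfolding p_def by (rule integrable_truncation[OF loc(1) r])
  have [measurable]: "p \<in> borel_measurable lebesgue" using pint by auto
  have [measurable]: "v \<in> borel_measurable lebesgue" unfolding v_def by measurable
  have p0: "p x \<ge> 0" for x unfolding p_def using cutoff_bounds(1)[of c r x] by simp
  define q where "q = integral\<^sup>L lebesgue p"
  have q: "q \<ge> 0" unfolding q_def using p0 by simp
  have v: "v \<in> BV" unfolding v_def p_def by (rule truncation_BV[OF u(1) r])
  have TVv: "TV v \<le> TV u + ereal (C * q)"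
    unfolding v_def p_def C_def q_def by (rule TV_truncation_le[OF u(1) r])
  obtain Tu where Tu: "TV u = ereal Tu" "Tu \<ge> 0" using BV_TV_real[OF u(1)] by metis
  obtain Tv where Tv: "TV v = ereal Tv" "Tv \<ge> 0" using BV_TV_real[OF v] by metis
  obtain Tf where Tf: "TV f = ereal Tf" "Tf \<ge> 0" using BV_TV_real[OF f] by metis
  define Iu where "Iu = (\<integral>\<^sup>+x. ennreal (\<psi> (u x - f x)) \<partial>lebesgue)"
  define Iv where "Iv = (\<integral>\<^sup>+x. ennreal (\<psi> (v x - f x)) \<partial>lebesgue)"
  \<comment> \<open>Where \<open>p x\<close> is nonzero, \<open>x\<close> lies in the ball, and
    \<open>v x\<close> is at least \<open>t\<close> because the cutoff is at most 1. Both arguments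
    of \<psi> are then at least \<nu>, as the increment bound demands. The gain stands on the left,
    so nothing possibly infinite is subtracted.\<close>
  have "AE x in lebesgue. ennreal (\<psi> (v x - f x)) + ennreal (k * p x) \<le> ennreal (\<psi> (u x - f x))"
    using fle
  proof eventually_elim
    case (elim x)
    show ?case
    proof (cases "p x = 0")
      case True then show ?thesis by (simp add: v_def)
    next
      case False
      then have "cutoff c r x \<noteq> 0" "u x > t" by (auto simp: p_def max_def split: if_splits)
      then have "x \<in> ball c r" using cutoff_eq_0_iff[OF r] by blast
      then have "f x \<le> t - \<nu>" using elim by blast
      have "p x \<le> 1 * max 0 (u x - t)"
        unfolding p_def by (intro mult_right_mono cutoff_bounds) auto
      then have "v x \<ge> t" using \<open>u x > t\<close> by (simp add: v_def)
      then have "\<psi> (v x - f x) + k * ((u x - f x) - (v x - f x)) \<le> \<psi> (u x - f x)"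
        unfolding k_def using \<open>f x \<le> t - \<nu>\<close> p0[of x] \<open>\<nu> > 0\<close>
        by (intro convex_increment_ge[OF conv \<psi>(3)]) (auto simp: v_def)
      then have "\<psi> (v x - f x) + k * p x \<le> \<psi> (u x - f x)" by (simp add: v_def)
      then show ?thesis using nonneg k p0[of x] by (simp flip: ennreal_plus add: ennreal_leI)
    qed
  qed
  then have "(\<integral>\<^sup>+x. ennreal (\<psi> (v x - f x)) + ennreal (k * p x) \<partial>lebesgue) \<le> Iu"
    unfolding Iu_def by (rule nn_integral_mono_AE)
  moreover have "(\<integral>\<^sup>+x. ennreal (\<psi> (v x - f x)) + ennreal (k * p x) \<partial>lebesgue) = Iv + ennreal (k * q)"
    unfolding Iv_def q_def using pint p0 k
    by (subst nn_integral_add) (auto simp: nn_integral_eq_integral)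
  ultimately have I: "Iv + ennreal (k * q) \<le> Iu" by simp
  \<comment> \<open>The datum \<open>f\<close> as competitor has zero fidelity, so the fidelity of
    \<open>u\<close> is finite and the comparison can continue in the reals.\<close>
  have "energy \<psi> f \<alpha> u \<le> ereal (\<alpha> * Tf)"
    using u(2)[OF f] \<psi>(3) by (simp add: energy_def Tf zero_ennreal.rep_eq)
  then have "enn2ereal Iu + ereal (\<alpha> * Tu) \<le> ereal (\<alpha> * Tf)"
    by (simp add: energy_def Iu_def Tu)
  then have "Iu \<noteq> \<infinity>" by auto
  then obtain iu where iu: "Iu = ennreal iu" "iu \<ge> 0" by (cases Iu) auto
  have "Iv \<le> Iv + ennreal (k * q)" by simp
  also note I
  finally have "Iv \<le> Iu" .
  then have "Iv \<noteq> \<infinity>" using \<open>Iu \<noteq> \<infinity>\<close> by (auto simp: top_unique)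
  then obtain iv where iv: "Iv = ennreal iv" "iv \<ge> 0" by (cases Iv) auto
  have "iv + k * q \<le> iu"
    using I iu iv k q by (simp flip: ennreal_plus)
  moreover have "iu + \<alpha> * Tu \<le> iv + \<alpha> * Tv"
    using u(2)[OF v] iu iv by (simp add: energy_def Tu Tv flip: Iu_def Iv_def)
  moreover have "\<alpha> * Tv \<le> \<alpha> * (Tu + C * q)"
    using TVv \<alpha>(1) by (intro mult_left_mono) (simp_all add: Tu Tv)
  \<comment> \<open>Minimality: the fidelity saved, at least \<open>k * q\<close>, cannot exceed the
    variation paid, at most \<open>\<alpha> * C * q\<close>. Since \<open>\<alpha> * C < k\<close>,
    the truncation removed nothing.\<close>
  ultimately have "k * q \<le> (\<alpha> * C) * q" by (simp add: algebra_simps)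
  moreover have "\<alpha> * C < k" using \<alpha>(2) by (simp add: C_def k_def)
  ultimately have "q = 0"
    using q mult_strict_right_mono[of "\<alpha> * C" k q] by (cases "q = 0") auto
  then have "AE x in lebesgue. p x = 0"
    using integral_nonneg_eq_0_iff_AE[OF pint] p0 by (simp add: q_def)
  then show ?thesis
  proof eventually_elim
    case (elim x)
    show ?case
    proof
      assume "x \<in> ball c r"
      then have "cutoff c r x \<noteq> 0" using cutoff_eq_0_iff[OF r] by blast
      then show "u x \<le> t" using elim by (auto simp: p_def max_def split: if_splits)
    qed
  qed
qed

section \<open>The measure-theoretic boundary and the canonical representative\<close>

lemma negligible_locally:
  assumes "\<And>x. x \<in> A \<Longrightarrow> \<exists>r>0. negligible (A \<inter> ball x r)"
  shows "negligible A"
  unfolding locally_negligible_alt[of A]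
proof
  fix x assume "x \<in> A"
  then obtain r where "r > 0" "negligible (A \<inter> ball x r)" using assms by blast
  then show "\<exists>U. openin (top_of_set A) U \<and> x \<in> U \<and> negligible U"
    using \<open>x \<in> A\<close> by (intro exI[of _ "A \<inter> ball x r"]) auto
qed

lemma emeasure_eq_0_iff_negligible:
  "A \<in> sets lebesgue \<Longrightarrow> emeasure lebesgue A = 0 \<longleftrightarrow> negligible A"
  by (auto simp: negligible_iff_null_sets null_sets_def)

lemma not_negligible_ball: "r > 0 \<Longrightarrow> \<not> negligible (ball x r)"
  using open_not_negligible[of "ball x r"] by auto

text \<open>The volume of a ball is finite and positive and splits between the set and its
  complement. So a density strictly between 0 and 1 only says that neither part is null, and all
  later arguments use this form.\<close>

lemma mboundary_iff:
  fixes E :: "'a::euclidean_space set"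
  assumes E: "E \<in> sets lebesgue"
  shows "x \<in> mboundary E \<longleftrightarrow> (\<forall>r>0. \<not> negligible (E \<inter> ball x r) \<and> \<not> negligible (ball x r - E))"
proof -
  have "(0 < measure lebesgue (E \<inter> ball x r) / measure lebesgue (ball x r)
      \<and> measure lebesgue (E \<inter> ball x r) / measure lebesgue (ball x r) < 1) \<longleftrightarrow>
    \<not> negligible (E \<inter> ball x r) \<and> \<not> negligible (ball x r - E)" if "r > 0" for r
  proof -
    have B: "ball x r \<in> lmeasurable" by (rule lmeasurable_ball)
    have m: "E \<inter> ball x r \<in> lmeasurable" "ball x r - E \<in> lmeasurable"
      using fmeasurable_Int_fmeasurable[OF B E] fmeasurable_Diff[OF B E] by (simp_all add: Int_commute)
    have "measure lebesgue ((E \<inter> ball x r) \<union> (ball x r - E)) = measure lebesgue (E \<inter> ball x r) + measure lebesgue (ball x r - E)"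
    proof -
      have "E \<inter> ball x r \<inter> (ball x r - E) = {}" by blast
      then show ?thesis by (simp add: measure_Un3[OF m])
    qed
    moreover have "(E \<inter> ball x r) \<union> (ball x r - E) = ball x r" by blast
    ultimately have sum: "measure lebesgue (ball x r) = measure lebesgue (E \<inter> ball x r) + measure lebesgue (ball x r - E)" by simp
    have neg: "negligible S \<longleftrightarrow> measure lebesgue S = 0" if "S \<in> lmeasurable" for S :: "'a set"
      using that negligible_iff_measure by blast
    have "measure lebesgue (ball x r) \<noteq> 0"
      using neg[OF B] not_negligible_ball[OF \<open>r > 0\<close>] by blast
    then have "measure lebesgue (ball x r) > 0" by (simp add: zero_less_measure_iff)
    then show ?thesis
      using sum neg[OF m(1)] neg[OF m(2)] measure_nonneg[of lebesgue "E \<inter> ball x r"] measure_nonneg[of lebesgue "ball x r - E"]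
      by (auto simp: zero_less_measure_iff)
  qed
  then show ?thesis unfolding mboundary_def by blast
qed

lemma open_locally_null: "open {y. \<exists>r>0. negligible (S \<inter> ball y r)}"
  unfolding open_dist
proof (clarify)
  fix y r assume r: "r > (0::real)" "negligible (S \<inter> ball y r)"
  have "\<exists>r>0. negligible (S \<inter> ball z r)" if "dist z y < r / 2" for z
  proof (intro exI conjI)
    have "ball z (r / 2) \<subseteq> ball y r"
    proof
      fix w assume "w \<in> ball z (r / 2)"
      then show "w \<in> ball y r" using that dist_triangle[of y w z] by (simp add: dist_commute)
    qed
    then show "negligible (S \<inter> ball z (r / 2))" by (intro negligible_subset[OF r(2)]) blast
  qed (use r in simp)
  then show "\<exists>e>0. \<forall>y'. dist y' y < e \<longrightarrow> y' \<in> {y. \<exists>r>0. negligible (S \<inter> ball y r)}"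
    using r(1) by (intro exI[of _ "r / 2"]) auto
qed

text \<open>The points near which the set is null and those near which its complement is null form
  two disjoint open sets within the ball. Off the boundary they cover it, and a ball is
  connected.\<close>

lemma null_or_full_if_disjoint_mboundary:
  assumes E: "E \<in> sets lebesgue" and "ball x e \<inter> mboundary E = {}"
  shows "negligible (E \<inter> ball x e) \<or> negligible (ball x e - E)"
proof -
  define A where "A = {y. \<exists>r>0. negligible (E \<inter> ball y r)}"
  define B where "B = {y. \<exists>r>0. negligible (- E \<inter> ball y r)}"
  have o: "open A" "open B" unfolding A_def B_def by (rule open_locally_null)+
  have "ball x e \<subseteq> A \<union> B"
  proof
    fix y assume "y \<in> ball x e"
    then have "y \<notin> mboundary E" using assms(2) by blast
    moreover have "ball y r - E = - E \<inter> ball y r" for r by blast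
    ultimately show "y \<in> A \<union> B" unfolding mboundary_iff[OF E] A_def B_def by auto
  qed
  moreover have "A \<inter> B \<inter> ball x e = {}"
  proof -
    have False if y: "y \<in> A" "y \<in> B" for y
    proof -
      obtain r s where rs: "r > 0" "s > 0" "negligible (E \<inter> ball y r)" "negligible (- E \<inter> ball y s)"
        using y by (auto simp: A_def B_def)
      have "negligible (ball y (min r s))"
        by (rule negligible_subset[OF negligible_Un[OF rs(3,4)]]) auto
      then show False using not_negligible_ball[of "min r s" y] rs by simp
    qed
    then show ?thesis by blast
  qed
  ultimately have "A \<inter> ball x e = {} \<or> B \<inter> ball x e = {}"
    by (intro connectedD[OF connected_ball o]) auto
  then show ?thesis
  proof
    assume "A \<inter> ball x e = {}"
    then have "ball x e \<subseteq> B" using \<open>ball x e \<subseteq> A \<union> B\<close> by blast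
    have "negligible (ball x e - E)"
    proof (rule negligible_locally)
      fix y assume "y \<in> ball x e - E"
      then have "y \<in> B" using \<open>ball x e \<subseteq> B\<close> by blast
      then show "\<exists>r>0. negligible ((ball x e - E) \<inter> ball y r)"
        unfolding B_def by (blast intro: negligible_subset)
    qed
    then show ?thesis ..
  next
    assume "B \<inter> ball x e = {}"
    then have "ball x e \<subseteq> A" using \<open>ball x e \<subseteq> A \<union> B\<close> by blast
    have "negligible (E \<inter> ball x e)"
    proof (rule negligible_locally)
      fix y assume "y \<in> E \<inter> ball x e"
      then have "y \<in> A" using \<open>ball x e \<subseteq> A\<close> by blast
      then show "\<exists>r>0. negligible ((E \<inter> ball x e) \<inter> ball y r)"
        unfolding A_def by (blast intro: negligible_subset)
    qed
    then show ?thesis ..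
  qed
qed

lemma canon_iff:
  assumes "E \<in> sets lebesgue"
  shows "x \<in> canon E \<longleftrightarrow> (\<exists>r>0. negligible (ball x r - E)) \<or> x \<in> E \<and> x \<in> mboundary E"
proof -
  have "ball x r - E \<in> sets lebesgue" for r using assms by auto
  then have "emeasure lebesgue (ball x r - E) = 0 \<longleftrightarrow> negligible (ball x r - E)" for r
    by (rule emeasure_eq_0_iff_negligible)
  then show ?thesis unfolding canon_def by blast
qed

text \<open>A point of \<open>E\<close> missed by \<open>canon E\<close> is not a boundary point and
  has no full ball, so \<open>E\<close> is null near it. Together with the next three lemmas this
  translates between null sets and the actual points that the Hausdorff distance sees.\<close>

lemma negligible_if_disjoint_canon:
  assumes E: "E \<in> sets lebesgue" and "canon E \<inter> U = {}"
  shows "negligible (E \<inter> U)"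
proof (rule negligible_locally)
  fix y assume "y \<in> E \<inter> U"
  then have y: "y \<notin> canon E" "y \<in> E" using assms(2) by auto
  then have "\<exists>r>0. negligible (E \<inter> ball y r)"
    unfolding canon_iff[OF E] mboundary_iff[OF E] by blast
  then show "\<exists>r>0. negligible (E \<inter> U \<inter> ball y r)"
    by (blast intro: negligible_subset)
qed

lemma negligible_if_subset_canon:
  assumes E: "E \<in> sets lebesgue" and "U \<subseteq> canon E"
  shows "negligible (U - E)"
proof (rule negligible_locally)
  fix y assume y: "y \<in> U - E"
  then have "\<exists>r>0. negligible (ball y r - E)"
    using assms(2) canon_iff[OF E] by blast
  then show "\<exists>r>0. negligible ((U - E) \<inter> ball y r)"
    by (blast intro: negligible_subset)
qed

text \<open>Every ball around a point of the representative meets \<open>E\<close> in positive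
  measure, both in the full case and in the boundary case.\<close>

lemma null_ball_disjoint_canon:
  assumes E: "E \<in> sets lebesgue" and n: "negligible (E \<inter> ball x e)"
  shows "canon E \<inter> ball x e = {}"
proof -
  have False if y: "y \<in> canon E" "y \<in> ball x e" for y
  proof -
    obtain d where d: "d > 0" "ball y d \<subseteq> ball x e"
      by (rule openE[OF open_ball y(2)])
    have nd: "negligible (E \<inter> ball y d)" by (rule negligible_subset[OF n]) (use d in blast)
    then obtain r where r: "r > 0" "negligible (ball y r - E)"
      using y(1) d(1) unfolding canon_iff[OF E] mboundary_iff[OF E] by blast
    have "negligible (ball y (min d r))"
      by (rule negligible_subset[OF negligible_Un[OF nd r(2)]]) auto
    then show False using not_negligible_ball[of "min d r" y] d r by simp
  qed
  then show ?thesis by blast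
qed

lemma full_ball_subset_canon:
  assumes E: "E \<in> sets lebesgue" and n: "negligible (ball x e - E)"
  shows "ball x e \<subseteq> canon E"
proof
  fix y assume y: "y \<in> ball x e"
  obtain d where d: "d > 0" "ball y d \<subseteq> ball x e"
    by (rule openE[OF open_ball y])
  have "negligible (ball y d - E)" by (rule negligible_subset[OF n]) (use d in blast)
  then show "y \<in> canon E" using d(1) unfolding canon_iff[OF E] by blast
qed

lemma closed_mboundary:
  assumes E: "E \<in> sets lebesgue"
  shows "closed (mboundary E)"
proof -
  have "- mboundary E = {y. \<exists>r>0. negligible (E \<inter> ball y r)} \<union> {y. \<exists>r>0. negligible (- E \<inter> ball y r)}"
  proof -
    have "ball y r - E = - E \<inter> ball y r" for y r by blast
    then show ?thesis by (auto simp: mboundary_iff[OF E])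
  qed
  then have "open (- mboundary E)"
    using open_Un[OF open_locally_null[of E] open_locally_null[of "- E"]] by simp
  then show ?thesis by (simp add: closed_def)
qed

lemma mboundary_subset_closure:
  assumes E: "E \<in> sets lebesgue"
  shows "mboundary E \<subseteq> closure E"
proof
  fix x assume x: "x \<in> mboundary E"
  have "\<exists>y\<in>E. dist y x < e" if "e > 0" for e
  proof -
    have "E \<inter> ball x e \<noteq> {}" using x that unfolding mboundary_iff[OF E] by (metis negligible_empty)
    then show ?thesis by (auto simp: dist_commute)
  qed
  then show "x \<in> closure E" by (simp add: closure_approachable)
qed

section \<open>Convergence of the boundaries\<close>

text \<open>A supremum over the empty set is minus infinity in \<open>ereal\<close>, but outside the
  case treated separately at least one of the two runs over a nonempty set.\<close>

lemma hausdist_nonneg: "hausdist A B \<ge> 0"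
proof -
  have i: "infdist_e x S \<ge> 0" for x :: 'a and S
    unfolding infdist_e_def by (rule INF_greatest) simp
  have "0 \<le> (SUP x\<in>S. infdist_e x S')" if "S \<noteq> {}" for S S' :: "'a set"
    using that i by (metis SUP_upper2 all_not_in_conv)
  then show ?thesis
    unfolding hausdist_def by (auto simp: le_max_iff_disj)
qed

text \<open>No assumption that \<open>A\<close> be nonempty is made: for empty \<open>A\<close> the
  infimum would be infinite, which the finite bound excludes.\<close>

lemma hausdist_lessD:
  assumes "hausdist A B < ereal e" "y \<in> B"
  obtains x where "x \<in> A" "dist y x < e"
proof -
  have "infdist_e y A \<le> (SUP y\<in>B. infdist_e y A)" using assms(2) by (rule SUP_upper)
  also have "\<dots> \<le> hausdist A B" using assms(2) by (auto simp: hausdist_def)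
  finally have "infdist_e y A < ereal e" using assms(1) by simp
  then obtain x where "x \<in> A" "dist y x < e"
    unfolding infdist_e_def INF_less_iff by auto
  then show ?thesis using that by blast
qed

lemma hausdist_leI:
  assumes "e \<ge> 0" "\<And>x. x \<in> A \<Longrightarrow> \<exists>y\<in>B. dist x y \<le> e" "\<And>y. y \<in> B \<Longrightarrow> \<exists>x\<in>A. dist y x \<le> e"
  shows "hausdist A B \<le> ereal e"
proof -
  have i: "infdist_e x S \<le> ereal e" if "\<exists>y\<in>S. dist x y \<le> e" for x :: 'a and S
    using that unfolding infdist_e_def by (auto intro: INF_lower2)
  show ?thesis
    unfolding hausdist_def using assms i by (auto intro!: SUP_least)
qed

text \<open>The statement concerns superlevel sets only; sublevel sets reduce to it by negating
  \<open>f\<close> and \<open>u\<close>. Of the Hausdorff continuity it keeps two one-sided facts: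
  \<open>outer\<close> puts \<open>f\<close> below a smaller level away from the set, and
  \<open>inner\<close> puts \<open>f\<close> above a larger level well inside it. Boundedness of the
  set replaces a condition on the sign of \<open>s\<close>.\<close>

lemma boundary_convergence:
  fixes \<psi> :: "real \<Rightarrow> real" and f :: "'a::euclidean_space \<Rightarrow> real" and u :: "real \<Rightarrow> 'a \<Rightarrow> real"
  assumes \<psi>: "strictly_convex \<psi>" "\<And>s. \<psi> (- s) = \<psi> s" "\<psi> 0 = 0"
    and f: "f \<in> BV" and bdd: "bounded {x. f x > s}"
    and u: "\<And>\<alpha>. \<alpha> > 0 \<Longrightarrow> u \<alpha> \<in> BV"
      "\<And>\<alpha> v. \<alpha> > 0 \<Longrightarrow> v \<in> BV \<Longrightarrow> energy \<psi> f \<alpha> (u \<alpha>) \<le> energy \<psi> f \<alpha> v"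
    and meas: "((\<lambda>\<alpha>. emeasure lebesgue (({x. u \<alpha> x > s} - {x. f x > s}) \<union> ({x. f x > s} - {x. u \<alpha> x > s})))
        \<longlongrightarrow> 0) (at_right 0)"
    and outer: "\<And>e. e > 0 \<Longrightarrow> \<exists>\<nu>>0. hausdist (canon {x. f x > s}) (canon {x. f x > s - \<nu>}) < ereal e"
    and inner: "\<And>e. e > 0 \<Longrightarrow>
      \<exists>\<nu>>0. hausdist (UNIV - canon {x. f x > s}) (UNIV - canon {x. f x > s + \<nu>}) < ereal e"
  shows "((\<lambda>\<alpha>. hausdist (mboundary {x. u \<alpha> x > s}) (mboundary {x. f x > s})) \<longlongrightarrow> 0) (at_right 0)"
proof -
  define G where "G = {x. f x > s}"
  define E where "E \<alpha> = {x. u \<alpha> x > s}" for \<alpha>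
  have fm: "f \<in> borel_measurable lebesgue" using f by (simp add: BV_def L1_loc_def)
  have super: "{x. g x > t} \<in> sets lebesgue" if g: "g \<in> borel_measurable lebesgue" for g :: "'a \<Rightarrow> real" and t
  proof -
    have "{x. g x > t} = g -` {t<..} \<inter> space lebesgue" by auto
    also have "\<dots> \<in> sets lebesgue" by (rule measurable_sets[OF g]) simp
    finally show ?thesis .
  qed
  have Gm: "G \<in> sets lebesgue" "{x. f x > t} \<in> sets lebesgue" for t
    unfolding G_def by (rule super[OF fm])+
  have um: "u \<alpha> \<in> borel_measurable lebesgue" if "\<alpha> > 0" for \<alpha>
    using u(1)[OF that] by (simp add: BV_def L1_loc_def)
  have Em: "E \<alpha> \<in> sets lebesgue" if "\<alpha> > 0" for \<alpha>
    unfolding E_def by (rule super[OF um[OF that]])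
  have AE_neg: "(AE x in lebesgue. x \<in> ball c r \<longrightarrow> g x \<le> t) \<longleftrightarrow> negligible {x \<in> ball c r. \<not> g x \<le> t}"
    if g: "g \<in> borel_measurable lebesgue" for c :: 'a and r t and g :: "'a \<Rightarrow> real"
  proof -
    have "{x \<in> ball c r. \<not> g x \<le> t} = ball c r \<inter> {x. g x > t}" by auto
    also have "\<dots> \<in> sets lebesgue" by (rule sets.Int[OF fmeasurableD[OF lmeasurable_ball] super[OF g]])
    finally have m: "{x \<in> ball c r. \<not> g x \<le> t} \<in> sets lebesgue" .
    have "(x \<in> ball c r \<longrightarrow> g x \<le> t) = (x \<notin> {x \<in> ball c r. \<not> g x \<le> t})" for x by blast
    then show ?thesis
      unfolding negligible_iff_null_sets AE_iff_null_sets[OF m] by presburger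
  qed
  have claim1: "eventually (\<lambda>\<alpha>. \<forall>x\<in>mboundary (E \<alpha>). \<exists>y\<in>mboundary G. dist x y \<le> e) (at_right 0)" if "e > 0" for e
  proof -
    have e2: "e / 2 > 0" using that by simp
    obtain \<nu>1 where n1: "\<nu>1 > 0" "hausdist (canon G) (canon {x. f x > s - \<nu>1}) < ereal (e / 2)"
      using outer[OF e2] by (auto simp: G_def)
    obtain \<nu>2 where n2: "\<nu>2 > 0" "hausdist (UNIV - canon G) (UNIV - canon {x. f x > s + \<nu>2}) < ereal (e / 2)"
      using inner[OF e2] by (auto simp: G_def)
    \<comment> \<open>The radius \<open>e / 2\<close> and the two gaps depend on \<open>e\<close>
      alone, so one threshold for \<alpha> serves all boundary points.\<close>
    define C where "C = (real DIM('a) + 4) / (e / 2)"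
    have C: "C > 0" using that by (simp add: C_def)
    \<comment> \<open>The second gap is halved because \<open>E\<close> is a strict superlevel set
      and the comparison principle gives a weak inequality: half of the gap feeds the principle, the
      other half makes \<open>u\<close> exceed \<open>s\<close> strictly.\<close>
    define k where "k = min (\<psi> \<nu>1 / \<nu>1) (\<psi> (\<nu>2 / 2) / (\<nu>2 / 2))"
    have k: "k > 0" using even_strictly_convex_pos[OF \<psi>] n1(1) n2(1) by (simp add: k_def)
    have "eventually (\<lambda>\<alpha>. \<alpha> \<in> {0<..<k / C}) (at_right 0)"
      using k C by (intro eventually_at_right_real) simp
    then show ?thesis
    proof eventually_elim
      case (elim \<alpha>)
      then have \<alpha>: "\<alpha> > 0" "\<alpha> * C < k" using C by (auto simp: field_simps)
      show ?case
      proof (rule ballI, rule ccontr)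
        fix x assume x: "x \<in> mboundary (E \<alpha>)" and far: "\<not> (\<exists>y\<in>mboundary G. dist x y \<le> e)"
        then have "ball x e \<inter> mboundary G = {}" by force
        then consider "negligible (G \<inter> ball x e)" | "negligible (ball x e - G)"
          using null_or_full_if_disjoint_mboundary[OF Gm(1)] by blast
        then show False
        proof cases
          case 1
          \<comment> \<open>A point of this intersection would have a point of
            \<open>canon G\<close> within \<open>e / 2\<close>, hence inside the ball of radius
            \<open>e\<close> on which \<open>G\<close> is null.\<close>
          have "canon {x. f x > s - \<nu>1} \<inter> ball x (e / 2) = {}"
          proof -
            have False if y: "y \<in> canon {x. f x > s - \<nu>1}" "y \<in> ball x (e / 2)" for y
            proof -
              obtain y' where y': "y' \<in> canon G" "dist y y' < e / 2" by (rule hausdist_lessD[OF n1(2) y(1)])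
              then have "y' \<in> ball x e" using y(2) dist_triangle[of x y' y] by simp
              then show False using null_ball_disjoint_canon[OF Gm(1) 1] y'(1) by blast
            qed
            then show ?thesis by blast
          qed
          from negligible_if_disjoint_canon[OF Gm(2) this]
          have "negligible {y \<in> ball x (e / 2). \<not> f y \<le> s - \<nu>1}"
            by (rule negligible_subset) auto
          then have "AE y in lebesgue. y \<in> ball x (e / 2) \<longrightarrow> f y \<le> s - \<nu>1" by (subst AE_neg[OF fm])
          then have "AE y in lebesgue. y \<in> ball x (e / 2) \<longrightarrow> u \<alpha> y \<le> s"
            using \<alpha>(2) by (intro minimizer_le_on_ball[OF \<psi> f u(1)[OF \<alpha>(1)] u(2)[OF \<alpha>(1)] e2 n1(1) \<alpha>(1)])
              (auto simp: C_def k_def)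
          then have "negligible {y \<in> ball x (e / 2). \<not> u \<alpha> y \<le> s}"
            by (subst (asm) AE_neg[OF um[OF \<alpha>(1)]])
          then have "negligible (E \<alpha> \<inter> ball x (e / 2))"
            by (rule negligible_subset) (auto simp: E_def)
          then show False using x e2 unfolding mboundary_iff[OF Em[OF \<alpha>(1)]] by blast
        next
          case 2
          \<comment> \<open>The same argument for complements: a missing point would have a point
            outside \<open>canon G\<close> within \<open>e / 2\<close>, inside a ball that
            \<open>G\<close> fills.\<close>
          have sub: "ball x (e / 2) \<subseteq> canon {x. f x > s + \<nu>2}"
          proof (rule subsetI, rule ccontr)
            fix y assume y: "y \<in> ball x (e / 2)" "y \<notin> canon {x. f x > s + \<nu>2}"
            then have "y \<in> UNIV - canon {x. f x > s + \<nu>2}" by blast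
            then obtain y' where y': "y' \<in> UNIV - canon G" "dist y y' < e / 2" by (rule hausdist_lessD[OF n2(2)])
            then have "y' \<in> ball x e" using y(1) dist_triangle[of x y' y] by simp
            then show False using full_ball_subset_canon[OF Gm(1) 2] y'(1) by blast
          qed
          have nn: "\<nu>2 / 2 > 0" using n2(1) by simp
          from negligible_if_subset_canon[OF Gm(2) sub]
          have "negligible {y \<in> ball x (e / 2). \<not> - f y \<le> - (s + \<nu>2 / 2) - \<nu>2 / 2}"
            by (rule negligible_subset) auto
          then have "AE y in lebesgue. y \<in> ball x (e / 2) \<longrightarrow> - f y \<le> - (s + \<nu>2 / 2) - \<nu>2 / 2"
            by (subst AE_neg[OF borel_measurable_uminus[OF fm]])
          \<comment> \<open>Evenness of \<psi> makes \<open>- u \<alpha>\<close> a minimizer for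
            \<open>- f\<close>, so the upper bound for it is the desired lower bound for
            \<open>u \<alpha>\<close>.\<close>
          moreover have "energy \<psi> (\<lambda>x. - f x) \<alpha> (\<lambda>x. - u \<alpha> x) \<le> energy \<psi> (\<lambda>x. - f x) \<alpha> v" if "v \<in> BV" for v
            using u(2)[OF \<alpha>(1) BV_uminus[OF that]] energy_uminus[of \<psi> f \<alpha> "u \<alpha>", OF \<psi>(2)]
              energy_uminus[of \<psi> f \<alpha> "\<lambda>x. - v x", OF \<psi>(2)] by simp
          ultimately have "AE y in lebesgue. y \<in> ball x (e / 2) \<longrightarrow> - u \<alpha> y \<le> - (s + \<nu>2 / 2)"
            using \<alpha>(2)
            by (intro minimizer_le_on_ball[OF \<psi> BV_uminus[OF f] BV_uminus[OF u(1)[OF \<alpha>(1)]] _ e2 nn \<alpha>(1)])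
              (auto simp: C_def k_def)
          then have "negligible {y \<in> ball x (e / 2). \<not> - u \<alpha> y \<le> - (s + \<nu>2 / 2)}"
            by (subst (asm) AE_neg[OF borel_measurable_uminus[OF um[OF \<alpha>(1)]]])
          then have "negligible (ball x (e / 2) - E \<alpha>)"
            by (rule negligible_subset) (use nn in \<open>auto simp: E_def\<close>)
          then show False using x e2 unfolding mboundary_iff[OF Em[OF \<alpha>(1)]] by blast
        qed
      qed
    qed
  qed
  have claim2: "eventually (\<lambda>\<alpha>. \<forall>x\<in>mboundary G. \<exists>y\<in>mboundary (E \<alpha>). dist x y \<le> e) (at_right 0)" if "e > 0" for e
  proof -
    have e2: "e / 2 > 0" using that by simp
    have "bounded (mboundary G)"
      using bounded_subset[OF bounded_closure[OF bdd]] mboundary_subset_closure[OF Gm(1)] by (simp add: G_def)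
    \<comment> \<open>Compactness reduces the boundary to finitely many balls, each holding positive
      mass of \<open>G\<close> and of its complement. The symmetric difference has to fall below
      finitely many positive numbers only.\<close>
    then have "compact (mboundary G)"
      using closed_mboundary[OF Gm(1)] by (simp add: compact_eq_bounded_closed)
    then obtain F where F: "F \<subseteq> mboundary G" "finite F" "mboundary G \<subseteq> (\<Union>x\<in>F. ball x (e / 2))"
    proof (rule compactE_image[of "mboundary G" "mboundary G" "\<lambda>x. ball x (e / 2)"])
      show "mboundary G \<subseteq> (\<Union>x\<in>mboundary G. ball x (e / 2))" using e2 by auto
    qed auto
    define m where "m \<alpha> = emeasure lebesgue ((E \<alpha> - G) \<union> (G - E \<alpha>))" for \<alpha>
    have m: "(m \<longlongrightarrow> 0) (at_right 0)" using meas unfolding m_def[abs_def] E_def G_def .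
    have "eventually (\<lambda>\<alpha>. m \<alpha> < emeasure lebesgue (G \<inter> ball x (e / 2)) \<and> m \<alpha> < emeasure lebesgue (ball x (e / 2) - G)) (at_right 0)"
      if "x \<in> F" for x
    proof -
      have "x \<in> mboundary G" using that F by blast
      then have "\<not> negligible (G \<inter> ball x (e / 2))" "\<not> negligible (ball x (e / 2) - G)"
        using e2 unfolding mboundary_iff[OF Gm(1)] by blast+
      moreover have "G \<inter> ball x (e / 2) \<in> sets lebesgue" "ball x (e / 2) - G \<in> sets lebesgue"
        by (rule sets.Int[OF Gm(1)] sets.Diff[OF _ Gm(1)]; rule fmeasurableD[OF lmeasurable_ball])+
      ultimately have "0 < emeasure lebesgue (G \<inter> ball x (e / 2))" "0 < emeasure lebesgue (ball x (e / 2) - G)"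
        using emeasure_eq_0_iff_negligible by (auto simp only: zero_less_iff_neq_zero)
      then show ?thesis by (intro eventually_conj order_tendstoD(2)[OF m])
    qed
    then have "eventually (\<lambda>\<alpha>. \<forall>x\<in>F. m \<alpha> < emeasure lebesgue (G \<inter> ball x (e / 2)) \<and> m \<alpha> < emeasure lebesgue (ball x (e / 2) - G)) (at_right 0)"
      using F(2) by (simp add: eventually_ball_finite_distrib)
    moreover have "eventually (\<lambda>\<alpha>::real. \<alpha> > 0) (at_right 0)" by (rule eventually_at_right_less)
    ultimately show ?thesis
    proof eventually_elim
      case (elim \<alpha>)
      show ?case
      proof (rule ballI, rule ccontr)
        fix x assume x: "x \<in> mboundary G" and far: "\<not> (\<exists>y\<in>mboundary (E \<alpha>). dist x y \<le> e)"
        obtain c where c: "c \<in> F" "x \<in> ball c (e / 2)" using x F(3) by blast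
        have sub: "ball c (e / 2) \<subseteq> ball x e"
        proof
          fix y assume "y \<in> ball c (e / 2)"
          then show "y \<in> ball x e" using c(2) dist_triangle[of x y c] by (simp add: dist_commute)
        qed
        have Ea: "E \<alpha> \<in> sets lebesgue" by (rule Em) (use elim in blast)
        have D: "(E \<alpha> - G) \<union> (G - E \<alpha>) \<in> sets lebesgue"
          by (rule sets.Un[OF sets.Diff[OF Ea Gm(1)] sets.Diff[OF Gm(1) Ea]])
        \<comment> \<open>The null set \<open>N\<close> absorbs the fact that
          \<open>E \<alpha>\<close> is empty or full in the ball only up to measure zero.\<close>
        have le: "emeasure lebesgue A \<le> m \<alpha>" if "A \<subseteq> ((E \<alpha> - G) \<union> (G - E \<alpha>)) \<union> N" "negligible N" for A N
        proof -
          have N: "N \<in> null_sets lebesgue" using that(2) by (simp add: negligible_iff_null_sets)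
          have "emeasure lebesgue A \<le> emeasure lebesgue (((E \<alpha> - G) \<union> (G - E \<alpha>)) \<union> N)"
            by (rule emeasure_mono[OF that(1)]) (rule sets.Un[OF D null_setsD2[OF N]])
          also have "\<dots> = m \<alpha>" unfolding m_def by (rule emeasure_Un_null_set[OF D N])
          finally show ?thesis .
        qed
        have "ball x e \<inter> mboundary (E \<alpha>) = {}" using far by force
        then consider "negligible (E \<alpha> \<inter> ball x e)" | "negligible (ball x e - E \<alpha>)"
          using null_or_full_if_disjoint_mboundary[OF Ea] by blast
        then show False
        proof cases
          case 1
          have "emeasure lebesgue (G \<inter> ball c (e / 2)) \<le> m \<alpha>" by (rule le[OF _ 1]) (use sub in blast)
          then show False using elim c(1) by (meson not_le)
        next
          case 2
          have "emeasure lebesgue (ball c (e / 2) - G) \<le> m \<alpha>" by (rule le[OF _ 2]) (use sub in blast)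
          then show False using elim c(1) by (meson not_le)
        qed
      qed
    qed
  qed
  have "((\<lambda>\<alpha>. hausdist (mboundary (E \<alpha>)) (mboundary G)) \<longlongrightarrow> 0) (at_right 0)"
  proof (rule order_tendstoI)
    fix a :: ereal assume "a < 0"
    then show "eventually (\<lambda>\<alpha>. a < hausdist (mboundary (E \<alpha>)) (mboundary G)) (at_right 0)"
      by (intro always_eventually allI order_less_le_trans[OF _ hausdist_nonneg])
  next
    fix a :: ereal assume "0 < a"
    then obtain e where e: "0 < ereal e" "ereal e < a" using ereal_dense2 by blast
    then have "e > 0" by simp
    from claim1[OF this] claim2[OF this]
    show "eventually (\<lambda>\<alpha>. hausdist (mboundary (E \<alpha>)) (mboundary G) < a) (at_right 0)"
    proof eventually_elim
      case (elim \<alpha>)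
      have "hausdist (mboundary (E \<alpha>)) (mboundary G) \<le> ereal e"
        by (rule hausdist_leI) (use elim \<open>e > 0\<close> in auto)
      then show ?case using e(2) by simp
    qed
  qed
  then show ?thesis unfolding E_def G_def .
qed

theorem theorem1p3:
  fixes \<psi> :: "real \<Rightarrow> real" and f :: "'a::euclidean_space \<Rightarrow> real"
    and u :: "real \<Rightarrow> 'a \<Rightarrow> real" and s :: real
  assumes "DIM('a) \<ge> 2"
    and "assumptionA DIM('a) \<psi>"
    and "f \<in> BV" and "bounded {x. f x \<noteq> 0}"
    and "\<forall>\<alpha>>0. u \<alpha> \<in> BV \<and> (\<forall>v\<in>BV. energy \<psi> f \<alpha> (u \<alpha>) \<le> energy \<psi> f \<alpha> v)"
    and "s \<noteq> 0"
    and "((\<lambda>\<alpha>. emeasure lebesgue ((levelset (u \<alpha>) s - levelset f s) \<union> (levelset f s - levelset (u \<alpha>) s)))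
           \<longlongrightarrow> 0) (at_right 0)"
    and "((\<lambda>\<nu>. hausdist (canon (levelset f s)) (canon (levelset f (s + \<nu>)))) \<longlongrightarrow> 0) (at 0)"
    and "((\<lambda>\<nu>. hausdist (UNIV - canon (levelset f s)) (UNIV - canon (levelset f (s + \<nu>)))) \<longlongrightarrow> 0) (at 0)"
  shows "((\<lambda>\<alpha>. hausdist (mboundary (levelset (u \<alpha>) s)) (mboundary (levelset f s))) \<longlongrightarrow> 0) (at_right 0)"
proof -
  have \<psi>: "strictly_convex \<psi>" "\<And>s. \<psi> (- s) = \<psi> s" "\<psi> 0 = 0"
    using assms(2) by (auto simp: assumptionA_def)
  have u: "\<And>\<alpha>. \<alpha> > 0 \<Longrightarrow> u \<alpha> \<in> BV"
      "\<And>\<alpha> v. \<alpha> > 0 \<Longrightarrow> v \<in> BV \<Longrightarrow> energy \<psi> f \<alpha> (u \<alpha>) \<le> energy \<psi> f \<alpha> v"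
    using assms(5) by blast+
  \<comment> \<open>Keeping \<nu> below the absolute value of \<open>s\<close> preserves the sign of
    the shifted level, so that \<open>levelset\<close> stays on the same branch. Both directions are
    recorded since \<open>outer\<close> and \<open>inner\<close> shift oppositely.\<close>
  have near: "\<exists>\<nu>>0. \<nu> < \<bar>s\<bar> \<and> h \<nu> < ereal e \<and> h (- \<nu>) < ereal e"
    if h: "(h \<longlongrightarrow> 0) (at 0)" and e: "e > 0" for h :: "real \<Rightarrow> ereal" and e
  proof -
    have "eventually (\<lambda>\<nu>. h \<nu> < ereal e) (at 0)"
      by (rule order_tendstoD(2)[OF h]) (use e in simp)
    then obtain d where d: "d > 0" "\<And>\<nu>. \<nu> \<noteq> 0 \<Longrightarrow> dist \<nu> 0 < d \<Longrightarrow> h \<nu> < ereal e"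
      unfolding eventually_at by auto
    define \<nu> where "\<nu> = min d \<bar>s\<bar> / 2"
    have "\<nu> > 0" "\<nu> < \<bar>s\<bar>" "\<nu> < d" using d(1) assms(6) by (auto simp: \<nu>_def)
    then show ?thesis using d(2)[of \<nu>] d(2)[of "- \<nu>"] by (intro exI[of _ \<nu>]) auto
  qed
  show ?thesis
  proof (cases "s > 0")
    case True
    have L: "levelset g t = {x. g x > t}" if "t > 0" for g :: "'a \<Rightarrow> real" and t
      using that by (simp add: levelset_def)
    have "((\<lambda>\<alpha>. hausdist (mboundary {x. u \<alpha> x > s}) (mboundary {x. f x > s})) \<longlongrightarrow> 0) (at_right 0)"
    proof (rule boundary_convergence[where u = u and f = f and s = s, OF \<psi> assms(3)])
      \<comment> \<open>A positive level confines the superlevel set to the bounded support of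
        \<open>f\<close>.\<close>
      show "bounded {x. f x > s}" by (rule bounded_subset[OF assms(4)]) (use True in auto)
      show "((\<lambda>\<alpha>. emeasure lebesgue (({x. u \<alpha> x > s} - {x. f x > s}) \<union> ({x. f x > s} - {x. u \<alpha> x > s})))
        \<longlongrightarrow> 0) (at_right 0)"
        using assms(7) unfolding L[OF True] .
      fix e :: real assume e: "e > 0"
      obtain \<nu> where \<nu>: "\<nu> > 0" "\<nu> < \<bar>s\<bar>" "hausdist (canon (levelset f s)) (canon (levelset f (s + - \<nu>))) < ereal e"
        using near[OF assms(8) e] by blast
      then have "hausdist (canon {x. f x > s}) (canon {x. f x > s - \<nu>}) < ereal e"
        using True by (simp add: L)
      then show "\<exists>\<nu>>0. hausdist (canon {x. f x > s}) (canon {x. f x > s - \<nu>}) < ereal e" using \<nu>(1) by blast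
      obtain \<nu> where \<nu>: "\<nu> > 0" "\<nu> < \<bar>s\<bar>" "hausdist (UNIV - canon (levelset f s)) (UNIV - canon (levelset f (s + \<nu>))) < ereal e"
        using near[OF assms(9) e] by blast
      then have "hausdist (UNIV - canon {x. f x > s}) (UNIV - canon {x. f x > s + \<nu>}) < ereal e"
        using True by (simp add: L)
      then show "\<exists>\<nu>>0. hausdist (UNIV - canon {x. f x > s}) (UNIV - canon {x. f x > s + \<nu>}) < ereal e" using \<nu>(1) by blast
    qed (rule u; assumption)+
    then show ?thesis unfolding L[OF True] .
  next
    case False
    then have s: "s < 0" using assms(6) by simp
    have L: "levelset g t = {x. - g x > - t}" if "t < 0" for g :: "'a \<Rightarrow> real" and t
      using that by (simp add: levelset_def)
    have "((\<lambda>\<alpha>. hausdist (mboundary {x. - u \<alpha> x > - s}) (mboundary {x. - f x > - s})) \<longlongrightarrow> 0) (at_right 0)"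
    proof (rule boundary_convergence[where u = "\<lambda>\<alpha> x. - u \<alpha> x" and f = "\<lambda>x. - f x" and s = "- s",
          OF \<psi> BV_uminus[OF assms(3)]])
      show "(\<lambda>x. - u \<alpha> x) \<in> BV" if "\<alpha> > 0" for \<alpha> by (rule BV_uminus[OF u(1)[OF that]])
      show "bounded {x. - f x > - s}" by (rule bounded_subset[OF assms(4)]) (use s in auto)
      show "((\<lambda>\<alpha>. emeasure lebesgue (({x. - u \<alpha> x > - s} - {x. - f x > - s}) \<union> ({x. - f x > - s} - {x. - u \<alpha> x > - s})))
        \<longlongrightarrow> 0) (at_right 0)"
        using assms(7) unfolding L[OF s] .
      show "energy \<psi> (\<lambda>x. - f x) \<alpha> (\<lambda>x. - u \<alpha> x) \<le> energy \<psi> (\<lambda>x. - f x) \<alpha> v" if "\<alpha> > 0" "v \<in> BV" for \<alpha> v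
        using u(2)[OF that(1) BV_uminus[OF that(2)]] energy_uminus[of \<psi> f \<alpha> "u \<alpha>", OF \<psi>(2)]
          energy_uminus[of \<psi> f \<alpha> "\<lambda>x. - v x", OF \<psi>(2)] by simp
      fix e :: real assume e: "e > 0"
      \<comment> \<open>After negation the level \<open>s + \<nu>\<close> becomes
        \<open>- s - \<nu>\<close>, so the two shifts trade places compared with positive
        \<open>s\<close>.\<close>
      obtain \<nu> where \<nu>: "\<nu> > 0" "\<nu> < \<bar>s\<bar>" "hausdist (canon (levelset f s)) (canon (levelset f (s + \<nu>))) < ereal e"
        using near[OF assms(8) e] by blast
      then have "hausdist (canon {x. - f x > - s}) (canon {x. - f x > - s - \<nu>}) < ereal e"
        using s by (simp add: L)
      then show "\<exists>\<nu>>0. hausdist (canon {x. - f x > - s}) (canon {x. - f x > - s - \<nu>}) < ereal e" using \<nu>(1) by blast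
      obtain \<nu> where \<nu>: "\<nu> > 0" "\<nu> < \<bar>s\<bar>" "hausdist (UNIV - canon (levelset f s)) (UNIV - canon (levelset f (s + - \<nu>))) < ereal e"
        using near[OF assms(9) e] by blast
      then have "hausdist (UNIV - canon {x. - f x > - s}) (UNIV - canon {x. - f x > - s + \<nu>}) < ereal e"
        using s by (simp add: L)
      then show "\<exists>\<nu>>0. hausdist (UNIV - canon {x. - f x > - s}) (UNIV - canon {x. - f x > - s + \<nu>}) < ereal e" using \<nu>(1) by blast
    qed
    then show ?thesis unfolding L[OF s] .
  qed
qed

end
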